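(* Let $\Gamma=\mathbb Z_2*\mathbb Z_3\cong \mathrm{PSL}(2,\mathbb Z)$ be the modular group endowed with the word distance determined by the generators of $\mathbb Z_2$ and $\mathbb Z_3$. The set of filling probability measures on $\Gamma$ is not closed under convolutions, nor under convex combinations. More specifically: (i) there are finitely supported probability measures $\mu_1,\mu_2$ on $\Gamma$ such that both $\mu_1$ and $\mu_2$ are filling, whereas their convolution $\mu_1*\mu_2$ is not filling; (ii) there are finitely supported probability measures $\mu_1,\mu_2$ on $\Gamma$ such that both $\mu_1$ and $\mu_2$ are filling, whereas for every $0<t<1$ their convex combination $t\mu_1+(1-t)\mu_2$ is not filling.
   Context: Write $\mathbb Z_2=\langle a\mid a^2\rangle$, $\mathbb Z_3=\langle b\mid b^3\rangle$, $\bar b=b^{-1}=b^2$. Elements of $\Gamma$ are identified with finite words in the alphabet $\{a,b,\bar b\}$ in which the letter $a$ and letters from $\{b,\bar b\}$ alternate (the empty word is the identity $e$). The word length $|g|$ is the length of this word, and the word distance is $\rho(g,h)=|g^{-1}h|$. Boundary. $\partial\Gamma$ is the set of right-infinite words in $\{a,b,\bar b\}$ subject to the same alternation rule, with the topology induced by the product topology; $\Gamma$ acts on $\partial\Gamma$ on the left by concatenation followed, if necessary, by reduction. $\partial \Gamma$ is the hyperbolic boundary of $\Gamma$; a sequence $g_n\in\Gamma$ converges to $\gamma\in\partial\Gamma$ if for every $k$ the first $k$ letters of $g_n$ coincide with those of $\gamma$ for all sufficiently large $n$. Random walks. A probability measure $\mu$ on $\Gamma$ is non-degenerate if its support generates $\Gamma$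 as a semigroup. Every probability measure considered here as a step distribution ($\mu_1$, $\mu_2$, $\mu_1*\mu_2$, $t\mu_1+(1-t)\mu_2$) is required to be non-degenerate. The convolution $\mu_1*\mu_2$ is the image of $\mu_1\otimes\mu_2$ under $(g,h)\mapsto gh$. For non-degenerate $\mu$, the sample paths $g_n=h_1h_2\cdots h_n$ (with $h_i$ independent and $\mu$-distributed) converge almost surely to $\partial\Gamma$; the distribution $\nu$ of the limit is the harmonic measure of $\mu$, and it is the unique probability measure on $\partial\Gamma$ with $\nu=\mu*\nu=\sum_g\mu(g)\,g\nu$. Filling measures. Endow $\partial\Gamma$ with the ultrametric $e^{-(\gamma_1|\gamma_2)}$, where $(\gamma_1|\gamma_2)$ is the length of the common part of the geodesic rays $[e,\gamma_1)$ and $[e,\gamma_2)$ in the Cayley graph of $\Gamma$ with respect to $\{a,b,\bar b\}$ (i.e. the length of the longest common initial segment of the words $\gamma_1,\gamma_2$). The conformal measure class of the word distance is the measure class of the Hausdorff measure of this metric space in its Hausdorff dimension $\frac{\log 2}{2}$ (the exponential growth rate of $\Gamma$). A measure $\mu$ on $\Gamma$ is filling if its harmonic measure belongs to this conformal measure class (i.e. is equivalent to this Hausdorff measure). *)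

theory Defs
  imports "HOL-Probability.Probability"
begin

section \<open>The modular group as reduced words\<close>

text \<open>\<open>La\<close> is the generator \<open>a\<close> of \<open>\<int>\<^sub>2\<close>, \<open>Lb\<close> the generator \<open>b\<close> of \<open>\<int>\<^sub>3\<close>, and
  \<open>Lb'\<close> its inverse \<open>b\<^sup>2\<close>.\<close>

datatype letter = La | Lb | Lb'

definition alt :: "letter \<Rightarrow> letter \<Rightarrow> bool" where
  "alt x y \<longleftrightarrow> (x = La) \<noteq> (y = La)"

definition reduced :: "letter list \<Rightarrow> bool" where
  "reduced w \<longleftrightarrow> successively alt w"

fun lcons :: "letter \<Rightarrow> letter list \<Rightarrow> letter list" where
  "lcons La (La # w) = w"
| "lcons Lb (Lb' # w) = w"
| "lcons Lb' (Lb # w) = w"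
| "lcons Lb (Lb # w) = Lb' # w"
| "lcons Lb' (Lb' # w) = Lb # w"
| "lcons x w = x # w"

lemma reduced_Nil [simp]: "reduced []"
  by (simp add: reduced_def)

lemma reduced_lcons: "reduced w \<Longrightarrow> reduced (lcons x w)"
  by (induction x w rule: lcons.induct)
    (auto simp: reduced_def alt_def successively_Cons)

lemma reduced_foldr_lcons: "reduced w \<Longrightarrow> reduced (foldr lcons v w)"
  by (induction v) (auto intro: reduced_lcons)

text \<open>The defining relations of \<open>\<int>\<^sub>2 * \<int>\<^sub>3\<close> hold for the action of the letters on reduced words.\<close>

lemma reduced_cases:
  assumes "reduced w"
  obtains "w = []" | "w = [La]" | "w = [Lb]" | "w = [Lb']" | u where "w = La # Lb # u" | u where "w = La # Lb' # u"
    | u where "w = Lb # La # u" | u where "w = Lb' # La # u"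
proof -
  consider "w = []" | x where "w = [x]" | x y u where "w = x # y # u"
    by (metis list.exhaust)
  then show ?thesis
  proof cases
    case (2 x)
    with that show ?thesis by (cases x) auto
  next
    case (3 x y u)
    with assms that show ?thesis
      by (cases x; cases y) (simp_all add: reduced_def alt_def)
  qed (use that in simp_all)
qed

lemma lcons_La_La: "reduced w \<Longrightarrow> lcons La (lcons La w) = w"
  by (erule reduced_cases) simp_all

lemma lcons_Lb_Lb: "reduced w \<Longrightarrow> lcons Lb (lcons Lb w) = lcons Lb' w"
  by (erule reduced_cases) simp_all

lemma lcons_Lb'_Lb': "reduced w \<Longrightarrow> lcons Lb' (lcons Lb' w) = lcons Lb w"
  by (erule reduced_cases) simp_all

lemma lcons_Lb_Lb': "reduced w \<Longrightarrow> lcons Lb (lcons Lb' w) = w"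
  by (erule reduced_cases) simp_all

lemma lcons_Lb'_Lb: "reduced w \<Longrightarrow> lcons Lb' (lcons Lb w) = w"
  by (erule reduced_cases) simp_all

lemma foldr_lcons_lcons:
  assumes "reduced k"
  shows "foldr lcons (lcons x h) k = lcons x (foldr lcons h k)"
  using assms
  by (induction x h rule: lcons.induct)
    (simp_all add: reduced_foldr_lcons lcons_La_La lcons_Lb_Lb lcons_Lb'_Lb' lcons_Lb_Lb' lcons_Lb'_Lb)

lemma foldr_lcons_assoc:
  assumes "reduced k"
  shows "foldr lcons (foldr lcons g h) k = foldr lcons g (foldr lcons h k)"
  using assms by (induction g) (simp_all add: foldr_lcons_lcons)

lemma foldr_lcons_Nil: "reduced g \<Longrightarrow> foldr lcons g [] = g"
proof (induction g)
  case (Cons x g)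
  then have "reduced g"
    by (auto simp: reduced_def successively_Cons)
  with Cons have "foldr lcons (x # g) [] = lcons x g" by simp
  also have "\<dots> = x # g"
    using Cons.prems by (rule reduced_cases) auto
  finally show ?case .
qed simp

typedef modgrp = "{w. reduced w}" morphisms word_of Modgrp
  by (rule exI[of _ "[]"]) simp

setup_lifting type_definition_modgrp

instantiation modgrp :: monoid_mult
begin

lift_definition one_modgrp :: modgrp is "[]" by simp

text \<open>Concatenation followed by reduction.\<close>

lift_definition times_modgrp :: "modgrp \<Rightarrow> modgrp \<Rightarrow> modgrp" is "\<lambda>g h. foldr lcons g h"
  by (rule reduced_foldr_lcons)

instance
  by standard (transfer; simp add: foldr_lcons_assoc foldr_lcons_Nil)+

end

lemma modgrp_inverse_exists: "\<exists>h::modgrp. h * g = 1 \<and> g * h = 1"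
proof -
  have ex_left: "\<exists>h::modgrp. h * g = 1" for g
  proof (transfer)
    fix w assume "reduced w"
    then show "\<exists>h\<in>{w. reduced w}. foldr lcons h w = []"
    proof (induction w)
      case (Cons x w)
      then have rw: "reduced w"
        by (auto simp: reduced_def successively_Cons)
      with Cons obtain h where h: "reduced h" "foldr lcons h w = []" by auto
      define y where "y = (case x of La \<Rightarrow> La | Lb \<Rightarrow> Lb' | Lb' \<Rightarrow> Lb)"
      have "foldr lcons (foldr lcons h [y]) (x # w) = foldr lcons h (lcons y (x # w))"
        using Cons.prems by (subst foldr_lcons_assoc) auto
      also have "lcons y (x # w) = w"
        by (cases x) (auto simp: y_def)
      finally have "foldr lcons (foldr lcons h [y]) (x # w) = []"
        using h by simp
      moreover have "reduced (foldr lcons h [y])"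
        by (rule reduced_foldr_lcons) (simp add: reduced_def)
      ultimately show ?case by auto
    qed (rule bexI[of _ "[]"]; simp)
  qed
  obtain h where h: "h * g = 1" using ex_left by blast
  obtain k where k: "k * h = 1" using ex_left by blast
  have "g = k"
    by (metis h k mult.assoc mult_1_left mult_1_right)
  with h k show ?thesis by blast
qed

section \<open>The boundary\<close>

typedef boundary = "{\<gamma> :: nat \<Rightarrow> letter. \<forall>n. alt (\<gamma> n) (\<gamma> (Suc n))}"
  morphisms letter_at Boundary
  by (rule exI[of _ "\<lambda>n. if even n then La else Lb"]) (auto simp: alt_def)

text \<open>Length of the longest common initial segment of two distinct boundary points, which is
  the length of the common part of the geodesic rays issued from the identity.\<close>

definition gromov_product :: "boundary \<Rightarrow> boundary \<Rightarrow> nat" where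
  "gromov_product \<gamma> \<delta> = (LEAST n. letter_at \<gamma> n \<noteq> letter_at \<delta> n)"

lemma gromov_product_ge_iff:
  assumes "\<gamma> \<noteq> \<delta>"
  shows "k \<le> gromov_product \<gamma> \<delta> \<longleftrightarrow> (\<forall>i<k. letter_at \<gamma> i = letter_at \<delta> i)"
proof -
  from assms obtain n where "letter_at \<gamma> n \<noteq> letter_at \<delta> n"
    by (metis ext letter_at_inject)
  then have "letter_at \<gamma> (gromov_product \<gamma> \<delta>) \<noteq> letter_at \<delta> (gromov_product \<gamma> \<delta>)"
    unfolding gromov_product_def by (rule LeastI)
  moreover have "letter_at \<gamma> i = letter_at \<delta> i" if "i < gromov_product \<gamma> \<delta>" for i
    using that not_less_Least unfolding gromov_product_def by blast
  ultimately show ?thesis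
    by (meson leI less_le_trans)
qed

instantiation boundary :: metric_space
begin

definition dist_boundary :: "boundary \<Rightarrow> boundary \<Rightarrow> real" where
  "dist_boundary \<gamma> \<delta> = (if \<gamma> = \<delta> then 0 else exp (- real (gromov_product \<gamma> \<delta>)))"

definition uniformity_boundary :: "(boundary \<times> boundary) filter" where
  "uniformity_boundary = (INF e\<in>{0<..}. principal {(x, y). dist x y < e})"

definition open_boundary :: "boundary set \<Rightarrow> bool" where
  "open_boundary U \<longleftrightarrow> (\<forall>x\<in>U. \<forall>\<^sub>F (x', y) in uniformity. x' = x \<longrightarrow> y \<in> U)"

lemma dist_boundary_le_iff:
  fixes \<gamma> \<delta> :: boundary
  shows "dist \<gamma> \<delta> \<le> exp (- real k) \<longleftrightarrow> (\<forall>i<k. letter_at \<gamma> i = letter_at \<delta> i)"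
  by (cases "\<gamma> = \<delta>") (auto simp: dist_boundary_def gromov_product_ge_iff[symmetric])

lemma dist_boundary_ultra:
  fixes x y z :: boundary
  shows "dist x y \<le> max (dist x z) (dist y z)"
proof (cases "x = z \<or> y = z")
  case True
  moreover have "gromov_product x y = gromov_product y x"
    unfolding gromov_product_def by metis
  ultimately show ?thesis
    by (auto simp: dist_boundary_def)
next
  case False
  define k where "k = min (gromov_product x z) (gromov_product y z)"
  have "\<forall>i<k. letter_at x i = letter_at z i" "\<forall>i<k. letter_at y i = letter_at z i"
    using False gromov_product_ge_iff[of x z k] gromov_product_ge_iff[of y z k]
    by (simp_all add: k_def)
  then have "dist x y \<le> exp (- real k)"
    by (simp add: dist_boundary_le_iff)
  also have "\<dots> \<le> max (dist x z) (dist y z)"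
    using False by (auto simp: dist_boundary_def k_def min_def)
  finally show ?thesis .
qed

instance
proof
  fix x y z :: boundary
  show "dist x y = 0 \<longleftrightarrow> x = y"
    by (simp add: dist_boundary_def)
  have "dist x z \<ge> 0" "dist y z \<ge> 0"
    by (simp_all add: dist_boundary_def)
  with dist_boundary_ultra[of x y z] show "dist x y \<le> dist x z + dist y z"
    by linarith
qed (simp_all add: uniformity_boundary_def open_boundary_def)

end

section \<open>Hausdorff measures\<close>

text \<open>The conventions make every power of the empty set vanish and turn the
  \<open>0\<close>-dimensional measure into the counting measure.\<close>

definition diam_power :: "real \<Rightarrow> 'a::metric_space set \<Rightarrow> ennreal" where
  "diam_power s U =
     (if U = {} then 0 else if s = 0 then 1 else ennreal (diameter U powr s))"

definition hausdorff_pre :: "real \<Rightarrow> real \<Rightarrow> 'a::metric_space set \<Rightarrow> ennreal" where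
  "hausdorff_pre s \<delta> A =
     (INF U\<in>{U :: nat \<Rightarrow> 'a set. A \<subseteq> (\<Union>i. U i) \<and> (\<forall>i. bounded (U i) \<and> diameter (U i) \<le> \<delta>)}.
        \<Sum>i. diam_power s (U i))"

definition hausdorff_outer :: "real \<Rightarrow> 'a::metric_space set \<Rightarrow> ennreal" where
  "hausdorff_outer s A = (SUP \<delta>\<in>{0<..}. hausdorff_pre s \<delta> A)"

definition hausdorff_measure :: "real \<Rightarrow> 'a::metric_space measure" where
  "hausdorff_measure s = measure_of UNIV (sets borel) (hausdorff_outer s)"

text \<open>Real-valued, hence meaningful only for sets of finite Hausdorff dimension.\<close>

definition hausdorff_dim :: "'a::metric_space set \<Rightarrow> real" where
  "hausdorff_dim A = Inf {s. 0 \<le> s \<and> hausdorff_outer s A = 0}"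

section \<open>Random walks, harmonic measures, filling measures\<close>

inductive_set semigroup_generated :: "'a::semigroup_mult set \<Rightarrow> 'a set" for S where
  base: "g \<in> S \<Longrightarrow> g \<in> semigroup_generated S"
| mult: "g \<in> semigroup_generated S \<Longrightarrow> h \<in> semigroup_generated S \<Longrightarrow> g * h \<in> semigroup_generated S"

definition nondegenerate :: "modgrp pmf \<Rightarrow> bool" where
  "nondegenerate \<mu> \<longleftrightarrow> semigroup_generated (set_pmf \<mu>) = UNIV"

definition convolution_pmf :: "'a::semigroup_mult pmf \<Rightarrow> 'a pmf \<Rightarrow> 'a pmf" where
  "convolution_pmf \<mu>\<^sub>1 \<mu>\<^sub>2 = map_pmf (\<lambda>(g, h). g * h) (pair_pmf \<mu>\<^sub>1 \<mu>\<^sub>2)"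

definition convex_comb_pmf :: "real \<Rightarrow> 'a pmf \<Rightarrow> 'a pmf \<Rightarrow> 'a pmf" where
  "convex_comb_pmf t \<mu>\<^sub>1 \<mu>\<^sub>2 = bind_pmf (bernoulli_pmf t) (\<lambda>c. if c then \<mu>\<^sub>1 else \<mu>\<^sub>2)"

lemma pmf_convex_comb_pmf:
  assumes "0 \<le> t" "t \<le> 1"
  shows "pmf (convex_comb_pmf t \<mu>\<^sub>1 \<mu>\<^sub>2) g = t * pmf \<mu>\<^sub>1 g + (1 - t) * pmf \<mu>\<^sub>2 g"
  using assms by (simp add: convex_comb_pmf_def pmf_bind integral_measure_pmf_real[of UNIV] UNIV_bool)

definition converges_to_boundary :: "(nat \<Rightarrow> modgrp) \<Rightarrow> boundary \<Rightarrow> bool" where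
  "converges_to_boundary g \<gamma> \<longleftrightarrow>
     (\<forall>k. \<forall>\<^sub>F n in sequentially. take k (word_of (g n)) = map (letter_at \<gamma>) [0..<k])"

definition boundary_limit :: "(nat \<Rightarrow> modgrp) \<Rightarrow> boundary" where
  "boundary_limit g = (THE \<gamma>. converges_to_boundary g \<gamma>)"

text \<open>The increments are indexed from \<open>0\<close>, so that the path is \<open>g\<^sub>n = h\<^sub>0 h\<^sub>1 \<dots> h\<^bsub>n-1\<^esub>\<close>.\<close>

definition sample_path :: "(nat \<Rightarrow> modgrp) \<Rightarrow> nat \<Rightarrow> modgrp" where
  "sample_path h n = prod_list (map h [0..<n])"

definition harmonic_measure :: "modgrp pmf \<Rightarrow> boundary measure" where
  "harmonic_measure \<mu> =
     distr (\<Pi>\<^sub>M i\<in>(UNIV :: nat set). measure_pmf \<mu>) borel (\<lambda>h. boundary_limit (sample_path h))"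

definition equivalent_measures :: "'a measure \<Rightarrow> 'a measure \<Rightarrow> bool" where
  "equivalent_measures M N \<longleftrightarrow> absolutely_continuous M N \<and> absolutely_continuous N M"

text \<open>The Hausdorff dimension of the boundary is \<open>ln 2 / 2\<close>.\<close>

definition filling :: "modgrp pmf \<Rightarrow> bool" where
  "filling \<mu> \<longleftrightarrow>
     equivalent_measures (harmonic_measure \<mu>) (hausdorff_measure (hausdorff_dim (UNIV :: boundary set)))"

end

theory Submission
  imports Defs
begin

text \<open>For step distributions supported on \<open>\<int>\<^sub>2 \<int>\<^sub>3\<close> the harmonic measure is
  multiplicative Markov: after the first letter, the letters \<open>b\<close>, \<open>b\<^sup>2\<close> are independent with
  probabilities \<open>p\<close>, \<open>1 - p\<close>. The Hausdorff measure corresponds to \<open>p = 1/2\<close> and is singular to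
  the others, so such a distribution is filling precisely if \<open>p = 1/2\<close>, which is a quadratic equation
  in its weights. A segment joining two points of this quadric but not contained in it settles convex
  combinations. For convolutions take \<open>\<kappa>\<close> on \<open>{a, b, b\<^sup>2}\<close>, symmetric under \<open>b \<leftrightarrow> b\<^sup>2\<close>: the filling
  measures \<open>\<kappa>\<close>, \<open>b\<kappa>b\<^sup>-\<^sup>1\<close>, \<open>b\<^sup>2\<kappa>b\<^sup>-\<^sup>2\<close> have product \<open>(\<kappa>b)\<^sup>3\<close>, which has the harmonic measure of \<open>\<kappa>b\<close>
  and is not filling; so one of the two successive convolutions leaves the filling class.

  A stationary measure \<open>\<nu>\<close> is recognised as the harmonic measure through the bounded martingales
  \<open>\<nu>(g\<^sub>n\<^sup>-\<^sup>1 D)\<close>: if \<open>\<nu>\<close> is not invariant, their square-summable increments force transience, hence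
  convergence to the boundary, and \<open>g\<^sub>n\<nu>\<close> then concentrates at the limit point.\<close>

section \<open>Words, boundary points and cylinders\<close>

text \<open>The support \<open>\<int>\<^sub>2 \<int>\<^sub>3\<close> is chosen for its action on the
  boundary. A boundary point is a first letter together with a sequence of binary choices between b
  and its inverse; a power of b only changes the first letter, and a only moves one choice across
  it. A step of this kind disturbs the Markov structure within the first two letters only, so
  stationarity becomes finitely many algebraic equations in p and the first-letter weights. As these
  weights are positive, the measure class depends on p alone. Convolution powers of \<kappa> keep
  its harmonic measure, so they yield no example; conjugation by b breaks the symmetry. It
  translates the harmonic measure by b, which permutes the first-letter weights and keeps p, while
  b^3 = 1 makes the product of the three conjugates telescope. The measure \<kappa>b has mass 1/2 at
  ab and none at a followed by the inverse of b, which violates the quadratic equation. Its third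
  power is no longer supported on \<open>\<int>\<^sub>2 \<int>\<^sub>3\<close>, so the criterion
  does not apply to it directly, but it inherits the stationary measure of \<kappa>b.\<close>

instance letter :: finite
proof
  have "(UNIV :: letter set) = {La, Lb, Lb'}"
    using letter.exhaust by blast
  then show "finite (UNIV :: letter set)" by (metis finite.emptyI finite_insert)
qed

lemma UNIV_letter: "(UNIV :: letter set) = {La, Lb, Lb'}"
  using letter.exhaust by blast

lemma alt_sym: "alt x y \<longleftrightarrow> alt y x"
  by (auto simp: alt_def)

lemma alt_letter_at: "alt (letter_at \<gamma> n) (letter_at \<gamma> (Suc n))"
  using letter_at[of \<gamma>] by simp

lemma reduced_ConsD: "reduced (x # w) \<Longrightarrow> reduced w"
  by (auto simp: reduced_def successively_Cons)

lemma reduced_Cons_Cons: "reduced (x # y # w) \<longleftrightarrow> alt x y \<and> reduced (y # w)"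
  by (simp add: reduced_def)

lemma reduced_word_of [simp]: "reduced (word_of g)"
  using word_of[of g] by simp

definition bprefix :: "nat \<Rightarrow> boundary \<Rightarrow> letter list" where
  "bprefix k \<gamma> = map (letter_at \<gamma>) [0..<k]"

definition cylinder :: "letter list \<Rightarrow> boundary set" where
  "cylinder w = {\<gamma>. bprefix (length w) \<gamma> = w}"

lemma length_bprefix [simp]: "length (bprefix k \<gamma>) = k"
  by (simp add: bprefix_def)

lemma bprefix_0 [simp]: "bprefix 0 \<gamma> = []"
  by (simp add: bprefix_def)

lemma nth_bprefix [simp]: "i < k \<Longrightarrow> bprefix k \<gamma> ! i = letter_at \<gamma> i"
  by (simp add: bprefix_def)

lemma take_bprefix: "j \<le> k \<Longrightarrow> take j (bprefix k \<gamma>) = bprefix j \<gamma>"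
  by (simp add: bprefix_def take_map)

lemma bprefix_eq_iff: "bprefix k \<gamma> = w \<longleftrightarrow> length w = k \<and> (\<forall>i<k. letter_at \<gamma> i = w ! i)"
  by (auto simp: list_eq_iff_nth_eq)

lemma boundary_eqI: "(\<And>n. letter_at \<gamma> n = letter_at \<delta> n) \<Longrightarrow> \<gamma> = \<delta>"
  by (metis ext letter_at_inject)

lemma reduced_bprefix: "reduced (bprefix k \<gamma>)"
  by (auto simp: reduced_def successively_conv_nth alt_letter_at)

section \<open>Letters acting on infinite words\<close>

definition bshift :: "boundary \<Rightarrow> boundary" where
  "bshift \<gamma> = Boundary (\<lambda>n. letter_at \<gamma> (Suc n))"

text \<open>Meaningful only if \<open>alt x (letter_at \<gamma> 0)\<close>; otherwise
  \<open>Boundary\<close> is applied outside its domain. Hence this premise in the facts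
  below.\<close>

definition bpre :: "letter \<Rightarrow> boundary \<Rightarrow> boundary" where
  "bpre x \<gamma> = Boundary (case_nat x (letter_at \<gamma>))"

lemma letter_at_bshift [simp]: "letter_at (bshift \<gamma>) n = letter_at \<gamma> (Suc n)"
  by (simp add: bshift_def Boundary_inverse alt_letter_at)

lemma letter_at_bpre: "alt x (letter_at \<gamma> 0) \<Longrightarrow> letter_at (bpre x \<gamma>) n = case_nat x (letter_at \<gamma>) n"
  by (subst bpre_def, subst Boundary_inverse) (auto simp: alt_letter_at split: nat.split)

lemma letter_at_bpre_0 [simp]: "alt x (letter_at \<gamma> 0) \<Longrightarrow> letter_at (bpre x \<gamma>) 0 = x"
  and letter_at_bpre_Suc [simp]: "alt x (letter_at \<gamma> 0) \<Longrightarrow> letter_at (bpre x \<gamma>) (Suc n) = letter_at \<gamma> n"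
  by (simp_all add: letter_at_bpre)

lemma bshift_bpre [simp]: "alt x (letter_at \<gamma> 0) \<Longrightarrow> bshift (bpre x \<gamma>) = \<gamma>"
  by (intro boundary_eqI) simp

lemma bpre_bshift [simp]: "x = letter_at \<gamma> 0 \<Longrightarrow> bpre x (bshift \<gamma>) = \<gamma>"
  by (intro boundary_eqI) (simp add: letter_at_bpre alt_letter_at split: nat.split)

text \<open>Infinite counterpart of \<open>lcons\<close>: no reduction, cancellation, or the merging
  of two equal letters b, b or of their inverses into the other one.\<close>

definition bcons :: "letter \<Rightarrow> boundary \<Rightarrow> boundary" where
  "bcons x \<gamma> =
     (let y = letter_at \<gamma> 0 in
      if alt x y then bpre x \<gamma>
      else if x = La \<or> x \<noteq> y then bshift \<gamma>
      else bpre (if x = Lb then Lb' else Lb) (bshift \<gamma>))"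

definition linv :: "letter \<Rightarrow> letter" where
  "linv x = (case x of La \<Rightarrow> La | Lb \<Rightarrow> Lb' | Lb' \<Rightarrow> Lb)"

lemma linv_simps [simp]: "linv La = La" "linv Lb = Lb'" "linv Lb' = Lb"
  by (simp_all add: linv_def)

lemma alt_simps [simp]: "\<not> alt x x" "alt La Lb" "alt La Lb'" "alt Lb La" "alt Lb' La"
  "\<not> alt Lb Lb'" "\<not> alt Lb' Lb"
  by (auto simp: alt_def)

lemma alt_La_iff [simp]: "alt La x \<longleftrightarrow> x \<noteq> La" "alt x La \<longleftrightarrow> x \<noteq> La"
  "alt Lb x \<longleftrightarrow> x = La" "alt Lb' x \<longleftrightarrow> x = La" "alt x Lb \<longleftrightarrow> x = La" "alt x Lb' \<longleftrightarrow> x = La"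
  by (auto simp: alt_def)

lemma letter_at_0_cases:
  obtains "letter_at \<gamma> 0 = La" "letter_at \<gamma> (Suc 0) \<noteq> La"
  | "letter_at \<gamma> 0 = Lb" "letter_at \<gamma> (Suc 0) = La"
  | "letter_at \<gamma> 0 = Lb'" "letter_at \<gamma> (Suc 0) = La"
  using alt_letter_at[of \<gamma> 0] by (cases "letter_at \<gamma> 0") auto

lemma bcons_La_La: "bcons La (bcons La \<gamma>) = \<gamma>"
  and bcons_Lb_Lb: "bcons Lb (bcons Lb \<gamma>) = bcons Lb' \<gamma>"
  and bcons_Lb'_Lb': "bcons Lb' (bcons Lb' \<gamma>) = bcons Lb \<gamma>"
  and bcons_Lb_Lb': "bcons Lb (bcons Lb' \<gamma>) = \<gamma>"
  and bcons_Lb'_Lb: "bcons Lb' (bcons Lb \<gamma>) = \<gamma>"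
  by (cases \<gamma> rule: letter_at_0_cases; simp add: bcons_def Let_def)+

lemma bcons_linv: "bcons (linv x) (bcons x \<gamma>) = \<gamma>"
  by (cases x) (simp_all add: bcons_La_La bcons_Lb_Lb' bcons_Lb'_Lb)

lemma foldr_bcons_lcons: "foldr bcons (lcons x h) \<gamma> = bcons x (foldr bcons h \<gamma>)"
  by (induction x h rule: lcons.induct)
    (simp_all add: bcons_La_La bcons_Lb_Lb bcons_Lb'_Lb' bcons_Lb_Lb' bcons_Lb'_Lb)

lemma foldr_bcons_foldr_lcons: "foldr bcons (foldr lcons g h) \<gamma> = foldr bcons g (foldr bcons h \<gamma>)"
  by (induction g) (simp_all add: foldr_bcons_lcons)

definition bact :: "modgrp \<Rightarrow> boundary \<Rightarrow> boundary" where
  "bact g \<gamma> = foldr bcons (word_of g) \<gamma>"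

lemma bact_mult: "bact (g * h) \<gamma> = bact g (bact h \<gamma>)"
  by (simp add: bact_def times_modgrp.rep_eq foldr_bcons_foldr_lcons)

lemma bact_1 [simp]: "bact 1 \<gamma> = \<gamma>"
  by (simp add: bact_def one_modgrp.rep_eq)

lemma bprefix_Suc: "bprefix (Suc k) \<gamma> = letter_at \<gamma> 0 # bprefix k (bshift \<gamma>)"
  by (auto simp: bprefix_eq_iff nth_Cons split: nat.split)

text \<open>Left multiplication by a letter shortens a word by at most one, so one further letter of
  \<gamma> determines the prefix. This makes the action measurable.\<close>

lemma bprefix_bcons: "bprefix k (bcons x \<gamma>) = take k (lcons x (bprefix (Suc k) \<gamma>))"
proof (cases "alt x (letter_at \<gamma> 0)")
  case True
  then have "lcons x (bprefix (Suc k) \<gamma>) = x # bprefix (Suc k) \<gamma>"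
    unfolding bprefix_Suc by (cases x; cases "letter_at \<gamma> 0") auto
  moreover have "bprefix k (bpre x \<gamma>) = take k (x # bprefix (Suc k) \<gamma>)"
    using True by (auto simp: bprefix_eq_iff letter_at_bpre nth_Cons split: nat.split)
  ultimately show ?thesis using True by (simp add: bcons_def)
next
  case False
  show ?thesis
  proof (cases "x = La \<or> x \<noteq> letter_at \<gamma> 0")
    case True
    with False have "lcons x (bprefix (Suc k) \<gamma>) = bprefix k (bshift \<gamma>)"
      unfolding bprefix_Suc by (cases x; cases "letter_at \<gamma> 0") auto
    with True False show ?thesis by (simp add: bcons_def)
  next
    case False2: False
    define z where "z = (if x = Lb then Lb' else Lb)"
    have l: "lcons x (bprefix (Suc k) \<gamma>) = z # bprefix k (bshift \<gamma>)"
      unfolding bprefix_Suc z_def using False False2 by (cases x; cases "letter_at \<gamma> 0") auto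
    have "alt z (letter_at (bshift \<gamma>) 0)"
      using False False2 by (cases \<gamma> rule: letter_at_0_cases) (auto simp: z_def)
    then have "bprefix k (bpre z (bshift \<gamma>)) = take k (z # bprefix k (bshift \<gamma>))"
      by (auto simp: bprefix_eq_iff letter_at_bpre nth_Cons split: nat.split)
    with l False False2 show ?thesis
      by (auto simp: bcons_def z_def Let_def)
  qed
qed

section \<open>Contraction of the boundary by long elements\<close>

definition winv :: "letter list \<Rightarrow> letter list" where
  "winv w = rev (map linv w)"

lemma length_winv [simp]: "length (winv w) = length w"
  by (simp add: winv_def)

lemma foldr_bcons_winv: "foldr bcons (winv w) (foldr bcons w \<gamma>) = \<gamma>"
  by (induction w) (simp_all add: winv_def bcons_linv)

lemma alt_linv [simp]: "alt (linv x) y \<longleftrightarrow> alt x y" "alt x (linv y) \<longleftrightarrow> alt x y"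
  by (cases x; cases y; simp)+

lemma reduced_winv: "reduced w \<Longrightarrow> reduced (winv w)"
  by (simp add: reduced_def winv_def successively_rev successively_map alt_sym)

lemma bprefix_foldr_bcons:
  assumes "reduced w" "w \<noteq> [] \<Longrightarrow> alt (last w) (letter_at \<delta> 0)"
  shows "bprefix (length w) (foldr bcons w \<delta>) = w"
  using assms
proof (induction w)
  case (Cons x w)
  have IH: "bprefix (length w) (foldr bcons w \<delta>) = w"
    using Cons by (auto dest: reduced_ConsD split: if_splits)
  have alt0: "alt x (letter_at (foldr bcons w \<delta>) 0)"
  proof (cases w)
    case Nil
    with Cons.prems show ?thesis by simp
  next
    case (Cons y v)
    then have "letter_at (foldr bcons w \<delta>) 0 = y"
      using IH by (auto simp: bprefix_Suc)
    with Cons.prems Cons show ?thesis by (simp add: reduced_Cons_Cons)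
  qed
  then have "bcons x (foldr bcons w \<delta>) = bpre x (foldr bcons w \<delta>)"
    by (simp add: bcons_def)
  with alt0 IH show ?case by (simp add: bprefix_Suc)
qed simp

text \<open>Multiplying \<delta> by the inverse of \<open>g\<close> cancels the common initial
  segment, which is shorter than \<open>k\<close>. At the first disagreement one more letter may be
  merged, and the rest of the inverse word survives untouched.\<close>

lemma winv_prefix:
  assumes "reduced g" "k \<le> length g" "bprefix k \<delta> \<noteq> take k g"
  shows "bprefix (length g - k) (foldr bcons (winv g) \<delta>) = take (length g - k) (winv g)"
  using assms
proof (induction g arbitrary: k \<delta>)
  case (Cons x g)
  obtain j where k: "k = Suc j"
    using Cons.prems by (cases k) auto
  have rg: "reduced g" using Cons.prems(1) by (rule reduced_ConsD)
  have w: "winv (x # g) = winv g @ [linv x]" by (simp add: winv_def)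
  have lw: "length (winv g) = length g" by (simp add: winv_def)
  show ?case
  proof (cases "letter_at \<delta> 0 = x")
    case True
    then have "bcons (linv x) \<delta> = bshift \<delta>"
      by (cases x) (auto simp: bcons_def)
    moreover have "bprefix j (bshift \<delta>) \<noteq> take j g"
      using Cons.prems True by (simp add: k bprefix_Suc)
    ultimately show ?thesis
      using Cons.IH[of j "bshift \<delta>"] Cons.prems rg by (simp add: w k lw)
  next
    case False
    have a: "x = La \<longleftrightarrow> letter_at (bcons (linv x) \<delta>) 0 = La"
      using False by (cases \<delta> rule: letter_at_0_cases; cases x) (auto simp: bcons_def)
    have "alt (last (winv g)) (letter_at (bcons (linv x) \<delta>) 0)" if ne: "winv g \<noteq> []"
    proof -
      obtain y v where g: "g = y # v"
        using ne by (cases g) (simp_all add: winv_def)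
      have "alt x y" using Cons.prems by (simp add: g reduced_Cons_Cons)
      moreover have "last (winv g) = linv y" by (simp add: winv_def g)
      ultimately show ?thesis using a by (cases x; cases y) (auto simp: alt_def)
    qed
    then have "bprefix (length g) (foldr bcons (winv g) (bcons (linv x) \<delta>)) = winv g"
      using bprefix_foldr_bcons[of "winv g"] reduced_winv[OF rg] lw by auto
    then have "take (length g - j) (bprefix (length g) (foldr bcons (winv g) (bcons (linv x) \<delta>)))
        = take (length g - j) (winv g)" by simp
    then show ?thesis
      by (simp add: w k lw take_bprefix)
  qed
qed simp

text \<open>North-south dynamics: the points that \<open>g\<close> does not send close to its own
  initial segment all lie in one cylinder, which is long when \<open>g\<close> is long.\<close>

lemma bact_prefix:
  assumes "k \<le> length (word_of g)" "bprefix k (bact g \<gamma>) \<noteq> take k (word_of g)"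
  shows "\<gamma> \<in> cylinder (take (length (word_of g) - k) (winv (word_of g)))"
  using winv_prefix[of "word_of g" k "bact g \<gamma>"] assms
  by (simp add: bact_def foldr_bcons_winv cylinder_def length_winv)

section \<open>Stability of initial segments under right multiplication\<close>

lemma foldr_lcons_single:
  assumes "reduced g"
  shows "length g - 1 \<le> length (foldr lcons g [x])
    \<and> take (length g - 1) (foldr lcons g [x]) = take (length g - 1) g"
proof (cases g rule: rev_cases)
  case (snoc u y)
  have ru: "foldr lcons u [z] = u @ [z]" if "\<And>v. alt v y \<Longrightarrow> alt v z" for z
  proof -
    have "reduced (u @ [z])"
      using assms that by (auto simp: snoc reduced_def successively_append_iff)
    then show ?thesis using foldr_lcons_Nil[of "u @ [z]"] by (cases z) auto
  qed
  have ruy: "foldr lcons u [] = u"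
    using assms foldr_lcons_Nil by (auto simp: snoc reduced_def successively_append_iff)
  have ruz: "foldr lcons u [y, x] = u @ [y, x]" if "alt y x"
  proof -
    have "reduced (u @ [y, x])"
      using assms that by (auto simp: snoc reduced_def successively_append_iff successively_Cons)
    moreover have "foldr lcons [y, x] [] = [y, x]" using that by (cases x; cases y) auto
    ultimately show ?thesis using foldr_lcons_Nil[of "u @ [y, x]"] by simp
  qed
  \<comment> \<open>The last letter \<open>y\<close> cancels with \<open>x\<close>, merges with it
    into another power of b, or stays and is followed by \<open>x\<close>.\<close>
  consider "lcons y [x] = []" | z where "lcons y [x] = [z]" "\<And>v. alt v y \<Longrightarrow> alt v z"
    | "lcons y [x] = [y, x]" "alt y x"
    by (cases x; cases y) (auto simp: alt_def)
  then show ?thesis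
    by cases (auto simp: snoc ru ruy ruz)
qed simp

text \<open>Each letter multiplied from the right disturbs at most the last letter of the current
  word, so \<open>w\<close> disturbs at most \<open>length w\<close> letters of
  \<open>g\<close>.\<close>

lemma foldr_lcons_prefix:
  assumes "reduced g" "reduced w"
  shows "length g - length w \<le> length (foldr lcons g w) \<and>
    take (length g - length w) (foldr lcons g w) = take (length g - length w) g"
  using assms
proof (induction w arbitrary: g)
  case Nil
  then show ?case by (simp add: foldr_lcons_Nil)
next
  case (Cons x w)
  define h where "h = foldr lcons g [x]"
  have rw: "reduced w" using Cons.prems(2) by (rule reduced_ConsD)
  have rh: "reduced h" unfolding h_def by (rule reduced_foldr_lcons) (simp add: reduced_def)
  have "x # w = foldr lcons [x] w"
    using Cons.prems(2) by (cases rule: reduced_cases) auto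
  then have eq: "foldr lcons g (x # w) = foldr lcons h w"
    using foldr_lcons_assoc[OF rw, of g "[x]"] by (simp add: h_def)
  have h: "length g - 1 \<le> length h" "take (length g - 1) h = take (length g - 1) g"
    using foldr_lcons_single[OF Cons.prems(1), of x] by (auto simp: h_def)
  have i: "length h - length w \<le> length (foldr lcons h w)"
    "take (length h - length w) (foldr lcons h w) = take (length h - length w) h"
    using Cons.IH[OF rh rw] by auto
  define n where "n = length g - length (x # w)"
  have n: "n \<le> length h - length w" "n \<le> length g - 1" using h(1) by (auto simp: n_def)
  have "take n (foldr lcons h w) = take n h"
    using i(2) n(1) by (metis min.absorb1 take_take)
  also have "\<dots> = take n g"
    using h(2) n(2) by (metis min.absorb1 take_take)
  finally show ?case
    using eq i(1) n unfolding n_def[symmetric] by simp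
qed

lemma word_of_mult_prefix:
  "k + length (word_of s) \<le> length (word_of g) \<Longrightarrow> take k (word_of (g * s)) = take k (word_of g)"
  using foldr_lcons_prefix[of "word_of g" "word_of s"]
  by (simp add: times_modgrp.rep_eq) (metis le_diff_conv2 min.absorb1 take_take add_leD2)

section \<open>The topology of the boundary\<close>

lemma bprefix_eq_dist: "bprefix k \<gamma> = bprefix k \<delta> \<longleftrightarrow> dist \<gamma> \<delta> \<le> exp (- real k)"
  by (auto simp: dist_boundary_le_iff bprefix_eq_iff)

lemma mem_cylinder_bprefix: "\<delta> \<in> cylinder (bprefix k \<gamma>) \<longleftrightarrow> bprefix k \<delta> = bprefix k \<gamma>"
  by (simp add: cylinder_def)

lemma cylinder_Nil [simp]: "cylinder [] = UNIV"
  by (simp add: cylinder_def)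

lemma open_cylinder: "open (cylinder w)"
proof (unfold open_dist, intro ballI exI conjI allI impI)
  fix \<gamma> \<delta> assume "\<gamma> \<in> cylinder w" "dist \<delta> \<gamma> < exp (- real (length w))"
  then show "\<delta> \<in> cylinder w"
    using bprefix_eq_dist[of "length w" \<delta> \<gamma>] by (simp add: cylinder_def)
qed simp

lemma exp_neg_small:
  assumes "0 < e" shows "\<exists>k::nat. exp (- real k) < e"
proof -
  obtain k :: nat where "- ln e < real k" using reals_Archimedean2 by blast
  then have "exp (- real k) < exp (ln e)" by simp
  with assms show ?thesis by auto
qed

lemma open_boundary_cylinder:
  assumes "open U" "\<gamma> \<in> U"
  shows "\<exists>k. cylinder (bprefix k \<gamma>) \<subseteq> U"
proof -
  obtain e where e: "0 < e" "\<And>\<delta>. dist \<delta> \<gamma> < e \<Longrightarrow> \<delta> \<in> U"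
    using assms unfolding open_dist by blast
  obtain k :: nat where "exp (- real k) < e"
    using exp_neg_small[OF e(1)] by blast
  then have "cylinder (bprefix k \<gamma>) \<subseteq> U"
    using e(2) by (auto simp: mem_cylinder_bprefix bprefix_eq_dist)
  then show ?thesis ..
qed

lemma topological_basis_cylinder: "topological_basis (range cylinder)"
proof (rule topological_basisI)
  fix U :: "boundary set" and \<gamma> assume "open U" "\<gamma> \<in> U"
  then obtain k where "cylinder (bprefix k \<gamma>) \<subseteq> U"
    using open_boundary_cylinder by blast
  then show "\<exists>B\<in>range cylinder. \<gamma> \<in> B \<and> B \<subseteq> U"
    by (intro bexI[of _ "cylinder (bprefix k \<gamma>)"]) (auto simp: mem_cylinder_bprefix)
qed (auto simp: open_cylinder)

instance boundary :: second_countable_topology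
  by standard
    (metis countable_image countableI_type topological_basis_cylinder topological_basis_imp_subbasis)

text \<open>Common source of boundary points given by approximation: limits of Cauchy sequences and
  limits of sample paths.\<close>

lemma compatible_prefixes:
  assumes len: "\<And>k. length (p k) = k"
    and red: "\<And>k. reduced (p k)" and ext: "\<And>j k. j \<le> k \<Longrightarrow> take j (p k) = p j"
  shows "\<exists>\<gamma>. \<forall>k. bprefix k \<gamma> = p k"
proof -
  define f where "f n = p (Suc n) ! n" for n
  have nth: "p k ! n = f n" if "n < k" for n k
    using ext[of "Suc n" k] that nth_take[of n "Suc n" "p k"] by (simp add: f_def)
  have "alt (f n) (f (Suc n))" for n
    using red[of "Suc (Suc n)"] nth[of n "Suc (Suc n)"] nth[of "Suc n" "Suc (Suc n)"] len
    by (auto simp: reduced_def successively_conv_nth)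
  then have "letter_at (Boundary f) = f"
    by (simp add: Boundary_inverse)
  then have "\<forall>k. bprefix k (Boundary f) = p k"
    using nth len by (auto simp: bprefix_eq_iff)
  then show ?thesis ..
qed

text \<open>With second countability this puts the boundary among the Polish spaces, where finite
  Borel measures are outer regular; the comparison with the Hausdorff measure rests on that.\<close>

instance boundary :: complete_space
proof
  fix X :: "nat \<Rightarrow> boundary" assume X: "Cauchy X"
  have "\<exists>N. \<forall>n\<ge>N. bprefix k (X n) = bprefix k (X N)" for k
  proof -
    obtain N where "\<And>m n. m \<ge> N \<Longrightarrow> n \<ge> N \<Longrightarrow> dist (X m) (X n) < exp (- real k)"
      using X unfolding Cauchy_def by (meson exp_gt_zero)
    then show ?thesis
      by (intro exI[of _ N]) (auto simp: bprefix_eq_dist intro: less_imp_le)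
  qed
  then have "\<forall>k. \<exists>N. \<forall>n\<ge>N. bprefix k (X n) = bprefix k (X N)" ..
  from choice[OF this] obtain N
    where N0: "\<forall>k. \<forall>n\<ge>N k. bprefix k (X n) = bprefix k (X (N k))" ..
  have N: "bprefix k (X n) = bprefix k (X (N k))" if "n \<ge> N k" for k n
    by (rule N0[rule_format, OF that])
  have "\<exists>\<gamma>. \<forall>k. bprefix k \<gamma> = bprefix k (X (N k))"
  proof (rule compatible_prefixes)
    fix j k :: nat assume "j \<le> k"
    define n where "n = max (N j) (N k)"
    have "bprefix k (X n) = bprefix k (X (N k))" "bprefix j (X n) = bprefix j (X (N j))"
      by (rule N, simp add: n_def)+
    with \<open>j \<le> k\<close> show "take j (bprefix k (X (N k))) = bprefix j (X (N j))"
      by (metis take_bprefix)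
  qed (simp_all add: reduced_bprefix)
  then obtain \<gamma> where \<gamma>: "\<forall>k. bprefix k \<gamma> = bprefix k (X (N k))" ..
  have "X \<longlonglongrightarrow> \<gamma>"
  proof (rule metric_LIMSEQ_I)
    fix e :: real assume "0 < e"
    then obtain k :: nat where k: "exp (- real k) < e" using exp_neg_small by blast
    have "dist (X n) \<gamma> < e" if "n \<ge> N k" for n
      using N[OF that] \<gamma>[rule_format, of k] k bprefix_eq_dist[of k "X n" \<gamma>] by simp
    then show "\<exists>no. \<forall>n\<ge>no. dist (X n) \<gamma> < e" by blast
  qed
  then show "convergent X" by (rule convergentI)
qed

lemma borel_boundary: "(borel :: boundary measure) = sigma UNIV (range cylinder)"
  by (rule borel_eq_countable_basis) (auto simp: topological_basis_cylinder)

lemma measurable_boundaryI: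
  assumes "\<And>w. {x \<in> space M. f x \<in> cylinder w} \<in> sets M"
  shows "f \<in> M \<rightarrow>\<^sub>M borel"
  unfolding borel_boundary
  by (rule measurable_measure_of)
    (use assms in \<open>auto simp: vimage_def Int_def conj_commute\<close>)

lemma cylinder_borel [measurable]: "cylinder w \<in> sets borel"
  by (simp add: open_cylinder)

lemma measurable_bprefix [measurable]: "bprefix k \<in> borel \<rightarrow>\<^sub>M count_space UNIV"
proof (subst measurable_count_space_eq2_countable, safe)
  fix w
  have "bprefix k -` {w} \<inter> space borel = (if length w = k then cylinder w else {})"
    by (auto simp: cylinder_def)
  then show "bprefix k -` {w} \<inter> space borel \<in> sets borel" by simp
qed auto

lemma measurable_boundary_iff:
  "f \<in> M \<rightarrow>\<^sub>M borel \<longleftrightarrow> (\<forall>k. (\<lambda>x. bprefix k (f x)) \<in> M \<rightarrow>\<^sub>M count_space UNIV)"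
proof safe
  assume f: "\<forall>k. (\<lambda>x. bprefix k (f x)) \<in> M \<rightarrow>\<^sub>M count_space UNIV"
  show "f \<in> M \<rightarrow>\<^sub>M borel"
  proof (rule measurable_boundaryI)
    fix w
    have "(\<lambda>x. bprefix (length w) (f x)) -` {w} \<inter> space M \<in> sets M"
      by (rule measurable_sets[OF f[rule_format]]) simp
    then show "{x \<in> space M. f x \<in> cylinder w} \<in> sets M"
      by (simp add: cylinder_def vimage_def Int_def conj_commute)
  qed
next
  fix k assume [measurable]: "f \<in> M \<rightarrow>\<^sub>M borel"
  show "(\<lambda>x. bprefix k (f x)) \<in> M \<rightarrow>\<^sub>M count_space UNIV" by measurable
qed

lemma measurable_bcons [measurable]: "bcons x \<in> borel \<rightarrow>\<^sub>M borel"
proof -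
  have "(\<lambda>\<gamma>. take k (lcons x (bprefix (Suc k) \<gamma>))) \<in> borel \<rightarrow>\<^sub>M count_space UNIV" for k
    by measurable
  then show ?thesis
    by (simp add: measurable_boundary_iff bprefix_bcons)
qed

lemma measurable_foldr_bcons [measurable]: "foldr bcons w \<in> borel \<rightarrow>\<^sub>M borel"
  by (induction w) (auto intro: measurable_comp)

lemma measurable_bact [measurable]: "bact g \<in> borel \<rightarrow>\<^sub>M borel"
  unfolding bact_def by measurable

lemma vimage_bact_borel [measurable]: "N \<in> sets borel \<Longrightarrow> bact g -` N \<in> sets borel"
  using measurable_sets[OF measurable_bact, of N g] by simp

lemma cylinder_Int: "cylinder v \<inter> cylinder w \<in> insert {} (range cylinder)"
proof -
  have *: "cylinder v \<inter> cylinder w \<in> insert {} (range cylinder)" if "length v \<le> length w" for v w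
  proof (cases "take (length v) w = v")
    case True
    have "bprefix (length v) \<gamma> = v" if "bprefix (length w) \<gamma> = w" for \<gamma>
      using True that \<open>length v \<le> length w\<close> by (metis take_bprefix)
    then have "cylinder w \<subseteq> cylinder v"
      by (auto simp: cylinder_def)
    then have "cylinder v \<inter> cylinder w = cylinder w" by blast
    then show ?thesis by blast
  next
    case False
    have False if "bprefix (length v) \<gamma> = v" "bprefix (length w) \<gamma> = w" for \<gamma>
      using False that \<open>length v \<le> length w\<close> by (metis take_bprefix)
    then have "cylinder v \<inter> cylinder w = {}"
      by (auto simp: cylinder_def)
    then show ?thesis by blast
  qed
  show ?thesis
    using *[of v w] *[of w v] by (metis Int_commute nat_le_linear)
qed

lemma boundary_measure_eqI:
  assumes M: "sets M = sets borel" and N: "sets N = sets borel"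
    and fin: "emeasure M UNIV \<noteq> \<infinity>"
    and eq: "\<And>w. emeasure M (cylinder w) = emeasure N (cylinder w)"
  shows "M = N"
proof (rule measure_eqI_generator_eq[where E="insert {} (range cylinder)" and \<Omega>=UNIV and A="\<lambda>_. UNIV"])
  show "Int_stable (insert {} (range cylinder))"
    using cylinder_Int unfolding Int_stable_def by fastforce
  have "sigma_sets UNIV (range cylinder) = sigma_sets UNIV (insert {} (range cylinder))"
    by (intro sigma_sets_eqI) (auto intro: sigma_sets.intros)
  moreover have "sets (borel :: boundary measure) = sigma_sets UNIV (range cylinder)"
    by (simp add: borel_boundary)
  ultimately show "sets M = sigma_sets UNIV (insert {} (range cylinder))"
    "sets N = sigma_sets UNIV (insert {} (range cylinder))"
    using M N by simp_all
  show "range (\<lambda>_. UNIV) \<subseteq> insert {} (range cylinder)"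
    using cylinder_Nil by (metis image_subset_iff insertI2 rangeI)
qed (use fin eq in auto)

section \<open>Sample paths\<close>

instance modgrp :: countable
  by (rule countable_classI[of "\<lambda>g. to_nat (word_of g)"]) (simp add: word_of_inject)

lemma convolution_pmf_bind:
  "convolution_pmf A B = bind_pmf A (\<lambda>g. map_pmf (\<lambda>h. g * h) B)"
  by (simp add: convolution_pmf_def pair_pmf_def map_bind_pmf map_pmf_def bind_assoc_pmf bind_return_pmf)

lemma convolution_pmf_assoc:
  "convolution_pmf (convolution_pmf A B) C = convolution_pmf A (convolution_pmf B C)"
  by (simp add: convolution_pmf_bind map_bind_pmf bind_assoc_pmf bind_map_pmf pmf.map_comp o_def
      mult.assoc[abs_def])

lemma nn_integral_convolution_pmf:
  "(\<integral>\<^sup>+g. F g \<partial>convolution_pmf A B) = (\<integral>\<^sup>+g. \<integral>\<^sup>+h. F (g * h) \<partial>B \<partial>A)"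
  by (simp add: convolution_pmf_def nn_integral_map_pmf nn_integral_pair_pmf')

lemma set_convolution_pmf: "set_pmf (convolution_pmf A B) = {g * h | g h. g \<in> set_pmf A \<and> h \<in> set_pmf B}"
  by (auto simp: convolution_pmf_def image_iff)

primrec walk_pmf :: "'a::monoid_mult pmf \<Rightarrow> nat \<Rightarrow> 'a pmf" where
  "walk_pmf \<mu> 0 = return_pmf 1"
| "walk_pmf \<mu> (Suc n) = convolution_pmf \<mu> (walk_pmf \<mu> n)"

text \<open>The definition splits off the first increment, as the product space does; the martingale
  computations need the last one split off.\<close>

lemma walk_pmf_Suc': "walk_pmf \<mu> (Suc n) = convolution_pmf (walk_pmf \<mu> n) \<mu>"
proof (induction n)
  case 0
  then show ?case
    by (simp add: convolution_pmf_bind bind_return_pmf bind_return_pmf' pmf.map_ident_strong)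
next
  case (Suc n)
  then show ?case
    by (metis convolution_pmf_assoc walk_pmf.simps(2))
qed

abbreviation increments :: "modgrp pmf \<Rightarrow> (nat \<Rightarrow> modgrp) measure" where
  "increments \<mu> \<equiv> \<Pi>\<^sub>M i\<in>(UNIV :: nat set). measure_pmf \<mu>"

lemma sequence_space_pmf: "sequence_space (measure_pmf \<mu>)"
  by unfold_locales

lemma sample_path_Suc: "sample_path h (Suc n) = sample_path h n * h n"
  by (simp add: sample_path_def)

lemma sample_path_case_nat: "sample_path (case_nat s h) (Suc n) = s * sample_path h n"
proof -
  have "map (case_nat s h) [Suc 0..<Suc n] = map h [0..<n]"
    by (subst map_Suc_upt[symmetric]) (simp add: o_def)
  then show ?thesis
    by (simp add: sample_path_def upt_conv_Cons del: upt_Suc)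
qed

lemma measurable_sample_path [measurable]:
  "(\<lambda>h. sample_path h n) \<in> increments \<mu> \<rightarrow>\<^sub>M count_space UNIV"
proof (induction n)
  case (Suc n)
  have hn: "(\<lambda>h. h n) \<in> increments \<mu> \<rightarrow>\<^sub>M count_space UNIV"
    using measurable_component_singleton[of n UNIV "\<lambda>_. measure_pmf \<mu>"]
    by (simp add: measurable_cong_sets[OF refl sets_measure_pmf_count_space])
  have "(\<lambda>h. sample_path h n * s) \<in> increments \<mu> \<rightarrow>\<^sub>M count_space UNIV" for s
    using measurable_compose[OF Suc, of "\<lambda>g. g * s" "count_space UNIV"] by simp
  from measurable_compose_countable[OF this hn] show ?case
    unfolding sample_path_Suc .
qed (simp add: sample_path_def)

lemma nn_integral_sample_path:
  "(\<integral>\<^sup>+h. F (sample_path h n) \<partial>increments \<mu>) = (\<integral>\<^sup>+g. F g \<partial>walk_pmf \<mu> n)"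
proof (induction n arbitrary: F)
  case 0
  interpret prob_space "increments \<mu>" by (intro prob_space_PiM measure_pmf.prob_space_axioms)
  show ?case by (simp add: sample_path_def emeasure_space_1)
next
  case (Suc n)
  interpret sequence_space "measure_pmf \<mu>" by (rule sequence_space_pmf)
  have "(\<integral>\<^sup>+h. F (sample_path h (Suc n)) \<partial>increments \<mu>)
      = (\<integral>\<^sup>+h. F (sample_path h (Suc n)) \<partial>distr (measure_pmf \<mu> \<Otimes>\<^sub>M increments \<mu>) (increments \<mu>) (\<lambda>(s, h). case_nat s h))"
    by (simp add: PiM_iter)
  also have "\<dots> = (\<integral>\<^sup>+x. F (sample_path (case_nat (fst x) (snd x)) (Suc n)) \<partial>(measure_pmf \<mu> \<Otimes>\<^sub>M increments \<mu>))"
    by (subst nn_integral_distr) (auto simp: split_beta')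
  also have "\<dots> = (\<integral>\<^sup>+s. \<integral>\<^sup>+h. F (sample_path (case_nat s h) (Suc n)) \<partial>increments \<mu> \<partial>measure_pmf \<mu>)"
    by (subst P.nn_integral_fst[symmetric]) simp_all
  also have "\<dots> = (\<integral>\<^sup>+s. \<integral>\<^sup>+g. F (s * g) \<partial>walk_pmf \<mu> n \<partial>measure_pmf \<mu>)"
    unfolding sample_path_case_nat by (subst Suc.IH) simp
  finally show ?case by (simp add: nn_integral_convolution_pmf)
qed

lemma emeasure_sample_path:
  "emeasure (increments \<mu>) {h \<in> space (increments \<mu>). sample_path h n \<in> A} = emeasure (walk_pmf \<mu> n) A"
proof -
  let ?B = "{h \<in> space (increments \<mu>). sample_path h n \<in> A}"
  have "emeasure (increments \<mu>) ?B = (\<integral>\<^sup>+h. indicator ?B h \<partial>increments \<mu>)"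
    by (rule nn_integral_indicator[symmetric]) measurable
  also have "\<dots> = (\<integral>\<^sup>+h. indicator A (sample_path h n) \<partial>increments \<mu>)"
    by (intro nn_integral_cong) (auto split: split_indicator)
  finally show ?thesis by (simp add: nn_integral_sample_path)
qed

section \<open>Convergence of paths to the boundary\<close>

lemma converges_to_boundary_iff:
  "converges_to_boundary g \<gamma> \<longleftrightarrow> (\<forall>k. \<forall>\<^sub>F n in sequentially. take k (word_of (g n)) = bprefix k \<gamma>)"
  by (simp add: converges_to_boundary_def bprefix_def)

lemma converges_to_boundary_unique:
  assumes "converges_to_boundary g \<gamma>" "converges_to_boundary g \<delta>"
  shows "\<gamma> = \<delta>"
proof (rule boundary_eqI)
  fix n
  have "\<forall>\<^sub>F i in sequentially. bprefix (Suc n) \<gamma> = bprefix (Suc n) \<delta>"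
    using assms[unfolded converges_to_boundary_iff, rule_format, of "Suc n"] by eventually_elim simp
  then have "bprefix (Suc n) \<gamma> ! n = bprefix (Suc n) \<delta> ! n" by simp
  then show "letter_at \<gamma> n = letter_at \<delta> n" by simp
qed

lemma boundary_limit_eq: "converges_to_boundary g \<gamma> \<Longrightarrow> boundary_limit g = \<gamma>"
  unfolding boundary_limit_def by (rule the_equality) (auto intro: converges_to_boundary_unique)

text \<open>Replaces the existence of a boundary point by countably many conditions on finite words,
  so that convergence is a measurable event.\<close>

lemma converges_to_boundary_ex_iff:
  "(\<exists>\<gamma>. converges_to_boundary g \<gamma>) \<longleftrightarrow>
    (\<forall>k. \<exists>w. length w = k \<and> (\<forall>\<^sub>F n in sequentially. take k (word_of (g n)) = w))"
proof
  assume "\<exists>\<gamma>. converges_to_boundary g \<gamma>"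
  then show "\<forall>k. \<exists>w. length w = k \<and> (\<forall>\<^sub>F n in sequentially. take k (word_of (g n)) = w)"
    unfolding converges_to_boundary_iff using length_bprefix by blast
next
  assume "\<forall>k. \<exists>w. length w = k \<and> (\<forall>\<^sub>F n in sequentially. take k (word_of (g n)) = w)"
  from choice[OF this] obtain p where
    p: "\<forall>k. length (p k) = k \<and> (\<forall>\<^sub>F n in sequentially. take k (word_of (g n)) = p k)" ..
  have red: "reduced (take k (word_of h))" for h k
    using reduced_word_of[of h] append_take_drop_id[of k "word_of h"]
    unfolding reduced_def by (metis successively_append_iff)
  have "\<exists>\<gamma>. \<forall>k. bprefix k \<gamma> = p k"
  proof (rule compatible_prefixes)
    show "length (p k) = k" for k using p by simp
    show "reduced (p k)" for k
    proof -
      have "\<forall>\<^sub>F n in sequentially. take k (word_of (g n)) = p k" using p by simp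
      then obtain n where "take k (word_of (g n)) = p k"
        using eventually_happens'[OF sequentially_bot] by blast
      then show ?thesis using red[of k "g n"] by simp
    qed
    show "take j (p k) = p j" if "j \<le> k" for j k
    proof -
      have "\<forall>\<^sub>F n in sequentially. take j (word_of (g n)) = p j \<and> take k (word_of (g n)) = p k"
        using p by (simp add: eventually_conj)
      then obtain n where "take j (word_of (g n)) = p j" "take k (word_of (g n)) = p k"
        using eventually_happens'[OF sequentially_bot] by blast
      then show ?thesis using that by (metis min.absorb1 take_take)
    qed
  qed
  then obtain \<gamma> where "\<forall>k. bprefix k \<gamma> = p k" ..
  then show "\<exists>\<gamma>. converges_to_boundary g \<gamma>"
    using p unfolding converges_to_boundary_iff by (intro exI[of _ \<gamma>]) simp
qed

text \<open>Once the path stays farther than \<open>k + K\<close> from the identity, a step of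
  length at most \<open>K\<close> cannot alter its first \<open>k\<close> letters.\<close>

lemma sample_path_converges:
  assumes K: "\<And>n. length (word_of (h n)) \<le> K"
    and inf: "\<And>k. \<forall>\<^sub>F n in sequentially. k < length (word_of (sample_path h n))"
  shows "\<exists>\<gamma>. converges_to_boundary (sample_path h) \<gamma>"
  unfolding converges_to_boundary_ex_iff
proof
  fix k
  obtain N where N: "\<And>n. n \<ge> N \<Longrightarrow> k + K < length (word_of (sample_path h n))"
    using inf[of "k + K"] by (auto simp: eventually_sequentially)
  have step: "take k (word_of (sample_path h (Suc n))) = take k (word_of (sample_path h n))" if "n \<ge> N" for n
    unfolding sample_path_Suc using N[OF that] K[of n] by (intro word_of_mult_prefix) linarith
  have "take k (word_of (sample_path h n)) = take k (word_of (sample_path h N))" if "n \<ge> N" for n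
    using that by (induction n rule: dec_induct) (auto simp: step)
  then have "\<forall>\<^sub>F n in sequentially. take k (word_of (sample_path h n)) = take k (word_of (sample_path h N))"
    by (rule eventually_sequentiallyI)
  moreover have "length (take k (word_of (sample_path h N))) = k"
    using N[of N] by simp
  ultimately show "\<exists>w. length w = k \<and> (\<forall>\<^sub>F n in sequentially. take k (word_of (sample_path h n)) = w)"
    by blast
qed

lemma measurable_boundary_limit:
  "(\<lambda>h. boundary_limit (sample_path h)) \<in> increments \<mu> \<rightarrow>\<^sub>M borel"
proof (rule measurable_boundaryI)
  fix w
  define C where "C h \<longleftrightarrow> (\<exists>\<gamma>. converges_to_boundary (sample_path h) \<gamma>)" for h
  define L where "L h \<longleftrightarrow> (\<forall>\<^sub>F n in sequentially. take (length w) (word_of (sample_path h n)) = w)" for h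
  have [measurable]: "Measurable.pred (increments \<mu>) C"
    unfolding C_def converges_to_boundary_ex_iff eventually_sequentially by measurable
  have [measurable]: "Measurable.pred (increments \<mu>) L"
    unfolding L_def eventually_sequentially by measurable
  have 1: "boundary_limit (sample_path h) \<in> cylinder w \<longleftrightarrow> L h" if C: "C h" for h
  proof -
    obtain \<gamma> where \<gamma>: "converges_to_boundary (sample_path h) \<gamma>"
      using C by (auto simp: C_def)
    have ev: "\<forall>\<^sub>F n in sequentially. take (length w) (word_of (sample_path h n)) = bprefix (length w) \<gamma>"
      using \<gamma> by (simp add: converges_to_boundary_iff)
    have "bprefix (length w) \<gamma> = w" if "L h"
    proof -
      have "\<forall>\<^sub>F n in sequentially. bprefix (length w) \<gamma> = w"
        using ev that unfolding L_def by eventually_elim simp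
      then show ?thesis by simp
    qed
    then show ?thesis
      using ev boundary_limit_eq[OF \<gamma>] by (auto simp: cylinder_def L_def)
  qed
  \<comment> \<open>Without convergence the description operator yields one fixed value independent
    of \<open>h\<close>, so the map is measurable on the whole space.\<close>
  have 2: "boundary_limit (sample_path h) = The (\<lambda>_. False)" if "\<not> C h" for h
  proof -
    have "converges_to_boundary (sample_path h) = (\<lambda>_. False)"
      using that by (auto simp: C_def)
    then show ?thesis by (simp add: boundary_limit_def)
  qed
  have "{h \<in> space (increments \<mu>). boundary_limit (sample_path h) \<in> cylinder w}
      = {h \<in> space (increments \<mu>). if C h then L h else The (\<lambda>_. False) \<in> cylinder w}"
  proof -
    have "boundary_limit (sample_path h) \<in> cylinder w \<longleftrightarrow>
        (if C h then L h else The (\<lambda>_. False) \<in> cylinder w)" for h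
      by (cases "C h") (simp_all add: 1 2)
    then show ?thesis by (simp only:)
  qed
  also have "\<dots> \<in> sets (increments \<mu>)" by measurable
  finally show "{h \<in> space (increments \<mu>). boundary_limit (sample_path h) \<in> cylinder w} \<in> sets (increments \<mu>)" .
qed

section \<open>Identification of the harmonic measure\<close>

text \<open>Says that \<open>\<nu>'\<close> is the convolution of \<mu> and \<nu>, tested on Borel
  sets; \<open>pushes \<mu> \<nu> \<nu>\<close> is stationarity.\<close>

definition pushes :: "modgrp pmf \<Rightarrow> boundary measure \<Rightarrow> boundary measure \<Rightarrow> bool" where
  "pushes \<mu> \<nu> \<nu>' \<longleftrightarrow> (\<forall>N\<in>sets borel. emeasure \<nu>' N = (\<integral>\<^sup>+s. emeasure \<nu> (bact s -` N) \<partial>\<mu>))"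

lemma pushes_convolution:
  assumes "pushes \<mu>\<^sub>2 \<nu> \<nu>'" "pushes \<mu>\<^sub>1 \<nu>' \<nu>''"
  shows "pushes (convolution_pmf \<mu>\<^sub>1 \<mu>\<^sub>2) \<nu> \<nu>''"
proof -
  have "bact (g * h) -` N = bact h -` (bact g -` N)" for g h N
    by (auto simp: bact_mult)
  with assms show ?thesis
    by (simp add: pushes_def nn_integral_convolution_pmf)
qed

text \<open>Finite support bounds the steps, so a path leaving all balls settles on one boundary
  point. \<open>atomless\<close> is uniform over long words and makes the translates of \<nu>
  concentrate. \<open>not_invariant\<close> gives the martingale a fixed conditional variance at
  each visit to a given element, which forces transience.\<close>

locale stationary =
  fixes \<mu> :: "modgrp pmf" and \<nu> :: "boundary measure"
  assumes fin: "finite (set_pmf \<mu>)"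
    and prob: "prob_space \<nu>"
    and sets_nu [measurable_cong]: "sets \<nu> = sets borel"
    and pushes: "pushes \<mu> \<nu> \<nu>"
    and atomless: "\<And>e. 0 < e \<Longrightarrow> \<exists>j. \<forall>c. j \<le> length c \<longrightarrow> measure \<nu> (cylinder c) \<le> e"
    and not_invariant: "\<exists>s\<in>set_pmf \<mu>. \<exists>D\<in>sets borel. measure \<nu> (bact s -` D) \<noteq> measure \<nu> D"
begin

sublocale prob_space \<nu> by (rule prob)

lemma space_nu [simp]: "space \<nu> = UNIV"
  using sets_eq_imp_space_eq[OF sets_nu] by simp

lemma vimage_bact_mult: "bact (g * h) -` N = bact h -` (bact g -` N)"
  by (auto simp: bact_mult)

lemma stationary_measure:
  assumes "D \<in> sets borel"
  shows "measure \<nu> D = (\<integral>s. measure \<nu> (bact s -` D) \<partial>\<mu>)"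
proof -
  have "ennreal (measure \<nu> D) = (\<integral>\<^sup>+s. ennreal (measure \<nu> (bact s -` D)) \<partial>\<mu>)"
    using pushes[unfolded pushes_def, rule_format, OF assms] unfolding emeasure_eq_measure .
  also have "\<dots> = ennreal (\<integral>s. measure \<nu> (bact s -` D) \<partial>\<mu>)"
    by (intro nn_integral_eq_integral integrable_measure_pmf_finite fin) simp
  finally show ?thesis by (simp add: integral_nonneg_AE)
qed

lemma nn_integral_walk:
  assumes "D \<in> sets borel"
  shows "(\<integral>\<^sup>+g. emeasure \<nu> (bact g -` D) \<partial>walk_pmf \<mu> n) = emeasure \<nu> D"
proof (induction n)
  case 0
  have "bact 1 -` D = D" by auto
  then show ?case by simp
next
  case (Suc n)
  have "(\<integral>\<^sup>+s. emeasure \<nu> (bact s -` (bact g -` D)) \<partial>\<mu>) = emeasure \<nu> (bact g -` D)" for g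
    by (rule pushes[unfolded pushes_def, rule_format, OF vimage_bact_borel[OF assms], symmetric])
  with Suc show ?case
    unfolding walk_pmf_Suc' by (simp add: nn_integral_convolution_pmf vimage_bact_mult)
qed

text \<open>Orthogonality of the increments of the bounded martingale \<open>\<nu>(g\<^sub>n\<^sup>-\<^sup>1 g D)\<close> bounds the Green
  function at \<open>g\<close>.\<close>

lemma summable_walk: "summable (\<lambda>n. pmf (walk_pmf \<mu> n) g)"
proof -
  obtain s0 D where s0: "s0 \<in> set_pmf \<mu>" and D: "D \<in> sets borel"
    and ne: "measure \<nu> (bact s0 -` D) \<noteq> measure \<nu> D"
    using not_invariant by blast
  obtain g' where g': "g' * g = 1" using modgrp_inverse_exists[of g] by blast
  \<comment> \<open>\<open>F k\<close> is the \<nu>-measure of D translated by g and then by the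
    inverse of k. This normalisation makes the conditional variance \<open>v\<close> at
    \<open>g\<close> equal to the constant \<open>c\<close>, which is positive by the choice of
    D.\<close>
  define F where "F k = measure \<nu> (bact k -` (bact g' -` D))" for k
  define v where "v k = (\<integral>s. (F (k * s) - F k)\<^sup>2 \<partial>\<mu>)" for k
  define c where "c = (\<integral>s. (measure \<nu> (bact s -` D) - measure \<nu> D)\<^sup>2 \<partial>\<mu>)"
  have D': "bact g' -` D \<in> sets borel" using D by measurable
  have "bact g -` (bact g' -` D) = D"
    using g' by (simp add: vimage_bact_mult[symmetric]) auto
  then have Fg: "F g = measure \<nu> D" and Fgs: "F (g * s) = measure \<nu> (bact s -` D)" for s
    by (simp_all add: F_def vimage_bact_mult)
  have vg: "v g = c" by (simp add: v_def c_def Fg Fgs)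
  have int: "integrable \<mu> f" for f :: "modgrp \<Rightarrow> real"
    by (rule integrable_measure_pmf_finite[OF fin])
  have "c = (\<Sum>s\<in>set_pmf \<mu>. (measure \<nu> (bact s -` D) - measure \<nu> D)\<^sup>2 * pmf \<mu> s)"
    unfolding c_def using fin by (rule integral_measure_pmf_real) auto
  also have "\<dots> > 0"
    using fin s0 ne by (intro sum_pos2[of _ s0]) (auto simp: pmf_positive)
  finally have c: "c > 0" .
  have F1: "0 \<le> F k" "F k \<le> 1" for k by (simp_all add: F_def)
  have v0: "0 \<le> v k" for k unfolding v_def by (intro integral_nonneg_AE) simp
  have step: "(\<integral>\<^sup>+s. ennreal ((F (k * s))\<^sup>2) \<partial>\<mu>) = ennreal ((F k)\<^sup>2) + ennreal (v k)" for k
  proof -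
    have Fk: "F k = (\<integral>s. F (k * s) \<partial>\<mu>)"
      unfolding F_def vimage_bact_mult by (rule stationary_measure) (use D in measurable)
    have "v k = (\<integral>s. (F (k * s))\<^sup>2 - 2 * F k * F (k * s) + (F k)\<^sup>2 \<partial>\<mu>)"
      unfolding v_def by (simp add: power2_diff algebra_simps)
    also have "\<dots> = (\<integral>s. (F (k * s))\<^sup>2 \<partial>\<mu>) - (F k)\<^sup>2"
      by (simp add: Bochner_Integration.integral_add Bochner_Integration.integral_diff int Fk[symmetric] power2_eq_square)
    finally have "(\<integral>s. (F (k * s))\<^sup>2 \<partial>\<mu>) = (F k)\<^sup>2 + v k" by simp
    moreover have "(\<integral>\<^sup>+s. ennreal ((F (k * s))\<^sup>2) \<partial>\<mu>) = ennreal (\<integral>s. (F (k * s))\<^sup>2 \<partial>\<mu>)"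
      by (intro nn_integral_eq_integral int) simp
    ultimately show ?thesis using v0 by simp
  qed
  \<comment> \<open>The second moment of the martingale at time \<open>n\<close>. It never exceeds 1
    and grows at each step by at least \<open>c\<close> times the probability of being at
    \<open>g\<close>.\<close>
  define A where "A n = (\<integral>\<^sup>+k. ennreal ((F k)\<^sup>2) \<partial>walk_pmf \<mu> n)" for n
  have lower: "ennreal (c * pmf (walk_pmf \<mu> n) g) \<le> (\<integral>\<^sup>+k. ennreal (v k) \<partial>walk_pmf \<mu> n)" for n
  proof -
    have "ennreal (c * pmf (walk_pmf \<mu> n) g) = (\<integral>\<^sup>+k. ennreal c * indicator {g} k \<partial>walk_pmf \<mu> n)"
      using c by (simp add: nn_integral_cmult_indicator emeasure_pmf_single ennreal_mult)
    also have "\<dots> \<le> (\<integral>\<^sup>+k. ennreal (v k) \<partial>walk_pmf \<mu> n)"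
      by (intro nn_integral_mono) (auto simp: indicator_def vg)
    finally show ?thesis .
  qed
  have A_Suc: "A (Suc n) = A n + (\<integral>\<^sup>+k. ennreal (v k) \<partial>walk_pmf \<mu> n)" for n
    unfolding A_def walk_pmf_Suc' nn_integral_convolution_pmf step by (intro nn_integral_add) simp_all
  have A_ge: "ennreal (\<Sum>n<N. c * pmf (walk_pmf \<mu> n) g) \<le> A N" for N
  proof (induction N)
    case (Suc N)
    have "ennreal (\<Sum>n<Suc N. c * pmf (walk_pmf \<mu> n) g)
        = ennreal (\<Sum>n<N. c * pmf (walk_pmf \<mu> n) g) + ennreal (c * pmf (walk_pmf \<mu> N) g)"
      using c by (simp add: ennreal_plus sum_nonneg)
    also have "\<dots> \<le> A (Suc N)"
      unfolding A_Suc by (intro add_mono Suc lower)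
    finally show ?case .
  qed simp
  have A_le: "A N \<le> 1" for N
  proof -
    have "A N \<le> (\<integral>\<^sup>+k. 1 \<partial>walk_pmf \<mu> N)"
      unfolding A_def by (intro nn_integral_mono) (simp add: power_le_one F1)
    then show ?thesis by simp
  qed
  have "(\<Sum>n<N. c * pmf (walk_pmf \<mu> n) g) \<le> 1" for N
    using order_trans[OF A_ge A_le, of N] by simp
  then have "summable (\<lambda>n. c * pmf (walk_pmf \<mu> n) g)"
    using c by (intro summableI_nonneg_bounded) auto
  with c show ?thesis by (simp add: summable_cmult_iff)
qed

text \<open>Balls are finite, so summability of the visits to each element and the Borel-Cantelli
  lemma leave only finitely many visits to a ball.\<close>

lemma AE_escapes:
  "AE h in increments \<mu>. \<forall>k. \<forall>\<^sub>F n in sequentially. k < length (word_of (sample_path h n))"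
proof (subst AE_all_countable, intro allI)
  fix k :: nat
  interpret P: prob_space "increments \<mu>" by (intro prob_space_PiM measure_pmf.prob_space_axioms)
  define B where "B = {g :: modgrp. length (word_of g) \<le> k}"
  have finB: "finite B"
  proof (rule finite_imageD)
    show "finite (word_of ` B)"
      by (rule finite_subset[OF _ finite_lists_length_le[of "UNIV :: letter set" k]]) (auto simp: B_def)
    show "inj_on word_of B" by (rule inj_onI) (simp add: word_of_inject)
  qed
  have "measure (increments \<mu>) {h \<in> space (increments \<mu>). sample_path h n \<in> B} = (\<Sum>g\<in>B. pmf (walk_pmf \<mu> n) g)" for n
    using finB by (simp add: measure_def emeasure_sample_path measure_measure_pmf_finite[symmetric])
  then have "summable (\<lambda>n. measure (increments \<mu>) {h \<in> space (increments \<mu>). sample_path h n \<in> B})"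
    by (simp add: summable_sum summable_walk)
  then have "AE h in increments \<mu>. \<forall>\<^sub>F n in sequentially.
      h \<in> space (increments \<mu>) - {h \<in> space (increments \<mu>). sample_path h n \<in> B}"
    by (intro borel_cantelli_AE1) (auto simp: P.emeasure_eq_measure)
  then show "AE h in increments \<mu>. \<forall>\<^sub>F n in sequentially. k < length (word_of (sample_path h n))"
    by eventually_elim (auto elim!: eventually_mono simp: B_def)
qed

lemma AE_converges: "AE h in increments \<mu>. \<exists>\<gamma>. converges_to_boundary (sample_path h) \<gamma>"
proof -
  define K where "K = Max ((\<lambda>g. length (word_of g)) ` set_pmf \<mu>)"
  have K: "length (word_of g) \<le> K" if "g \<in> set_pmf \<mu>" for g
    unfolding K_def using fin that by (intro Max_ge) auto
  have "AE h in increments \<mu>. \<forall>n. h n \<in> set_pmf \<mu>"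
    unfolding AE_all_countable
    by (intro allI AE_PiM_component measure_pmf.prob_space_axioms) (auto simp: AE_measure_pmf)
  with AE_escapes show ?thesis
    by eventually_elim (auto intro!: sample_path_converges[where K=K] K)
qed

text \<open>The translates of \<nu> by \<open>g n\<close> converge to the point mass at \<gamma>,
  tested on cylinders: a long element sends everything outside one small cylinder close to its own
  initial segment.\<close>

lemma measure_translate_tendsto:
  assumes conv: "converges_to_boundary g \<gamma>"
    and inf: "\<And>k. \<forall>\<^sub>F n in sequentially. k < length (word_of (g n))"
  shows "(\<lambda>n. measure \<nu> (bact (g n) -` cylinder w)) \<longlonglongrightarrow> indicator (cylinder w) \<gamma>"
proof (rule tendstoI)
  fix e :: real assume e: "0 < e"
  then obtain j where j: "\<And>c. j \<le> length c \<Longrightarrow> measure \<nu> (cylinder c) \<le> e / 2"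
    using atomless[of "e / 2"] by auto
  define k where "k = length w"
  have "\<forall>\<^sub>F n in sequentially. take k (word_of (g n)) = bprefix k \<gamma>"
    using conv by (simp add: converges_to_boundary_iff)
  with inf[of "k + j"]
  show "\<forall>\<^sub>F n in sequentially. dist (measure \<nu> (bact (g n) -` cylinder w)) (indicator (cylinder w) \<gamma>) < e"
  proof eventually_elim
    fix n
    assume long: "k + j < length (word_of (g n))" and pre: "take k (word_of (g n)) = bprefix k \<gamma>"
    \<comment> \<open>The exceptional cylinder for \<open>g n\<close>. It moves with
      \<open>n\<close>, so a bound uniform over all long cylinders is needed.\<close>
    define C where "C = cylinder (take (length (word_of (g n)) - k) (winv (word_of (g n))))"
    have C: "measure \<nu> C \<le> e / 2"
      unfolding C_def using long by (intro j) simp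
    have off: "bprefix k (bact (g n) \<eta>) = bprefix k \<gamma>" if "\<eta> \<notin> C" for \<eta>
      using bact_prefix[of k "g n" \<eta>] long that pre by (auto simp: C_def)
    have Cm: "C \<in> sets borel" by (simp add: C_def)
    show "dist (measure \<nu> (bact (g n) -` cylinder w)) (indicator (cylinder w) \<gamma>) < e"
    proof (cases "\<gamma> \<in> cylinder w")
      case True
      then have "UNIV - C \<subseteq> bact (g n) -` cylinder w"
        using off by (auto simp: cylinder_def k_def)
      then have "measure \<nu> (UNIV - C) \<le> measure \<nu> (bact (g n) -` cylinder w)"
        using Cm by (intro finite_measure_mono) (auto simp: sets_nu)
      moreover have "measure \<nu> (UNIV - C) = 1 - measure \<nu> C"
        using prob_compl[of C] Cm by (simp add: sets_nu)
      ultimately have "1 - e / 2 \<le> measure \<nu> (bact (g n) -` cylinder w)"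
        using C by simp
      then show ?thesis
        using True e by (simp add: dist_real_def abs_le_iff)
    next
      case False
      then have "bact (g n) -` cylinder w \<subseteq> C"
        using off by (force simp: cylinder_def k_def)
      then have "measure \<nu> (bact (g n) -` cylinder w) \<le> measure \<nu> C"
        using Cm by (intro finite_measure_mono) (auto simp: sets_nu)
      with C e False show ?thesis by (simp add: dist_real_def)
    qed
  qed
qed

text \<open>For a cylinder the martingale has the constant expectation given by \<nu>, while it
  converges almost surely to the indicator at the limit point; dominated convergence identifies the
  two.\<close>

theorem harmonic_measure_eq: "harmonic_measure \<mu> = \<nu>"
proof (rule sym, rule boundary_measure_eqI)
  show "sets \<nu> = sets borel" by (rule sets_nu)
  show "sets (harmonic_measure \<mu>) = sets borel" by (simp add: harmonic_measure_def)
  show "emeasure \<nu> UNIV \<noteq> \<infinity>" by simp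
  fix w
  interpret P: prob_space "increments \<mu>" by (intro prob_space_PiM measure_pmf.prob_space_axioms)
  let ?u = "\<lambda>n h. ennreal (measure \<nu> (bact (sample_path h n) -` cylinder w))"
  let ?l = "\<lambda>h. boundary_limit (sample_path h)"
  note measurable_boundary_limit[measurable]
  have "(\<lambda>n. \<integral>\<^sup>+h. ?u n h \<partial>increments \<mu>) \<longlonglongrightarrow> (\<integral>\<^sup>+h. indicator (cylinder w) (?l h) \<partial>increments \<mu>)"
  proof (rule nn_integral_dominated_convergence[where w="\<lambda>_. 1"])
    have "AE h in increments \<mu>. (\<lambda>n. measure \<nu> (bact (sample_path h n) -` cylinder w))
        \<longlonglongrightarrow> indicator (cylinder w) (?l h)"
      using AE_converges AE_escapes
      by eventually_elim (auto simp: boundary_limit_eq intro: measure_translate_tendsto)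
    then show "AE h in increments \<mu>. (\<lambda>n. ?u n h) \<longlonglongrightarrow> indicator (cylinder w) (?l h)"
    proof eventually_elim
      case (elim h)
      from tendsto_ennrealI[OF elim] show ?case by (simp add: ennreal_indicator)
    qed
    show "?u n \<in> borel_measurable (increments \<mu>)" for n
      by (rule measurable_compose[OF measurable_sample_path]) simp
    show "(\<lambda>h. indicator (cylinder w) (?l h)) \<in> borel_measurable (increments \<mu>)"
      by measurable
    show "AE h in increments \<mu>. ?u n h \<le> 1" for n
      by simp
    show "(\<integral>\<^sup>+h. 1 \<partial>increments \<mu>) < \<infinity>"
      by (simp add: P.emeasure_space_1)
  qed simp
  moreover have "(\<integral>\<^sup>+h. ?u n h \<partial>increments \<mu>) = emeasure \<nu> (cylinder w)" for n
    using nn_integral_sample_path[where F="\<lambda>g. ennreal (measure \<nu> (bact g -` cylinder w))" and n=n and \<mu>=\<mu>]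
      nn_integral_walk[of "cylinder w" n] by (simp add: emeasure_eq_measure)
  ultimately have "emeasure \<nu> (cylinder w) = (\<integral>\<^sup>+h. indicator (cylinder w) (?l h) \<partial>increments \<mu>)"
    by (simp add: LIMSEQ_const_iff)
  also have "\<dots> = (\<integral>\<^sup>+\<gamma>. indicator (cylinder w) \<gamma> \<partial>harmonic_measure \<mu>)"
    unfolding harmonic_measure_def by (subst nn_integral_distr) auto
  also have "\<dots> = emeasure (harmonic_measure \<mu>) (cylinder w)"
    by (simp add: harmonic_measure_def)
  finally show "emeasure \<nu> (cylinder w) = emeasure (harmonic_measure \<mu>) (cylinder w)" .
qed

end

section \<open>Boundary points as coin sequences\<close>

abbreviation coins :: "real \<Rightarrow> (nat \<Rightarrow> bool) measure" where
  "coins p \<equiv> \<Pi>\<^sub>M i\<in>(UNIV :: nat set). measure_pmf (bernoulli_pmf p)"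

lemma prob_space_coins: "prob_space (coins p)"
  by (intro prob_space_PiM measure_pmf.prob_space_axioms)

lemma space_coins [simp]: "space (coins p) = UNIV"
  by (simp add: space_PiM)

lemma measurable_coin [measurable]: "(\<lambda>c. c n) \<in> coins p \<rightarrow>\<^sub>M count_space UNIV"
  using measurable_component_singleton[of n UNIV "\<lambda>_. measure_pmf (bernoulli_pmf p)"]
  by (simp add: measurable_cong_sets[OF refl sets_measure_pmf_count_space])

lemma nn_integral_bernoulli:
  "0 \<le> p \<Longrightarrow> p \<le> 1 \<Longrightarrow> (\<integral>\<^sup>+b. f b \<partial>bernoulli_pmf p) = ennreal p * f True + ennreal (1 - p) * f False"
  by (subst nn_integral_measure_pmf_support[of UNIV]) (simp_all add: UNIV_bool mult.commute add.commute)

lemma nn_integral_bernoulli_real: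
  "0 \<le> p \<Longrightarrow> p \<le> 1 \<Longrightarrow> (\<And>b. 0 \<le> f b) \<Longrightarrow>
    (\<integral>\<^sup>+b. ennreal (f b) \<partial>bernoulli_pmf p) = ennreal (p * f True + (1 - p) * f False)"
  by (simp add: nn_integral_bernoulli ennreal_mult mult.commute)

lemma nn_integral_coins:
  assumes "f \<in> borel_measurable (coins p)"
  shows "(\<integral>\<^sup>+c. f c \<partial>coins p) = (\<integral>\<^sup>+b. \<integral>\<^sup>+c. f (case_nat b c) \<partial>coins p \<partial>bernoulli_pmf p)"
proof -
  interpret sequence_space "measure_pmf (bernoulli_pmf p)" by unfold_locales
  note assms[measurable]
  have "(\<integral>\<^sup>+c. f c \<partial>coins p)
      = (\<integral>\<^sup>+c. f c \<partial>distr (measure_pmf (bernoulli_pmf p) \<Otimes>\<^sub>M coins p) (coins p) (\<lambda>(b, c). case_nat b c))"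
    by (simp add: PiM_iter)
  also have "\<dots> = (\<integral>\<^sup>+x. f (case_nat (fst x) (snd x)) \<partial>(measure_pmf (bernoulli_pmf p) \<Otimes>\<^sub>M coins p))"
    by (subst nn_integral_distr) (auto simp: split_beta')
  also have "\<dots> = (\<integral>\<^sup>+b. \<integral>\<^sup>+c. f (case_nat b c) \<partial>coins p \<partial>bernoulli_pmf p)"
    by (subst P.nn_integral_fst[symmetric]) simp_all
  finally show ?thesis .
qed

lemma nn_integral_coins_prod:
  "(\<integral>\<^sup>+c. (\<Prod>i<n. f i (c i)) \<partial>coins p) = (\<Prod>i<n. \<integral>\<^sup>+b. f i b \<partial>bernoulli_pmf p)"
proof (induction n arbitrary: f)
  case 0
  interpret prob_space "coins p" by (rule prob_space_coins)
  show ?case using emeasure_space_1 by simp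
next
  case (Suc n)
  have [measurable]: "f i \<in> borel_measurable (count_space UNIV)" for i by simp
  have "(\<integral>\<^sup>+c. (\<Prod>i<Suc n. f i (c i)) \<partial>coins p)
      = (\<integral>\<^sup>+b. \<integral>\<^sup>+c. (\<Prod>i<Suc n. f i (case_nat b c i)) \<partial>coins p \<partial>bernoulli_pmf p)"
    by (rule nn_integral_coins) measurable
  also have "\<dots> = (\<integral>\<^sup>+b. f 0 b * (\<integral>\<^sup>+c. (\<Prod>i<n. f (Suc i) (c i)) \<partial>coins p) \<partial>bernoulli_pmf p)"
    by (subst nn_integral_cmult[symmetric]) (simp_all add: prod.lessThan_Suc_shift del: prod.lessThan_Suc)
  also have "\<dots> = (\<integral>\<^sup>+b. f 0 b \<partial>bernoulli_pmf p) * (\<Prod>i<n. \<integral>\<^sup>+b. f (Suc i) b \<partial>bernoulli_pmf p)"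
    using Suc.IH[of "\<lambda>i. f (Suc i)"] by (simp add: nn_integral_multc)
  finally show ?case by (simp add: prod.lessThan_Suc_shift del: prod.lessThan_Suc)
qed

lemma coins_prefix_sets [measurable]: "{c. \<forall>i<n. c i = z i} \<in> sets (coins p)"
proof -
  have "{c \<in> space (coins p). \<forall>i<n. c i = z i} \<in> sets (coins p)" by measurable
  then show ?thesis by simp
qed

lemma emeasure_coins_prefix:
  "emeasure (coins p) {c. \<forall>i<n. c i = z i} = (\<Prod>i<n. ennreal (pmf (bernoulli_pmf p) (z i)))"
proof -
  have "emeasure (coins p) {c. \<forall>i<n. c i = z i} = (\<integral>\<^sup>+c. indicator {c. \<forall>i<n. c i = z i} c \<partial>coins p)"
    by (rule nn_integral_indicator[OF coins_prefix_sets, symmetric])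
  also have "\<dots> = (\<integral>\<^sup>+c. (\<Prod>i<n. indicator {z i} (c i)) \<partial>coins p)"
    by (intro nn_integral_cong) (auto simp: indicator_def prod.neutral)
  finally show ?thesis
    using nn_integral_coins_prod[where f="\<lambda>i. indicator {z i}" and n=n and p=p] by (simp add: emeasure_pmf_single)
qed

definition lit :: "bool \<Rightarrow> letter" where
  "lit b = (if b then Lb else Lb')"

lemma lit_simps [simp]: "lit True = Lb" "lit False = Lb'" "lit b \<noteq> La" "lit b = Lb \<longleftrightarrow> b" "alt La (lit b)" "alt (lit b) La"
  by (auto simp: lit_def)

definition encA :: "(nat \<Rightarrow> bool) \<Rightarrow> boundary" where
  "encA c = Boundary (\<lambda>n. if even n then La else lit (c (n div 2)))"

text \<open>The sequence \<open>c\<close> lists the choices between b and its inverse after the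
  first letter; a first letter from that pair is not part of \<open>c\<close>.\<close>

definition enc :: "letter \<Rightarrow> (nat \<Rightarrow> bool) \<Rightarrow> boundary" where
  "enc x c = (if x = La then encA c else bpre x (encA c))"

definition dec :: "boundary \<Rightarrow> nat \<Rightarrow> bool" where
  "dec \<gamma> n \<longleftrightarrow> letter_at \<gamma> (if letter_at \<gamma> 0 = La then 2 * n + 1 else 2 * n + 2) = Lb"

lemma letter_at_encA [simp]: "letter_at (encA c) n = (if even n then La else lit (c (n div 2)))"
  by (subst encA_def, subst Boundary_inverse) auto

lemma letter_at_enc_0 [simp]: "letter_at (enc x c) 0 = x"
  by (simp add: enc_def)

lemma letter_at_enc_Suc: "letter_at (enc x c) (Suc n) =
    (if x = La then (if odd n then La else lit (c (n div 2)))
     else (if even n then La else lit (c (n div 2))))"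
  by (simp add: enc_def)

lemma dec_enc [simp]: "dec (enc x c) = c"
  by (rule ext) (auto simp: dec_def letter_at_enc_Suc)

lemma enc_dec: "enc (letter_at \<gamma> 0) (dec \<gamma>) = \<gamma>"
proof (rule boundary_eqI)
  fix n
  have La: "letter_at \<gamma> (i + n) = La \<longleftrightarrow> (letter_at \<gamma> i = La \<longleftrightarrow> even n)" for i n
  proof (induction n)
    case (Suc n)
    then show ?case using alt_letter_at[of \<gamma> "i + n"] by (auto simp: alt_def)
  qed simp
  have lit: "lit (letter_at \<gamma> n = Lb) = letter_at \<gamma> n" if "letter_at \<gamma> n \<noteq> La" for n
    using that by (cases "letter_at \<gamma> n") auto
  show "letter_at (enc (letter_at \<gamma> 0) (dec \<gamma>)) n = letter_at \<gamma> n"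
  proof (cases n)
    case (Suc m)
    show ?thesis
    proof (cases "letter_at \<gamma> n = La")
      case True
      then show ?thesis using La[of 0 n] by (auto simp: Suc letter_at_enc_Suc)
    next
      case False
      have "n = (if letter_at \<gamma> 0 = La then 2 * (m div 2) + 1 else 2 * (m div 2) + 2)"
        using False La[of 0 n] by (auto simp: Suc)
      then have "dec \<gamma> (m div 2) \<longleftrightarrow> letter_at \<gamma> n = Lb"
        by (simp only: dec_def)
      then show ?thesis using False La[of 0 n] lit[of n] by (auto simp: Suc letter_at_enc_Suc)
    qed
  qed simp
qed

text \<open>In these coordinates powers of b act on the first letter only, and a exchanges one coin
  with the first letter. All later computations with the action reduce to this table.\<close>

lemma bcons_enc:
  "bcons La (enc La c) = enc (lit (c 0)) (\<lambda>n. c (Suc n))"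
  "bcons La (enc (lit b) c) = enc La (case_nat b c)"
  "bcons Lb (enc La c) = enc Lb c" "bcons Lb (enc Lb c) = enc Lb' c" "bcons Lb (enc Lb' c) = enc La c"
  "bcons Lb' (enc La c) = enc Lb' c" "bcons Lb' (enc Lb c) = enc La c" "bcons Lb' (enc Lb' c) = enc Lb c"
proof -
  show 1: "bcons La (enc (lit b) c) = enc La (case_nat b c)" for b c
  proof (rule boundary_eqI)
    fix n
    show "letter_at (bcons La (enc (lit b) c)) n = letter_at (enc La (case_nat b c)) n"
      by (cases n; cases "n - 1")
        (auto simp: bcons_def Let_def letter_at_enc_Suc split: nat.split elim!: oddE)
  qed
  have "enc La c = bcons La (enc (lit (c 0)) (\<lambda>n. c (Suc n)))"
    unfolding 1 by (intro arg_cong[where f="enc La"] ext) (simp split: nat.split)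
  then show "bcons La (enc La c) = enc (lit (c 0)) (\<lambda>n. c (Suc n))"
    by (simp add: bcons_La_La)
qed (simp_all add: bcons_def enc_def Let_def)

lemma measurable_enc [measurable]: "enc x \<in> coins p \<rightarrow>\<^sub>M borel"
proof -
  have [measurable]: "encA \<in> coins p \<rightarrow>\<^sub>M borel"
  proof (rule measurable_boundaryI)
    fix w
    have "{c \<in> space (coins p). encA c \<in> cylinder w}
        = {c \<in> space (coins p). \<forall>i<length w. (if even i then La else lit (c (i div 2))) = w ! i}"
      by (simp add: cylinder_def bprefix_eq_iff)
    also have "\<dots> \<in> sets (coins p)" by measurable
    finally show "{c \<in> space (coins p). encA c \<in> cylinder w} \<in> sets (coins p)" .
  qed
  have "enc x = (\<lambda>c. if x = La then encA c else bcons x (encA c))"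
    by (rule ext, cases x) (simp_all add: enc_def bcons_def)
  moreover have "(\<lambda>c. if x = La then encA c else bcons x (encA c)) \<in> coins p \<rightarrow>\<^sub>M borel"
    by measurable
  ultimately show ?thesis by (simp only:)
qed

lemma measurable_letter_at [measurable]: "(\<lambda>\<gamma>. letter_at \<gamma> n) \<in> borel \<rightarrow>\<^sub>M count_space UNIV"
proof -
  have "(\<lambda>\<gamma>. bprefix (Suc n) \<gamma> ! n) \<in> borel \<rightarrow>\<^sub>M count_space UNIV" by measurable
  then show ?thesis by simp
qed

lemma measurable_dec [measurable]: "dec \<in> borel \<rightarrow>\<^sub>M coins p"
proof (rule measurable_PiM_single')
  fix i
  have "(\<lambda>\<gamma>. dec \<gamma> i) \<in> borel \<rightarrow>\<^sub>M count_space UNIV"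
    unfolding dec_def by measurable
  then show "(\<lambda>\<gamma>. dec \<gamma> i) \<in> borel \<rightarrow>\<^sub>M measure_pmf (bernoulli_pmf p)"
    by (simp add: measurable_cong_sets[OF refl sets_measure_pmf_count_space])
qed simp

definition coin_measure :: "real \<Rightarrow> letter \<Rightarrow> boundary set \<Rightarrow> real" where
  "coin_measure p x N = measure (coins p) (enc x -` N)"

lemma emeasure_enc: "emeasure (coins p) (enc x -` N) = ennreal (coin_measure p x N)"
proof -
  interpret prob_space "coins p" by (rule prob_space_coins)
  show ?thesis by (simp add: coin_measure_def emeasure_eq_measure)
qed

lemma coin_measure_nonneg [simp]: "0 \<le> coin_measure p x N"
  by (simp add: coin_measure_def)

lemma coin_measure_UNIV [simp]: "coin_measure p x UNIV = 1"
  using prob_space.prob_space[OF prob_space_coins] by (simp add: coin_measure_def)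

lemma enc_vimage [measurable]: "N \<in> sets borel \<Longrightarrow> enc x -` N \<in> sets (coins p)"
  using measurable_sets[OF measurable_enc, of N x p] by simp

lemma coin_measure_split:
  assumes p: "0 \<le> p" "p \<le> 1" and N: "N \<in> sets borel"
  shows "coin_measure p La N =
    p * coin_measure p Lb (bcons La -` N) + (1 - p) * coin_measure p Lb' (bcons La -` N)"
proof -
  note N[measurable]
  have *: "(\<integral>\<^sup>+c. indicator N (enc La (case_nat b c)) \<partial>coins p) = ennreal (coin_measure p (lit b) (bcons La -` N))" for b
  proof -
    have "(\<integral>\<^sup>+c. indicator N (enc La (case_nat b c)) \<partial>coins p)
        = (\<integral>\<^sup>+c. indicator (enc (lit b) -` (bcons La -` N)) c \<partial>coins p)"
      by (intro nn_integral_cong) (auto simp: bcons_enc split: split_indicator)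
    also have "\<dots> = emeasure (coins p) (enc (lit b) -` (bcons La -` N))"
      using measurable_sets[OF measurable_bcons N, of La] by (intro nn_integral_indicator enc_vimage) simp
    finally show ?thesis by (simp add: emeasure_enc)
  qed
  have "ennreal (coin_measure p La N) = (\<integral>\<^sup>+c. indicator (enc La -` N) c \<partial>coins p)"
    unfolding emeasure_enc[symmetric] by (intro nn_integral_indicator[symmetric] enc_vimage N)
  also have "\<dots> = (\<integral>\<^sup>+c. indicator N (enc La c) \<partial>coins p)"
    by (intro nn_integral_cong) (auto split: split_indicator)
  also have "\<dots> = (\<integral>\<^sup>+b. \<integral>\<^sup>+c. indicator N (enc La (case_nat b c)) \<partial>coins p \<partial>bernoulli_pmf p)"
    by (rule nn_integral_coins) measurable
  also have "\<dots> = ennreal (p * coin_measure p Lb (bcons La -` N) + (1 - p) * coin_measure p Lb' (bcons La -` N))"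
    using p by (simp add: * nn_integral_bernoulli ennreal_mult mult.commute)
  finally show ?thesis
    using p by (subst (asm) ennreal_inj) auto
qed

lemma coin_measure_La:
  assumes p: "0 \<le> p" "p \<le> 1" and N: "N \<in> sets borel"
  shows "coin_measure p La (bcons La -` N) = p * coin_measure p Lb N + (1 - p) * coin_measure p Lb' N"
proof -
  have "bcons La -` (bcons La -` N) = N" by (auto simp: bcons_La_La)
  then show ?thesis
    using coin_measure_split[OF p, of "bcons La -` N"] measurable_sets[OF measurable_bcons N, of La] by simp
qed

lemma coin_measure_b:
  "coin_measure p La (bcons Lb -` N) = coin_measure p Lb N"
  "coin_measure p Lb (bcons Lb -` N) = coin_measure p Lb' N"
  "coin_measure p Lb' (bcons Lb -` N) = coin_measure p La N"
  "coin_measure p La (bcons Lb' -` N) = coin_measure p Lb' N"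
  "coin_measure p Lb (bcons Lb' -` N) = coin_measure p La N"
  "coin_measure p Lb' (bcons Lb' -` N) = coin_measure p Lb N"
  by (simp_all add: coin_measure_def vimage_def bcons_enc)

section \<open>Multiplicative Markov measures\<close>

definition markov :: "letter pmf \<Rightarrow> real \<Rightarrow> boundary measure" where
  "markov \<theta> p = distr (measure_pmf \<theta> \<Otimes>\<^sub>M coins p) borel (\<lambda>(x, c). enc x c)"

lemma measurable_enc_pair: "(\<lambda>(x, c). enc x c) \<in> measure_pmf \<theta> \<Otimes>\<^sub>M coins p \<rightarrow>\<^sub>M borel"
proof -
  have "(\<lambda>(x, c). enc x c) \<in> count_space UNIV \<Otimes>\<^sub>M coins p \<rightarrow>\<^sub>M borel"
    by (rule measurable_pair_measure_countable1) auto
  then show ?thesis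
    by (subst measurable_cong_sets[OF sets_pair_measure_cong[OF sets_measure_pmf_count_space refl] refl])
qed

lemma sets_markov [simp, measurable_cong]: "sets (markov \<theta> p) = sets borel"
  by (simp add: markov_def)

lemma space_markov [simp]: "space (markov \<theta> p) = UNIV"
  by (simp add: markov_def)

lemma prob_space_markov: "prob_space (markov \<theta> p)"
proof -
  interpret C: prob_space "coins p" by (rule prob_space_coins)
  interpret pair_prob_space "measure_pmf \<theta>" "coins p" ..
  show ?thesis unfolding markov_def by (rule prob_space_distr[OF measurable_enc_pair])
qed

lemma emeasure_markov:
  assumes "N \<in> sets borel"
  shows "emeasure (markov \<theta> p) N = ennreal (\<Sum>x\<in>UNIV. pmf \<theta> x * coin_measure p x N)"
proof -
  interpret C: prob_space "coins p" by (rule prob_space_coins)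
  interpret pair_prob_space "measure_pmf \<theta>" "coins p" ..
  have "emeasure (markov \<theta> p) N
      = emeasure (measure_pmf \<theta> \<Otimes>\<^sub>M coins p) ((\<lambda>(x, c). enc x c) -` N \<inter> space (measure_pmf \<theta> \<Otimes>\<^sub>M coins p))"
    unfolding markov_def by (rule emeasure_distr[OF measurable_enc_pair assms])
  also have "\<dots> = (\<integral>\<^sup>+x. ennreal (coin_measure p x N) \<partial>\<theta>)"
  proof (subst C.emeasure_pair_measure_alt)
    show "(\<lambda>(x, c). enc x c) -` N \<inter> space (measure_pmf \<theta> \<Otimes>\<^sub>M coins p) \<in> sets (measure_pmf \<theta> \<Otimes>\<^sub>M coins p)"
      by (rule measurable_sets[OF measurable_enc_pair assms])
    have "Pair x -` ((\<lambda>(x, c). enc x c) -` N \<inter> space (measure_pmf \<theta> \<Otimes>\<^sub>M coins p)) = enc x -` N" for x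
      by (auto simp: space_pair_measure)
    then show "(\<integral>\<^sup>+x. emeasure (coins p) (Pair x -` ((\<lambda>(x, c). enc x c) -` N \<inter> space (measure_pmf \<theta> \<Otimes>\<^sub>M coins p))) \<partial>\<theta>)
        = (\<integral>\<^sup>+x. ennreal (coin_measure p x N) \<partial>\<theta>)"
      by (simp add: emeasure_enc)
  qed
  also have "\<dots> = (\<Sum>x\<in>UNIV. ennreal (pmf \<theta> x * coin_measure p x N))"
    by (subst nn_integral_measure_pmf_support[of UNIV]) (simp_all add: ennreal_mult mult.commute)
  finally show ?thesis by (simp add: sum_ennreal)
qed

lemma measure_markov:
  "N \<in> sets borel \<Longrightarrow> measure (markov \<theta> p) N =
    pmf \<theta> La * coin_measure p La N + pmf \<theta> Lb * coin_measure p Lb N + pmf \<theta> Lb' * coin_measure p Lb' N"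
  by (simp add: measure_def emeasure_markov sum_nonneg) (simp add: UNIV_letter)

lemma coin_measure_first_letter: "coin_measure p x {\<gamma>. letter_at \<gamma> 0 = y} = (if x = y then 1 else 0)"
  using coin_measure_UNIV[of p x] by (simp add: coin_measure_def)

lemma first_letter_borel [measurable]: "{\<gamma>. letter_at \<gamma> 0 = y} \<in> sets borel"
  using measurable_sets[OF measurable_letter_at, of "{y}" 0] by (simp add: vimage_def)

lemma markov_first_letter: "measure (markov \<theta> p) {\<gamma>. letter_at \<gamma> 0 = y} = pmf \<theta> y"
  by (cases y) (simp_all add: measure_markov coin_measure_first_letter)

text \<open>A word of length \<open>2 * n + 1\<close> fixes at least \<open>n\<close> coins,
  whichever the first letter is.\<close>

lemma coin_measure_cylinder_le:
  assumes p: "0 < p" "p < 1" and w: "2 * n + 1 \<le> length w"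
  shows "coin_measure p x (cylinder w) \<le> max p (1 - p) ^ n"
proof -
  interpret prob_space "coins p" by (rule prob_space_coins)
  define z where "z i \<longleftrightarrow> w ! (if x = La then 2 * i + 1 else 2 * i + 2) = Lb" for i
  have sub: "enc x -` cylinder w \<subseteq> {c. \<forall>i<n. c i = z i}"
  proof safe
    fix c i assume c: "enc x c \<in> cylinder w" and i: "i < n"
    define k where "k = (if x = La then 2 * i + 1 else 2 * i + 2)"
    have "k < length w" using i w by (auto simp: k_def)
    then have "letter_at (enc x c) k = w ! k"
      using c by (auto simp: cylinder_def bprefix_eq_iff)
    moreover have "letter_at (enc x c) k = lit (c i)"
      by (auto simp: k_def letter_at_enc_Suc)
    ultimately have "lit (c i) = w ! k" by simp
    then have "z i \<longleftrightarrow> lit (c i) = Lb" by (simp add: z_def k_def)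
    then show "c i \<Longrightarrow> z i" "z i \<Longrightarrow> c i" by simp_all
  qed
  have "coin_measure p x (cylinder w) \<le> prob {c. \<forall>i<n. c i = z i}"
    unfolding coin_measure_def by (rule finite_measure_mono[OF sub coins_prefix_sets])
  also have "\<dots> = (\<Prod>i<n. pmf (bernoulli_pmf p) (z i))"
    using emeasure_coins_prefix[of p n z] by (simp add: emeasure_eq_measure prod_ennreal prod_nonneg)
  also have "\<dots> \<le> (\<Prod>i<n. max p (1 - p))"
  proof (intro prod_mono conjI pmf_nonneg)
    show "pmf (bernoulli_pmf p) (z i) \<le> max p (1 - p)" for i
      using p by (cases "z i") auto
  qed
  finally show ?thesis by simp
qed

lemma markov_atomless:
  assumes p: "0 < p" "p < 1" and e: "0 < e"
  shows "\<exists>j. \<forall>w. j \<le> length w \<longrightarrow> measure (markov \<theta> p) (cylinder w) \<le> e"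
proof -
  obtain n where n: "max p (1 - p) ^ n < e"
    using real_arch_pow_inv[OF e, of "max p (1 - p)"] p by auto
  have "measure (markov \<theta> p) (cylinder w) \<le> e" if w: "2 * n + 1 \<le> length w" for w
  proof -
    have le: "coin_measure p x (cylinder w) \<le> e" for x
      using coin_measure_cylinder_le[OF p w, of x] n by simp
    have "measure (markov \<theta> p) (cylinder w) \<le> pmf \<theta> La * e + pmf \<theta> Lb * e + pmf \<theta> Lb' * e"
      by (subst measure_markov) (auto intro!: add_mono mult_left_mono le)
    also have "\<dots> = (\<Sum>x\<in>UNIV. pmf \<theta> x) * e"
      by (simp add: UNIV_letter algebra_simps)
    also have "(\<Sum>x\<in>UNIV. pmf \<theta> x) = 1"
      by (rule sum_pmf_eq_1) auto
    finally show ?thesis by simp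
  qed
  then show ?thesis by blast
qed

section \<open>Singularity of distinct coin measures\<close>

text \<open>The Hellinger affinity of the first \<open>n\<close> coins decays geometrically, so the likelihood ratio
  separates the two laws along a summable sequence of events.\<close>

lemma coins_singular:
  assumes p: "0 < p" "p < 1" "p \<noteq> 1 / 2"
  shows "\<exists>Z\<in>sets (coins p). emeasure (coins p) Z = 0 \<and> emeasure (coins (1 / 2)) Z = 1"
proof -
  \<comment> \<open>Density of one coin of bias \<open>p\<close> with respect to the fair
    coin.\<close>
  define r where "r b = (if b then 2 * p else 2 * (1 - p))" for b
  \<comment> \<open>The Hellinger affinity of the two coin laws: the fair mean of the square root of
    \<open>r\<close>, and equally the mean of its reciprocal under bias \<open>p\<close>.\<close>
  define \<rho> where "\<rho> = (sqrt (2 * p) + sqrt (2 * (1 - p))) / 2"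
  have r: "r b > 0" for b using p by (simp add: r_def)
  have \<rho>: "0 < \<rho>" "\<rho> < 1"
  proof -
    show "0 < \<rho>" using p by (simp add: \<rho>_def add_pos_pos)
    \<comment> \<open>Strictness uses \<open>p \<noteq> 1 / 2\<close> and is what makes \<rho> less
      than 1.\<close>
    have "(sqrt (2 * p) - sqrt (2 * (1 - p)))\<^sup>2 > 0" using p by simp
    then have "(sqrt (2 * p) + sqrt (2 * (1 - p)))\<^sup>2 < 2 * ((sqrt (2 * p))\<^sup>2 + (sqrt (2 * (1 - p)))\<^sup>2)"
      by (simp add: power2_diff power2_sum)
    also have "\<dots> = 2\<^sup>2" using p by simp
    finally show "\<rho> < 1" using power_less_imp_less_base[of _ 2 2] by (simp add: \<rho>_def)
  qed
  define R where "R n c = (\<Prod>i<n. sqrt (r (c i)))" for n and c :: "nat \<Rightarrow> bool"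
  have Rpos: "R n c > 0" for n c unfolding R_def using r by (intro prod_pos) simp
  have R_meas [measurable]: "R n \<in> borel_measurable (coins q)" for n q
  proof -
    have [measurable]: "r \<in> borel_measurable (count_space UNIV)" by simp
    show ?thesis unfolding R_def by measurable
  qed
  have int_half: "(\<integral>\<^sup>+c. ennreal (R n c) \<partial>coins (1 / 2)) = ennreal (\<rho> ^ n)" for n
  proof -
    have "(\<integral>\<^sup>+c. ennreal (R n c) \<partial>coins (1 / 2)) = (\<Prod>i<n. \<integral>\<^sup>+b. ennreal (sqrt (r b)) \<partial>bernoulli_pmf (1 / 2))"
      by (subst nn_integral_coins_prod[symmetric])
        (simp add: R_def prod_ennreal r less_imp_le)
    also have "(\<integral>\<^sup>+b. ennreal (sqrt (r b)) \<partial>bernoulli_pmf (1 / 2)) = ennreal \<rho>"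
      using p by (subst nn_integral_bernoulli_real) (auto simp: r_def \<rho>_def add_divide_distrib)
    finally show ?thesis using \<rho> by (simp add: ennreal_power)
  qed
  have int_p: "(\<integral>\<^sup>+c. ennreal (1 / R n c) \<partial>coins p) = ennreal (\<rho> ^ n)" for n
  proof -
    have "(\<integral>\<^sup>+c. ennreal (1 / R n c) \<partial>coins p) = (\<Prod>i<n. \<integral>\<^sup>+b. ennreal (1 / sqrt (r b)) \<partial>bernoulli_pmf p)"
      by (subst nn_integral_coins_prod[symmetric])
        (simp add: R_def prod_ennreal r less_imp_le prod_dividef)
    also have "(\<integral>\<^sup>+b. ennreal (1 / sqrt (r b)) \<partial>bernoulli_pmf p) = ennreal \<rho>"
    proof -
      have *: "q * (1 / sqrt (2 * q)) = sqrt (2 * q) / 2" if "0 < q" for q :: real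
        using that by (simp add: field_simps)
      have "(\<integral>\<^sup>+b. ennreal (1 / sqrt (r b)) \<partial>bernoulli_pmf p)
          = ennreal (p * (1 / sqrt (r True)) + (1 - p) * (1 / sqrt (r False)))"
        using p r by (intro nn_integral_bernoulli_real) (auto simp: less_imp_le)
      also have "p * (1 / sqrt (r True)) + (1 - p) * (1 / sqrt (r False)) = \<rho>"
        unfolding r_def if_True if_False \<rho>_def using *[of p] *[of "1 - p"] p
        by (simp only: add_divide_distrib)
      finally show ?thesis .
    qed
    finally show ?thesis using \<rho> by (simp add: ennreal_power)
  qed
  \<comment> \<open>Markov's inequality turns the geometric decay of the means into summable
    probabilities. It is applied to \<open>R n\<close> under the fair law and to its reciprocal
    under bias \<open>p\<close>.\<close>
  have markov_ineq: "AE c in coins q. \<forall>\<^sub>F n in sequentially. f n c < 1"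
    if f: "\<And>n. f n \<in> borel_measurable (coins q)" "\<And>n. (\<integral>\<^sup>+c. ennreal (f n c) \<partial>coins q) = ennreal (\<rho> ^ n)"
    for f :: "nat \<Rightarrow> (nat \<Rightarrow> bool) \<Rightarrow> real" and q
  proof -
    interpret prob_space "coins q" by (rule prob_space_coins)
    note f(1)[measurable]
    have le: "measure (coins q) {c. 1 \<le> f n c} \<le> \<rho> ^ n" for n
    proof -
      have "emeasure (coins q) {c \<in> UNIV. 1 \<le> 1 * ennreal (f n c)} \<le> 1 * (\<integral>\<^sup>+c. ennreal (f n c) * indicator UNIV c \<partial>coins q)"
        by (rule nn_integral_Markov_inequality) (use sets.top[of "coins q"] in auto)
      then have "emeasure (coins q) {c. 1 \<le> f n c} \<le> ennreal (\<rho> ^ n)"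
        by (simp add: f(2))
      then show ?thesis using \<rho> by (simp add: emeasure_eq_measure)
    qed
    have "summable (\<lambda>n. measure (coins q) {c. 1 \<le> f n c})"
      by (rule summable_comparison_test'[OF summable_geometric[of \<rho>], of 0]) (use \<rho> le in auto)
    moreover have "{c. 1 \<le> f n c} \<in> sets (coins q)" for n
    proof -
      have "{c \<in> space (coins q). 1 \<le> f n c} \<in> sets (coins q)" by measurable
      then show ?thesis by simp
    qed
    ultimately have "AE c in coins q. \<forall>\<^sub>F n in sequentially. c \<in> space (coins q) - {c. 1 \<le> f n c}"
      by (intro borel_cantelli_AE1) (auto simp: emeasure_eq_measure)
    then show ?thesis by eventually_elim (auto elim!: eventually_mono)
  qed
  \<comment> \<open>The event that the likelihood ratio is eventually below 1, typical for fair
    coins and impossible as soon as its reciprocal is eventually below 1.\<close>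
  define Z where "Z = {c. \<forall>\<^sub>F n in sequentially. R n c < 1}"
  have Z [measurable]: "Z \<in> sets (coins q)" for q
  proof -
    have "{c \<in> space (coins q). \<forall>\<^sub>F n in sequentially. R n c < 1} \<in> sets (coins q)"
      unfolding eventually_sequentially by measurable
    then show ?thesis by (simp add: Z_def)
  qed
  have "AE c in coins p. \<forall>\<^sub>F n in sequentially. 1 / R n c < 1"
    by (rule markov_ineq[OF _ int_p]) measurable
  then have "AE c in coins p. c \<notin> Z"
  proof eventually_elim
    case (elim c)
    show "c \<notin> Z"
    proof
      assume "c \<in> Z"
      then have "\<forall>\<^sub>F n in sequentially. R n c < 1" by (simp add: Z_def)
      with elim have "\<forall>\<^sub>F n in sequentially. False"
        by eventually_elim (use Rpos in \<open>simp add: field_simps not_less_iff_gr_or_eq\<close>)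
      then show False by simp
    qed
  qed
  then have "emeasure (coins p) Z = 0"
    using AE_iff_null_sets[OF Z] by (auto simp: null_sets_def)
  moreover have "AE c in coins (1 / 2). \<forall>\<^sub>F n in sequentially. R n c < 1"
    by (rule markov_ineq[OF _ int_half]) measurable
  then have "emeasure (coins (1 / 2)) Z = 1"
    using prob_space.emeasure_eq_1_AE[OF prob_space_coins Z, of "1 / 2"] by (simp add: Z_def)
  ultimately show ?thesis using Z by blast
qed

section \<open>The Hausdorff measure of the boundary\<close>

lemma letter_pmf:
  assumes "0 \<le> f La" "0 \<le> f Lb" "0 \<le> f Lb'" "f La + f Lb + f Lb' = 1"
  shows "pmf (embed_pmf f) x = f x"
proof (rule pmf_embed_pmf)
  show nonneg: "0 \<le> f y" for y using assms by (cases y) auto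
  have "(\<integral>\<^sup>+y. ennreal (f y) \<partial>count_space UNIV) = (\<Sum>y\<in>UNIV. ennreal (f y))"
    by (rule nn_integral_count_space_finite) simp
  also have "\<dots> = ennreal (\<Sum>y\<in>UNIV. f y)"
    by (rule sum_ennreal) (rule nonneg)
  also have "(\<Sum>y\<in>UNIV. f y) = 1"
    using assms by (simp add: UNIV_letter)
  finally show "(\<integral>\<^sup>+y. ennreal (f y) \<partial>count_space UNIV) = 1" by simp
qed

text \<open>Diameter to the power ln 2 / 2 of the cylinder of the letter. After a the next letter is
  free, giving diameter exp(-1); after b or its inverse the letter a is forced, giving
  exp(-2).\<close>

definition conformal_weight :: "letter \<Rightarrow> real" where
  "conformal_weight x = (if x = La then 1 / sqrt 2 else 1 / 2)"

definition conformal :: "boundary measure" where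
  "conformal = scale_measure (ennreal (1 / sqrt 2 + 1))
     (markov (embed_pmf (\<lambda>x. conformal_weight x / (1 / sqrt 2 + 1))) (1 / 2))"

lemma sets_conformal [simp, measurable_cong]: "sets conformal = sets borel"
  by (simp add: conformal_def)

lemma space_conformal [simp]: "space conformal = UNIV"
  using sets_eq_imp_space_eq[OF sets_conformal] by simp

lemma emeasure_conformal:
  assumes "N \<in> sets borel"
  shows "emeasure conformal N = ennreal (\<Sum>x\<in>UNIV. conformal_weight x * coin_measure (1 / 2) x N)"
proof -
  define T :: real where "T = 1 / sqrt 2 + 1"
  have T: "T > 0" by (simp add: T_def add_pos_pos)
  have "conformal_weight La + conformal_weight Lb + conformal_weight Lb' = T"
    by (simp add: conformal_weight_def T_def)
  then have "conformal_weight La / T + conformal_weight Lb / T + conformal_weight Lb' / T = 1"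
    using T by (simp add: add_divide_distrib[symmetric])
  moreover have "0 \<le> conformal_weight x / T" for x
    using T by (simp add: conformal_weight_def)
  ultimately have "pmf (embed_pmf (\<lambda>x. conformal_weight x / T)) y = conformal_weight y / T" for y
    by (intro letter_pmf)
  then have "emeasure conformal N
      = ennreal T * ennreal (\<Sum>x\<in>UNIV. conformal_weight x / T * coin_measure (1 / 2) x N)"
    using assms by (simp add: conformal_def T_def[symmetric] emeasure_markov)
  also have "\<dots> = ennreal (\<Sum>x\<in>UNIV. conformal_weight x * coin_measure (1 / 2) x N)"
    using T by (subst ennreal_mult[symmetric])
      (auto simp: sum_nonneg conformal_weight_def sum_distrib_left)
  finally show ?thesis .
qed

lemma finite_conformal: "emeasure conformal UNIV \<noteq> \<infinity>"
  by (simp add: emeasure_conformal)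

lemma enc_vimage_cylinder:
  assumes "0 < k"
  shows "enc x -` cylinder (bprefix k (enc y z)) =
    (if x = y then {c. \<forall>i<(if x = La then k div 2 else (k - 1) div 2). c i = z i} else {})"
proof -
  have agree: "enc x c \<in> cylinder (bprefix k (enc y z)) \<longleftrightarrow> (\<forall>i<k. letter_at (enc x c) i = letter_at (enc y z) i)" for c
    by (auto simp: cylinder_def bprefix_eq_iff)
  show ?thesis
  proof (cases "x = y")
    case False
    then have "enc x c \<notin> cylinder (bprefix k (enc y z))" for c
      using assms unfolding agree by (metis letter_at_enc_0)
    with False show ?thesis by auto
  next
    case True
    define m where "m = (if x = La then k div 2 else (k - 1) div 2)"
    have lit: "lit a = lit b \<longleftrightarrow> a = b" for a b by (cases a; cases b) auto
    have "(\<forall>i<k. letter_at (enc x c) i = letter_at (enc y z) i) \<longleftrightarrow> (\<forall>i<m. c i = z i)" for c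
    proof safe
      fix i assume *: "\<forall>i<k. letter_at (enc x c) i = letter_at (enc y z) i" and i: "i < m"
      define j where "j = (if x = La then 2 * i + 1 else 2 * i + 2)"
      have "j < k" using i by (auto simp: j_def m_def split: if_splits)
      then have "letter_at (enc x c) j = letter_at (enc y z) j" using * by simp
      then have "c i \<longleftrightarrow> z i" by (auto simp: j_def True letter_at_enc_Suc lit split: if_splits)
      then show "c i \<Longrightarrow> z i" "z i \<Longrightarrow> c i" by simp_all
    next
      fix i assume *: "\<forall>i<m. c i = z i" and i: "i < k"
      show "letter_at (enc x c) i = letter_at (enc y z) i"
      proof (cases i)
        case (Suc j)
        have "j div 2 < m" if "if x = La then even j else odd j"
          using that i Suc by (auto simp: m_def split: if_splits elim!: evenE oddE)
        then show ?thesis using * by (auto simp: Suc True letter_at_enc_Suc)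
      qed (simp add: True)
    qed
    then show ?thesis
      unfolding m_def[symmetric] using True agree by auto
  qed
qed

text \<open>Length of the longest word with the same cylinder: a word ending in b or its inverse is
  followed by a forced a, and branching occurs only after an a.\<close>

definition cylinder_exponent :: "boundary \<Rightarrow> nat \<Rightarrow> nat" where
  "cylinder_exponent \<gamma> k = (if letter_at \<gamma> 0 = La then 1 + 2 * (k div 2) else 2 + 2 * ((k - 1) div 2))"

lemma emeasure_conformal_cylinder:
  assumes "0 < k"
  shows "emeasure conformal (cylinder (bprefix k \<gamma>)) = ennreal ((1 / sqrt 2) ^ cylinder_exponent \<gamma> k)"
proof -
  define y where "y = letter_at \<gamma> 0"
  define m where "m = (if y = La then k div 2 else (k - 1) div 2)"
  interpret prob_space "coins (1 / 2)" by (rule prob_space_coins)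
  have cm: "coin_measure (1 / 2) x (cylinder (bprefix k \<gamma>)) = (if x = y then (1 / 2) ^ m else 0)" for x
  proof -
    have "prob {c. \<forall>i<m. c i = dec \<gamma> i} = (1 / 2) ^ m"
      using emeasure_coins_prefix[of "1 / 2" m "dec \<gamma>"]
      by (simp add: emeasure_eq_measure pmf_bernoulli_half ennreal_power del: ennreal_half)
    then show ?thesis
      using enc_vimage_cylinder[OF assms, of x y "dec \<gamma>"] enc_dec[of \<gamma>]
      by (simp add: coin_measure_def y_def m_def)
  qed
  have "emeasure conformal (cylinder (bprefix k \<gamma>)) = ennreal (conformal_weight y * (1 / 2) ^ m)"
    by (simp add: emeasure_conformal cm if_distrib cong: if_cong)
  also have "conformal_weight y * (1 / 2) ^ m = (1 / sqrt 2) ^ cylinder_exponent \<gamma> k"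
  proof -
    have "(1 / 2 :: real) = (1 / sqrt 2)\<^sup>2" by (simp add: power_divide)
    then have "(1 / 2 :: real) ^ m = (1 / sqrt 2) ^ (2 * m)" by (metis power_mult)
    then show ?thesis
      by (auto simp: conformal_weight_def cylinder_exponent_def y_def[symmetric] m_def power_add power2_eq_square)
  qed
  finally show ?thesis .
qed

lemma exp_powr_dim: "exp (- real k) powr (ln 2 / 2) = (1 / sqrt 2) ^ k"
proof -
  have "exp (- real k) powr (ln 2 / 2) = exp (- ln (sqrt 2)) ^ k"
    by (simp add: powr_def ln_sqrt exp_of_nat_mult[symmetric])
  also have "exp (- ln (sqrt 2)) = 1 / sqrt 2"
    by (subst exp_minus, subst exp_ln) (simp_all add: inverse_eq_divide)
  finally show ?thesis .
qed

lemma emeasure_conformal_cylinder_le: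
  assumes "0 < k"
  shows "emeasure conformal (cylinder (bprefix k \<gamma>)) \<le> ennreal (exp (- real k) powr (ln 2 / 2))"
proof -
  have "k \<le> cylinder_exponent \<gamma> k" by (auto simp: cylinder_exponent_def)
  then have "(1 / sqrt 2) ^ cylinder_exponent \<gamma> k \<le> (1 / sqrt 2 :: real) ^ k"
    by (intro power_decreasing) auto
  then show ?thesis
    by (simp add: emeasure_conformal_cylinder[OF assms] exp_powr_dim ennreal_leI)
qed

text \<open>The parity condition says that the word ends in a, so its cylinder branches immediately
  and its diameter is not smaller than its length suggests.\<close>

lemma emeasure_conformal_cylinder_eq:
  assumes "0 < k" "letter_at \<gamma> 0 = La \<longleftrightarrow> odd k"
  shows "emeasure conformal (cylinder (bprefix k \<gamma>)) = ennreal (exp (- real k) powr (ln 2 / 2))"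
proof -
  have "cylinder_exponent \<gamma> k = k" 
    using assms unfolding cylinder_exponent_def by (cases "letter_at \<gamma> 0 = La"; simp; presburger)
  then show ?thesis
    by (simp add: emeasure_conformal_cylinder[OF assms(1)] exp_powr_dim)
qed

section \<open>Lower bound for the Hausdorff measure: the mass distribution principle\<close>

lemma bounded_boundary: "bounded (U :: boundary set)"
proof -
  have "dist \<gamma> \<delta> \<le> 1" for \<gamma> \<delta> :: boundary
    using bprefix_eq_dist[of 0 \<gamma> \<delta>] by simp
  then show ?thesis unfolding bounded_def by blast
qed

lemma emeasure_conformal_singleton: "emeasure conformal {\<gamma>} = 0"
proof -
  have le: "emeasure conformal {\<gamma>} \<le> ennreal ((1 / sqrt 2) ^ Suc k)" for k
  proof -
    have "emeasure conformal {\<gamma>} \<le> emeasure conformal (cylinder (bprefix (Suc k) \<gamma>))"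
      by (rule emeasure_mono) (auto simp: mem_cylinder_bprefix)
    also have "\<dots> \<le> ennreal ((1 / sqrt 2) ^ Suc k)"
      using emeasure_conformal_cylinder_le[of "Suc k" \<gamma>] unfolding exp_powr_dim by simp
    finally show ?thesis .
  qed
  have "(\<lambda>k. ennreal ((1 / sqrt 2) ^ k)) \<longlonglongrightarrow> ennreal 0"
    by (intro tendsto_ennrealI LIMSEQ_realpow_zero) auto
  then have "(\<lambda>k. ennreal ((1 / sqrt 2) ^ Suc k)) \<longlonglongrightarrow> ennreal 0"
    by (rule LIMSEQ_Suc)
  then have "emeasure conformal {\<gamma>} \<le> ennreal 0"
    by (rule LIMSEQ_le_const) (use le in blast)
  then show ?thesis by simp
qed

text \<open>A set with at least two points lies in the cylinder of length \<open>k\<close>, its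
  least Gromov product, and has diameter at least exp(-k). The Borel set \<open>V\<close> is
  supplied because \<open>U\<close> itself may fail to be measurable.\<close>

lemma conformal_mass_distribution:
  assumes diam: "diameter U \<le> 1 / 2"
  shows "\<exists>V\<in>sets borel. U \<subseteq> V \<and> emeasure conformal V \<le> diam_power (ln 2 / 2) U"
proof -
  consider "U = {}" | \<gamma> where "U = {\<gamma>}" | x y where "x \<in> U" "y \<in> U" "x \<noteq> y"
    by blast
  then show ?thesis
  proof cases
    case 1
    then show ?thesis by (intro bexI[of _ "{}"]) auto
  next
    case 2
    then show ?thesis
      by (intro bexI[of _ "{\<gamma>}"]) (auto simp: emeasure_conformal_singleton)
  next
    case 3
    define G where "G k \<longleftrightarrow> (\<exists>x\<in>U. \<exists>y\<in>U. x \<noteq> y \<and> gromov_product x y = k)" for k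
    define k where "k = (LEAST k. G k)"
    have "G k" unfolding k_def by (rule LeastI[of _ "gromov_product x y"]) (use 3 in \<open>auto simp: G_def\<close>)
    then obtain u v where uv: "u \<in> U" "v \<in> U" "u \<noteq> v" "gromov_product u v = k"
      by (auto simp: G_def)
    have "exp (- real k) = dist u v" using uv by (simp add: dist_boundary_def)
    also have "\<dots> \<le> diameter U" using diameter_bounded_bound[OF bounded_boundary] uv by blast
    finally have d: "exp (- real k) \<le> diameter U" .
    \<comment> \<open>For \<open>k = 0\<close> the diameter would be at least 1. This case must be
      excluded, as the whole boundary has conformal mass greater than 1.\<close>
    have k: "0 < k" using d diam by (cases k) auto
    have "bprefix k z = bprefix k u" if "z \<in> U" for z
    proof (cases "z = u")
      case False
      then have "G (gromov_product z u)" using that uv by (auto simp: G_def)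
      then have "k \<le> gromov_product z u" unfolding k_def by (rule Least_le)
      then show ?thesis using gromov_product_ge_iff[OF False] by (auto simp: bprefix_eq_iff)
    qed simp
    then have "U \<subseteq> cylinder (bprefix k u)" by (auto simp: mem_cylinder_bprefix)
    moreover have "emeasure conformal (cylinder (bprefix k u)) \<le> diam_power (ln 2 / 2) U"
    proof -
      have "exp (- real k) powr (ln 2 / 2) \<le> diameter U powr (ln 2 / 2)"
        using d by (intro powr_mono2) auto
      then show ?thesis
        using emeasure_conformal_cylinder_le[OF k, of u] uv(1)
        by (auto simp: diam_power_def intro: order_trans ennreal_leI)
    qed
    ultimately show ?thesis by (intro bexI[of _ "cylinder (bprefix k u)"]) auto
  qed
qed

lemma conformal_le_hausdorff_pre:
  assumes A: "A \<in> sets borel"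
  shows "emeasure conformal A \<le> hausdorff_pre (ln 2 / 2) (1 / 2) A"
  unfolding hausdorff_pre_def
proof (rule INF_greatest, safe)
  fix U :: "nat \<Rightarrow> boundary set"
  assume U: "A \<subseteq> (\<Union>i. U i)" "\<forall>i. bounded (U i) \<and> diameter (U i) \<le> 1 / 2"
  have "\<forall>i. \<exists>V. V \<in> sets borel \<and> U i \<subseteq> V \<and> emeasure conformal V \<le> diam_power (ln 2 / 2) (U i)"
    using conformal_mass_distribution U(2) by blast
  from choice[OF this] obtain V where
    V: "\<forall>i. V i \<in> sets borel \<and> U i \<subseteq> V i \<and> emeasure conformal (V i) \<le> diam_power (ln 2 / 2) (U i)" ..
  have "emeasure conformal A \<le> emeasure conformal (\<Union>i. V i)"
    using U(1) V by (intro emeasure_mono) (auto, blast)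
  also have "\<dots> \<le> (\<Sum>i. emeasure conformal (V i))"
    using V by (intro emeasure_subadditive_countably) auto
  also have "\<dots> \<le> (\<Sum>i. diam_power (ln 2 / 2) (U i))"
    using V by (intro suminf_le) auto
  finally show "emeasure conformal A \<le> (\<Sum>i. diam_power (ln 2 / 2) (U i))" .
qed

section \<open>Upper bound for the Hausdorff measure: disjoint covers by cylinders\<close>

lemma diameter_cylinder_le: "diameter (cylinder (bprefix k \<gamma>)) \<le> exp (- real k)"
proof -
  have "\<gamma> \<in> cylinder (bprefix k \<gamma>)" by (simp add: mem_cylinder_bprefix)
  then show ?thesis
    unfolding diameter_def
    by (auto intro!: cSUP_least simp: mem_cylinder_bprefix bprefix_eq_dist[symmetric])
qed

text \<open>An open set is a disjoint union of arbitrarily small cylinders of words ending in a. On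
  these the conformal mass is exactly the power of the length scale, so the cover costs no more than
  the mass of the set.\<close>

lemma hausdorff_pre_le_open:
  assumes G: "open G" and \<delta>: "0 < \<delta>"
  shows "hausdorff_pre (ln 2 / 2) \<delta> G \<le> emeasure conformal G"
proof -
  obtain K0 :: nat where K0: "exp (- real K0) < \<delta>" using exp_neg_small[OF \<delta>] by blast
  define K where "K = Suc K0"
  have K: "exp (- real K) \<le> \<delta>" using K0 by (simp add: K_def) (smt (verit) exp_less_cancel_iff)
  define good where "good \<gamma> k \<longleftrightarrow> K \<le> k \<and> (letter_at \<gamma> 0 = La \<longleftrightarrow> odd k) \<and> cylinder (bprefix k \<gamma>) \<subseteq> G" for \<gamma> k
  \<comment> \<open>Shortest good prefixes only: two cylinders from \<open>W\<close> that meet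
    coincide.\<close>
  define W where "W = {bprefix k \<gamma> | k \<gamma>. good \<gamma> k \<and> (\<forall>j<k. \<not> good \<gamma> j)}"
  have good_cong: "good \<gamma> j \<longleftrightarrow> good \<delta> j" if "bprefix k \<gamma> = bprefix k \<delta>" "j \<le> k" "0 < k" for \<gamma> \<delta> j k
  proof -
    have "bprefix j \<gamma> = bprefix j \<delta>" using that by (metis take_bprefix)
    moreover have "letter_at \<gamma> 0 = letter_at \<delta> 0"
      using that(1,3) by (metis nth_bprefix)
    ultimately show ?thesis by (simp add: good_def)
  qed
  \<comment> \<open>The condition \<open>to_nat w = i\<close> prevents a cylinder from being listed
    twice, since \<open>from_nat\<close> need not be injective.\<close>
  define U where "U i = (let w = from_nat i in if w \<in> W \<and> to_nat w = i then cylinder w else {})" for i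
  have U_to_nat: "U (to_nat w) = cylinder w" if "w \<in> W" for w
    using that by (simp add: U_def)
  have U_cases: "U i = {} \<or> (\<exists>w\<in>W. i = to_nat w \<and> U i = cylinder w)" for i
  proof (cases "from_nat i \<in> W \<and> to_nat (from_nat i :: letter list) = i")
    case True
    then show ?thesis
      by (intro disjI2 bexI[of _ "from_nat i"]) (simp_all add: U_def)
  qed (auto simp: U_def Let_def)
  have cover: "G \<subseteq> (\<Union>i. U i)"
  proof
    fix \<gamma> assume "\<gamma> \<in> G"
    then obtain k0 where k0: "cylinder (bprefix k0 \<gamma>) \<subseteq> G"
      using open_boundary_cylinder[OF G] by blast
    define k1 where "k1 = max K k0"
    \<comment> \<open>Of two consecutive lengths, exactly one belongs to a prefix ending in
      a.\<close>
    obtain k where k: "k1 \<le> k" "letter_at \<gamma> 0 = La \<longleftrightarrow> odd k"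
      by (cases "letter_at \<gamma> 0 = La \<longleftrightarrow> odd k1") (auto intro: that[of k1] that[of "Suc k1"])
    have "cylinder (bprefix k \<gamma>) \<subseteq> cylinder (bprefix k0 \<gamma>)"
    proof -
      have "k0 \<le> k" using k(1) by (simp add: k1_def)
      then show ?thesis
        unfolding cylinder_def by simp (metis (mono_tags, lifting) Collect_mono take_bprefix)
    qed
    then have "good \<gamma> k" using k k0 by (auto simp: good_def k1_def)
    define j where "j = (LEAST j. good \<gamma> j)"
    have "good \<gamma> j" unfolding j_def by (rule LeastI) fact
    moreover have "\<forall>i<j. \<not> good \<gamma> i" unfolding j_def using not_less_Least by blast
    ultimately have "bprefix j \<gamma> \<in> W" by (auto simp: W_def)
    then have "\<gamma> \<in> U (to_nat (bprefix j \<gamma>))" by (simp add: U_to_nat mem_cylinder_bprefix)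
    then show "\<gamma> \<in> (\<Union>i. U i)" by blast
  qed
  have W_eq: "w = w'" if w: "w \<in> W" "w' \<in> W" and \<gamma>: "\<gamma> \<in> cylinder w" "\<gamma> \<in> cylinder w'" for w w' \<gamma>
  proof -
    have *: "w = bprefix (length w) \<gamma> \<and> good \<gamma> (length w) \<and> (\<forall>j<length w. \<not> good \<gamma> j)"
      if w': "w \<in> W" "\<gamma> \<in> cylinder w" for w
    proof -
      obtain k \<eta> where k: "w = bprefix k \<eta>" "good \<eta> k" "\<forall>j<k. \<not> good \<eta> j"
        using w' by (auto simp: W_def)
      have "bprefix k \<gamma> = bprefix k \<eta>" using w' k by (simp add: cylinder_def)
      moreover have "0 < k" using k by (auto simp: good_def K_def)
      ultimately show ?thesis using k good_cong[of k \<gamma> \<eta>] by auto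
    qed
    have "length w = length w'"
      using *[OF w(1) \<gamma>(1)] *[OF w(2) \<gamma>(2)] by (metis linorder_neqE_nat)
    then show ?thesis using *[OF w(1) \<gamma>(1)] *[OF w(2) \<gamma>(2)] by metis
  qed
  have disj: "disjoint_family U"
  proof (unfold disjoint_family_on_def, intro ballI impI)
    fix i j :: nat assume "i \<noteq> j"
    then show "U i \<inter> U j = {}"
      using U_cases[of i] U_cases[of j] W_eq by blast
  qed
  have meas: "U i \<in> sets conformal" for i using U_cases[of i] by auto
  have each: "diameter (U i) \<le> \<delta> \<and> diam_power (ln 2 / 2) (U i) \<le> emeasure conformal (U i) \<and> U i \<subseteq> G" for i
  proof (cases "U i = {}")
    case True
    then show ?thesis using \<delta> by (simp add: diam_power_def)
  next
    case False
    then obtain w where w: "w \<in> W" "U i = cylinder w" using U_cases[of i] by blast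
    then obtain k \<eta> where k: "w = bprefix k \<eta>" "good \<eta> k" by (auto simp: W_def)
    have k0: "K \<le> k" "0 < k" using k by (auto simp: good_def K_def)
    have d: "diameter (U i) \<le> exp (- real k)" unfolding w(2) k(1) by (rule diameter_cylinder_le)
    also have "\<dots> \<le> exp (- real K)" using k0 by simp
    finally have "diameter (U i) \<le> \<delta>" using K by simp
    moreover have "diam_power (ln 2 / 2) (U i) \<le> emeasure conformal (U i)"
    proof -
      have "diameter (U i) powr (ln 2 / 2) \<le> exp (- real k) powr (ln 2 / 2)"
        using d by (intro powr_mono2 diameter_ge_0 bounded_boundary) auto
      moreover have "emeasure conformal (U i) = ennreal (exp (- real k) powr (ln 2 / 2))"
        unfolding w(2) k(1) using k k0 by (intro emeasure_conformal_cylinder_eq) (auto simp: good_def)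
      ultimately show ?thesis
        using False by (simp add: diam_power_def ennreal_leI)
    qed
    ultimately show ?thesis using k w by (simp add: good_def)
  qed
  have "hausdorff_pre (ln 2 / 2) \<delta> G \<le> (\<Sum>i. diam_power (ln 2 / 2) (U i))"
    unfolding hausdorff_pre_def using cover each by (intro INF_lower) (auto intro: bounded_boundary)
  also have "\<dots> \<le> (\<Sum>i. emeasure conformal (U i))"
    using each by (intro suminf_le) auto
  also have "\<dots> = emeasure conformal (\<Union>i. U i)"
    using meas disj by (intro suminf_emeasure) auto
  also have "\<dots> \<le> emeasure conformal G"
    using each G by (intro emeasure_mono) auto
  finally show ?thesis .
qed

lemma hausdorff_pre_mono: "A \<subseteq> B \<Longrightarrow> hausdorff_pre s \<delta> A \<le> hausdorff_pre s \<delta> B"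
  unfolding hausdorff_pre_def by (rule INF_superset_mono) auto

lemma hausdorff_pre_antimono: "\<delta> \<le> \<epsilon> \<Longrightarrow> hausdorff_pre s \<epsilon> A \<le> hausdorff_pre s \<delta> A"
  unfolding hausdorff_pre_def by (rule INF_superset_mono) (auto intro: order_trans)

text \<open>Outer regularity carries the upper bound from open sets to Borel sets. For the lower
  bound the single scale 1/2 suffices, since the Hausdorff outer measure is a supremum over
  scales.\<close>

lemma hausdorff_outer_conformal:
  assumes A: "A \<in> sets borel"
  shows "hausdorff_outer (ln 2 / 2) A = emeasure conformal A"
proof (rule antisym)
  show "hausdorff_outer (ln 2 / 2) A \<le> emeasure conformal A"
    unfolding hausdorff_outer_def
  proof (rule SUP_least)
    fix \<delta> :: real assume "\<delta> \<in> {0<..}"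
    then have \<delta>: "0 < \<delta>" by simp
    have "emeasure conformal A = (INF U\<in>{U. A \<subseteq> U \<and> open U}. emeasure conformal U)"
      using A finite_conformal by (intro outer_regular) auto
    moreover have "hausdorff_pre (ln 2 / 2) \<delta> A \<le> (INF U\<in>{U. A \<subseteq> U \<and> open U}. emeasure conformal U)"
      by (rule INF_greatest)
        (auto intro: order_trans[OF hausdorff_pre_mono hausdorff_pre_le_open[OF _ \<delta>]])
    ultimately show "hausdorff_pre (ln 2 / 2) \<delta> A \<le> emeasure conformal A" by simp
  qed
  show "emeasure conformal A \<le> hausdorff_outer (ln 2 / 2) A"
    unfolding hausdorff_outer_def
    by (rule SUP_upper2[of "1 / 2"]) (auto intro: conformal_le_hausdorff_pre[OF A])
qed

lemma hausdorff_measure_conformal: "hausdorff_measure (ln 2 / 2) = conformal"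
proof -
  have "hausdorff_measure (ln 2 / 2) = measure_of UNIV (sets borel) (emeasure conformal)"
    unfolding hausdorff_measure_def
    by (rule measure_of_eq) (auto simp: hausdorff_outer_conformal sets.sigma_sets_eq[of borel, simplified])
  then show ?thesis
    using measure_of_of_measure[of conformal] by simp
qed

section \<open>The Hausdorff dimension of the boundary\<close>

lemma emeasure_conformal_UNIV_pos: "0 < emeasure conformal UNIV"
  by (simp add: emeasure_conformal UNIV_letter conformal_weight_def add_pos_pos)

lemma hausdorff_outer_below:
  assumes s: "0 \<le> s" "s \<le> ln 2 / 2"
  shows "hausdorff_outer s (UNIV :: boundary set) \<noteq> 0"
proof -
  have "hausdorff_pre (ln 2 / 2) (1 / 2) (UNIV :: boundary set) \<le> hausdorff_pre s (1 / 2) (UNIV :: boundary set)"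
    unfolding hausdorff_pre_def
  proof (rule INF_greatest)
    fix U :: "nat \<Rightarrow> boundary set"
    assume U: "U \<in> {U. UNIV \<subseteq> (\<Union>i. U i) \<and> (\<forall>i. bounded (U i) \<and> diameter (U i) \<le> 1 / 2)}"
    have "diam_power (ln 2 / 2) (U i) \<le> diam_power s (U i)" for i
    proof -
      have d: "0 \<le> diameter (U i)" "diameter (U i) \<le> 1"
        using U by (auto intro!: diameter_ge_0 intro: order_trans[of _ "1 / 2"])
      \<comment> \<open>Needed for \<open>s = 0\<close>, where \<open>diam_power\<close> takes the
        value 1 on nonempty sets instead of a value of \<open>powr\<close>.\<close>
      have "diameter (U i) powr (ln 2 / 2) \<le> 1"
        using d by (intro powr_le1) auto
      moreover have "diameter (U i) powr (ln 2 / 2) \<le> diameter (U i) powr s"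
        using d s by (cases "diameter (U i) = 0") (auto intro: powr_mono')
      ultimately show ?thesis
        by (auto simp: diam_power_def ennreal_leI)
    qed
    then have "(\<Sum>i. diam_power (ln 2 / 2) (U i)) \<le> (\<Sum>i. diam_power s (U i))"
      by (intro suminf_le) auto
    then show "(INF U\<in>{U :: nat \<Rightarrow> boundary set. UNIV \<subseteq> (\<Union>i. U i) \<and> (\<forall>i. bounded (U i) \<and> diameter (U i) \<le> 1 / 2)}.
        \<Sum>i. diam_power (ln 2 / 2) (U i)) \<le> (\<Sum>i. diam_power s (U i))"
      by (rule INF_lower2[OF U])
  qed
  moreover have "hausdorff_pre s (1 / 2) (UNIV :: boundary set) \<le> hausdorff_outer s (UNIV :: boundary set)"
    unfolding hausdorff_outer_def by (rule SUP_upper) simp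
  ultimately show ?thesis
    using conformal_le_hausdorff_pre[of UNIV] emeasure_conformal_UNIV_pos by auto
qed

text \<open>On sets of diameter at most \<delta>, raising the exponent by \<open>t\<close> gains the
  factor \<open>\<delta> powr t\<close>, while at exponent ln 2 / 2 there are covers with uniformly
  bounded sums.\<close>

lemma hausdorff_outer_above:
  assumes s: "ln 2 / 2 < s"
  shows "hausdorff_outer s (UNIV :: boundary set) = 0"
proof -
  define t where "t = s - ln 2 / 2"
  have t: "0 < t" using s by (simp add: t_def)
  have s0: "0 < s" using s by (smt (verit) ln_gt_zero divide_pos_pos)
  \<comment> \<open>The added 1 gives a strict bound, so that an actual cover can be picked from the
    infimum.\<close>
  define c where "c = enn2real (emeasure conformal UNIV) + 1"
  have c: "emeasure conformal UNIV < ennreal c" "0 \<le> c"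
    using finite_conformal by (auto simp: c_def ennreal_enn2real_if intro!: ennreal_lessI)
  have pre: "hausdorff_pre s \<delta> (UNIV :: boundary set) \<le> ennreal (\<delta> powr t * c)"
    if \<delta>: "0 < \<delta>" for \<delta>
  proof -
    have "hausdorff_pre (ln 2 / 2) \<delta> (UNIV :: boundary set) < ennreal c"
      using hausdorff_pre_le_open[OF open_UNIV \<delta>] c(1) by (rule le_less_trans)
    then obtain U :: "nat \<Rightarrow> boundary set"
      where U: "UNIV \<subseteq> (\<Union>i. U i)" "\<And>i. diameter (U i) \<le> \<delta>"
        and less: "(\<Sum>i. diam_power (ln 2 / 2) (U i)) < ennreal c"
      unfolding hausdorff_pre_def INF_less_iff by auto
    have "diam_power s (U i) \<le> ennreal (\<delta> powr t) * diam_power (ln 2 / 2) (U i)" for i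
    proof -
      have d: "0 \<le> diameter (U i)" "diameter (U i) \<le> \<delta>"
        using U by (auto intro: diameter_ge_0 bounded_boundary)
      have "diameter (U i) powr s = diameter (U i) powr t * diameter (U i) powr (ln 2 / 2)"
        by (simp add: t_def powr_add[symmetric])
      also have "\<dots> \<le> \<delta> powr t * diameter (U i) powr (ln 2 / 2)"
        using d t by (intro mult_right_mono powr_mono2) auto
      finally show ?thesis
        using s0 by (auto simp: diam_power_def ennreal_mult[symmetric] ennreal_leI)
    qed
    then have "(\<Sum>i. diam_power s (U i)) \<le> ennreal (\<delta> powr t) * (\<Sum>i. diam_power (ln 2 / 2) (U i))"
      unfolding ennreal_suminf_cmult[symmetric] by (intro suminf_le) auto
    also have "\<dots> \<le> ennreal (\<delta> powr t) * ennreal c"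
      using less by (intro mult_left_mono) auto
    also have "\<dots> = ennreal (\<delta> powr t * c)"
      using c(2) by (simp add: ennreal_mult)
    finally show ?thesis
      unfolding hausdorff_pre_def using U by (intro INF_lower2[of U]) (auto intro: bounded_boundary)
  qed
  have "hausdorff_pre s \<epsilon> (UNIV :: boundary set) = 0" if \<epsilon>: "0 < \<epsilon>" for \<epsilon>
  proof -
    have "hausdorff_pre s \<epsilon> (UNIV :: boundary set) \<le> ennreal (exp (- t) ^ n * c)" if n: "exp (- real n) \<le> \<epsilon>" for n
    proof -
      have "hausdorff_pre s \<epsilon> (UNIV :: boundary set) \<le> hausdorff_pre s (exp (- real n)) (UNIV :: boundary set)"
        using n by (rule hausdorff_pre_antimono)
      also have "\<dots> \<le> ennreal (exp (- real n) powr t * c)"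
        by (rule pre) simp
      also have "exp (- real n) powr t = exp (- t) ^ n"
        by (simp add: powr_def exp_of_nat_mult[symmetric] mult.commute)
      finally show ?thesis .
    qed
    moreover obtain N :: nat where N: "exp (- real N) < \<epsilon>" using exp_neg_small[OF \<epsilon>] by blast
    moreover have "exp (- real n) \<le> \<epsilon>" if "N \<le> n" for n
      using N that by (smt (verit) exp_le_cancel_iff of_nat_mono)
    ultimately have ev: "\<exists>N. \<forall>n\<ge>N. hausdorff_pre s \<epsilon> (UNIV :: boundary set) \<le> ennreal (exp (- t) ^ n * c)"
      by blast
    have "(\<lambda>n. ennreal (exp (- t) ^ n * c)) \<longlonglongrightarrow> ennreal (0 * c)"
      using t by (intro tendsto_ennrealI tendsto_mult LIMSEQ_realpow_zero tendsto_const) auto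
    then have "hausdorff_pre s \<epsilon> (UNIV :: boundary set) \<le> ennreal (0 * c)"
      by (rule LIMSEQ_le_const) (rule ev)
    then show ?thesis by simp
  qed
  then show ?thesis
    by (simp add: hausdorff_outer_def)
qed

lemma hausdorff_dim_boundary: "hausdorff_dim (UNIV :: boundary set) = ln 2 / 2"
proof -
  have "0 \<le> s \<and> hausdorff_outer s (UNIV :: boundary set) = 0 \<longleftrightarrow> ln 2 / 2 < s" for s
  proof
    assume "ln 2 / 2 < s"
    moreover have "(0 :: real) < ln 2 / 2" by simp
    ultimately show "0 \<le> s \<and> hausdorff_outer s (UNIV :: boundary set) = 0"
      using hausdorff_outer_above[of s] by linarith
  next
    assume "0 \<le> s \<and> hausdorff_outer s (UNIV :: boundary set) = 0"
    then show "ln 2 / 2 < s"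
      using hausdorff_outer_below[of s] by (meson not_le)
  qed
  then have "{s. 0 \<le> s \<and> hausdorff_outer s (UNIV :: boundary set) = 0} = {ln 2 / 2<..}"
    unfolding greaterThan_def by (rule Collect_cong)
  then show ?thesis
    unfolding hausdorff_dim_def by (simp only: cInf_greaterThan)
qed

section \<open>Filling measures\<close>

lemma filling_iff: "filling \<mu> \<longleftrightarrow> equivalent_measures (harmonic_measure \<mu>) conformal"
  by (simp add: filling_def hausdorff_dim_boundary hausdorff_measure_conformal)

text \<open>Both measures are positive combinations of the same three fair coin measures, hence have
  the same null sets.\<close>

lemma filling_markov_half:
  assumes harm: "harmonic_measure \<mu> = markov \<theta> (1 / 2)" and pos: "\<And>x. 0 < pmf \<theta> x"
  shows "filling \<mu>"
proof -
  have w: "0 < conformal_weight x" for x by (simp add: conformal_weight_def)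
  have "emeasure (markov \<theta> (1 / 2)) N = 0 \<longleftrightarrow> emeasure conformal N = 0" if "N \<in> sets borel" for N
  proof -
    have *: "ennreal (\<Sum>x\<in>UNIV. f x * coin_measure (1 / 2) x N) = 0 \<longleftrightarrow> (\<forall>x. coin_measure (1 / 2) x N = 0)"
      if f: "\<And>x. 0 < f x" for f :: "letter \<Rightarrow> real"
    proof -
      have nn: "0 \<le> f x * coin_measure (1 / 2) x N" for x using f[of x] by simp
      have "0 \<le> (\<Sum>x\<in>UNIV. f x * coin_measure (1 / 2) x N)" by (intro sum_nonneg nn)
      then have "ennreal (\<Sum>x\<in>UNIV. f x * coin_measure (1 / 2) x N) = 0
          \<longleftrightarrow> (\<Sum>x\<in>UNIV. f x * coin_measure (1 / 2) x N) = 0"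
        unfolding ennreal_eq_0_iff by linarith
      also have "\<dots> \<longleftrightarrow> (\<forall>x\<in>UNIV. f x * coin_measure (1 / 2) x N = 0)"
        by (rule sum_nonneg_eq_0_iff) (simp_all add: nn)
      also have "\<dots> \<longleftrightarrow> (\<forall>x. coin_measure (1 / 2) x N = 0)"
        using f by (simp add: less_imp_neq[symmetric])
      finally show ?thesis .
    qed
    show ?thesis
      unfolding emeasure_markov[OF that] emeasure_conformal[OF that] using *[OF pos] *[OF w] by simp
  qed
  then show ?thesis
    by (auto simp: filling_iff harm equivalent_measures_def absolutely_continuous_def null_sets_def)
qed

text \<open>The separating set of coin sequences is pulled back by \<open>dec\<close>, which forgets
  the first letter; it is therefore null or of full mass for all three first letters at
  once.\<close>

lemma not_filling_markov:
  assumes harm: "harmonic_measure \<mu> = markov \<theta> p" and p: "0 < p" "p < 1" "p \<noteq> 1 / 2"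
  shows "\<not> filling \<mu>"
proof
  assume "filling \<mu>"
  then have ac: "absolutely_continuous (markov \<theta> p) conformal"
    by (simp add: filling_iff harm equivalent_measures_def)
  obtain Z where Z: "Z \<in> sets (coins p)" "emeasure (coins p) Z = 0" "emeasure (coins (1 / 2)) Z = 1"
    using coins_singular[OF p] by blast
  define N where "N = dec -` Z"
  have N: "N \<in> sets borel"
    using measurable_sets[OF measurable_dec Z(1)] by (simp add: N_def)
  have "enc x -` N = Z" for x by (auto simp: N_def)
  then have "coin_measure p x N = 0" "coin_measure (1 / 2) x N = 1" for x
    using Z by (simp_all add: coin_measure_def measure_def)
  then have "emeasure (markov \<theta> p) N = 0" "emeasure conformal N \<noteq> 0"
    using N emeasure_conformal_UNIV_pos by (simp_all add: emeasure_markov emeasure_conformal)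
  then show False
    using ac N by (auto simp: absolutely_continuous_def null_sets_def)
qed

section \<open>The generators\<close>

definition ga :: modgrp where "ga = Modgrp [La]"
definition gb :: modgrp where "gb = Modgrp [Lb]"
definition gb' :: modgrp where "gb' = Modgrp [Lb']"

lemma word_of_gens [simp]: "word_of ga = [La]" "word_of gb = [Lb]" "word_of gb' = [Lb']"
  by (simp_all add: ga_def gb_def gb'_def Modgrp_inverse reduced_def)

lemma word_of_eq_iff: "g = h \<longleftrightarrow> word_of g = word_of h"
  by (simp add: word_of_inject)

lemmas word_of_ops = times_modgrp.rep_eq one_modgrp.rep_eq

lemma gens_mult [simp]:
  "ga * ga = 1" "gb * gb = gb'" "gb' * gb' = gb" "gb * gb' = 1" "gb' * gb = 1"
  by (simp_all add: word_of_eq_iff word_of_ops)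

lemma gens_mult_left [simp]:
  "ga * (ga * g) = g" "gb * (gb * g) = gb' * g" "gb' * (gb' * g) = gb * g" "gb * (gb' * g) = g" "gb' * (gb * g) = g"
  by (simp_all add: mult.assoc[symmetric])

lemma nondegenerateI:
  assumes a: "ga \<in> semigroup_generated (set_pmf \<mu>)" and b: "gb \<in> semigroup_generated (set_pmf \<mu>)"
  shows "nondegenerate \<mu>"
proof -
  have letter: "Modgrp [x] \<in> semigroup_generated (set_pmf \<mu>)" for x
  proof (cases x)
    case Lb'
    then show ?thesis
      using semigroup_generated.mult[OF b b] by (simp add: gb'_def)
  qed (use a b in \<open>simp_all add: ga_def gb_def\<close>)
  have "reduced w \<Longrightarrow> Modgrp w \<in> semigroup_generated (set_pmf \<mu>)" for w
  proof (induction w)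
    case Nil
    have "1 = ga * ga" by simp
    also have "\<dots> \<in> semigroup_generated (set_pmf \<mu>)" by (rule semigroup_generated.mult[OF a a])
    finally show ?case by (simp add: one_modgrp_def)
  next
    case (Cons x w)
    then have w: "reduced w" by (blast dest: reduced_ConsD)
    have "lcons x w = x # w" using Cons.prems by (cases rule: reduced_cases) auto
    then have "Modgrp (x # w) = Modgrp [x] * Modgrp w"
      using w Cons.prems by (simp add: word_of_eq_iff word_of_ops Modgrp_inverse reduced_def)
    then show ?case
      using semigroup_generated.mult[OF letter Cons.IH[OF w]] by simp
  qed
  then have "Modgrp (word_of g) \<in> semigroup_generated (set_pmf \<mu>)" for g by simp
  then show ?thesis
    by (auto simp: nondegenerate_def word_of_inverse)
qed

section \<open>Random walks supported on the product of the two free factors\<close>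

text \<open>A duplicate-free list, so that sums over the support unfold into explicit terms.\<close>

definition factor_product :: "modgrp list" where
  "factor_product = [1, gb, gb', ga, ga * gb, ga * gb']"

lemma distinct_factor_product: "distinct factor_product"
  by (simp add: factor_product_def word_of_eq_iff word_of_ops)

lemma bact_vimage:
  "bact 1 -` N = N" "bact gb -` N = bcons Lb -` N" "bact gb' -` N = bcons Lb' -` N" "bact ga -` N = bcons La -` N"
  "bact (ga * gb) -` N = bcons Lb -` (bcons La -` N)" "bact (ga * gb') -` N = bcons Lb' -` (bcons La -` N)"
  by (auto simp: bact_def word_of_ops)

text \<open>After one step the mass is distributed over the cylinders of b, of its inverse, and of
  the two words of length two beginning with a; beyond that the coins are untouched.
  \<open>B\<close> and \<open>B'\<close> balance the first two, \<open>ratio\<close> the proportion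
  of the last two, and the mass of a then follows from total mass 1.\<close>

lemma markov_pushes:
  fixes \<mu> :: "modgrp pmf"
  defines "x \<equiv> pmf \<mu> ga" and "y \<equiv> pmf \<mu> (ga * gb)" and "z \<equiv> pmf \<mu> (ga * gb')"
    and "u \<equiv> pmf \<mu> gb" and "v \<equiv> pmf \<mu> gb'" and "w \<equiv> pmf \<mu> 1"
  assumes supp: "set_pmf \<mu> \<subseteq> set factor_product"
    and p: "0 \<le> p" "p \<le> 1" and total: "\<alpha> + \<beta> + \<gamma> = 1"
    and \<theta>: "pmf \<theta> La = \<alpha>" "pmf \<theta> Lb = \<beta>" "pmf \<theta> Lb' = \<gamma>"
    and ratio: "(1 - p) * (x * \<beta> + y * \<alpha> + z * \<gamma>) = p * (x * \<gamma> + y * \<beta> + z * \<alpha>)"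
    and B: "\<beta> = p * (x * \<alpha> + y * \<gamma> + z * \<beta>) + u * \<alpha> + v * \<gamma> + w * \<beta>"
    and B': "\<gamma> = (1 - p) * (x * \<alpha> + y * \<gamma> + z * \<beta>) + u * \<beta> + v * \<alpha> + w * \<gamma>"
  shows "pushes \<mu> (markov \<theta> p) (markov \<theta> p)"
  unfolding pushes_def
proof
  fix N :: "boundary set" assume N: "N \<in> sets borel"
  interpret prob_space "markov \<theta> p" by (rule prob_space_markov)
  have sum1: "x + y + z + u + v + w = 1"
  proof -
    have "(\<Sum>s\<in>set factor_product. pmf \<mu> s) = 1"
      using supp by (intro sum_pmf_eq_1) auto
    then show ?thesis
      by (simp add: sum.distinct_set_conv_list[OF distinct_factor_product])
        (simp add: factor_product_def x_def y_def z_def u_def v_def w_def)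
  qed
  define q where "q = 1 - p"
  \<comment> \<open>\<open>vT\<close> and \<open>vF\<close> are the probabilities of
    \<open>N\<close> given that the word starts with a followed by b, respectively by the inverse of
    b.\<close>
  define vT where "vT = coin_measure p Lb (bcons La -` N)"
  define vF where "vF = coin_measure p Lb' (bcons La -` N)"
  define uB where "uB = coin_measure p Lb N"
  define uB' where "uB' = coin_measure p Lb' N"
  have cm: "coin_measure p La N = p * vT + q * vF" "coin_measure p La (bcons La -` N) = p * uB + q * uB'"
    unfolding vT_def vF_def uB_def uB'_def q_def using p N coin_measure_split coin_measure_La by auto
  have bN: "bcons l -` N' \<in> sets borel" if "N' \<in> sets borel" for l N'
    using measurable_sets[OF measurable_bcons that, of l] by simp
  \<comment> \<open>\<open>S\<close> and \<open>S'\<close> are the masses arriving on these two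
    cylinders through steps that put a new a in front; \<open>ratio\<close> says that they stand in
    the proportion \<open>p\<close> to \<open>q\<close>.\<close>
  define S where "S = x * \<beta> + y * \<alpha> + z * \<gamma>"
  define S' where "S' = x * \<gamma> + y * \<beta> + z * \<alpha>"
  have S: "S = p * (S + S')" "S' = q * (S + S')"
    using ratio unfolding q_def S_def[symmetric] S'_def[symmetric] by (simp_all add: algebra_simps)
  have A: "\<alpha> = (S + S') + (u * \<gamma> + v * \<beta> + w * \<alpha>)"
  proof -
    have "\<alpha> + \<beta> + \<gamma> = (x + y + z + u + v + w) * (\<alpha> + \<beta> + \<gamma>)" using sum1 by simp
    with B B' show ?thesis by (simp add: S_def S'_def algebra_simps)
  qed
  have "(\<integral>\<^sup>+s. emeasure (markov \<theta> p) (bact s -` N) \<partial>\<mu>)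
      = (\<Sum>s\<in>set factor_product. emeasure (markov \<theta> p) (bact s -` N) * pmf \<mu> s)"
    using supp by (intro nn_integral_measure_pmf_support) (auto simp: subset_eq)
  also have "\<dots> = ennreal (\<Sum>s\<in>set factor_product. measure (markov \<theta> p) (bact s -` N) * pmf \<mu> s)"
    by (simp add: emeasure_eq_measure ennreal_mult[symmetric] sum_ennreal)
  also have "(\<Sum>s\<in>set factor_product. measure (markov \<theta> p) (bact s -` N) * pmf \<mu> s)
      = S * vT + S' * vF + (u * \<gamma> + v * \<beta> + w * \<alpha>) * (p * vT + q * vF)
        + (p * (x * \<alpha> + y * \<gamma> + z * \<beta>) + u * \<alpha> + v * \<gamma> + w * \<beta>) * uB
        + (q * (x * \<alpha> + y * \<gamma> + z * \<beta>) + u * \<beta> + v * \<alpha> + w * \<gamma>) * uB'"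
    by (simp add: sum.distinct_set_conv_list[OF distinct_factor_product])
      (simp add: factor_product_def bact_vimage measure_markov bN N coin_measure_b cm
        vT_def[symmetric] vF_def[symmetric] uB_def[symmetric] uB'_def[symmetric]
        x_def[symmetric] y_def[symmetric] z_def[symmetric] u_def[symmetric] v_def[symmetric] w_def[symmetric]
        \<theta> S_def S'_def algebra_simps)
  also have "\<dots> = \<alpha> * (p * vT + q * vF) + \<beta> * uB + \<gamma> * uB'"
  proof -
    have "S * vT + S' * vF = p * (S + S') * vT + q * (S + S') * vF"
      by (rule arg_cong2[where f="\<lambda>r r'. r * vT + r' * vF", OF S])
    moreover have "\<alpha> * (p * vT + q * vF) = ((S + S') + (u * \<gamma> + v * \<beta> + w * \<alpha>)) * (p * vT + q * vF)"
      by (rule arg_cong[where f="\<lambda>r. r * (p * vT + q * vF)", OF A])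
    moreover have "\<beta> * uB = (p * (x * \<alpha> + y * \<gamma> + z * \<beta>) + u * \<alpha> + v * \<gamma> + w * \<beta>) * uB"
      by (rule arg_cong[where f="\<lambda>r. r * uB", OF B])
    moreover have "\<gamma> * uB' = (q * (x * \<alpha> + y * \<gamma> + z * \<beta>) + u * \<beta> + v * \<alpha> + w * \<gamma>) * uB'"
      by (rule arg_cong[where f="\<lambda>r. r * uB'", OF B'[folded q_def]])
    ultimately show ?thesis
      by (simp only: distrib_left distrib_right mult.assoc mult.left_commute[of _ q] mult.left_commute[of _ p])
  qed
  also have "\<dots> = measure (markov \<theta> p) N"
    using N by (simp add: measure_markov \<theta> cm uB_def uB'_def)
  finally show "emeasure (markov \<theta> p) N = (\<integral>\<^sup>+s. emeasure (markov \<theta> p) (bact s -` N) \<partial>\<mu>)"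
    by (simp add: emeasure_eq_measure)
qed

text \<open>The weights are the cofactors of the linear system expressing stationarity on the cylinders
  of \<open>b\<close> and \<open>b\<^sup>2\<close>; the remaining equation (the ratio of the two cylinders of length two inside
  that of \<open>a\<close>) is solved for \<open>p\<close> by the intermediate value theorem.\<close>

lemma markov_solution:
  fixes x y z u v w :: real
  assumes nn: "0 \<le> x" "0 \<le> y" "0 \<le> z" "0 \<le> u" "0 < v" "0 \<le> w"
    and pos: "0 < x + y + z" and sum1: "x + y + z + u + v + w = 1"
  shows "\<exists>p \<alpha> \<beta> \<gamma>. 0 < p \<and> p < 1 \<and> 0 < \<alpha> \<and> 0 < \<beta> \<and> 0 < \<gamma> \<and> \<alpha> + \<beta> + \<gamma> = 1 \<and>
    (1 - p) * (x * \<beta> + y * \<alpha> + z * \<gamma>) = p * (x * \<gamma> + y * \<beta> + z * \<alpha>) \<and>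
    \<beta> = p * (x * \<alpha> + y * \<gamma> + z * \<beta>) + u * \<alpha> + v * \<gamma> + w * \<beta> \<and>
    \<gamma> = (1 - p) * (x * \<alpha> + y * \<gamma> + z * \<beta>) + u * \<beta> + v * \<alpha> + w * \<gamma> \<and>
    (p = 1 / 2 \<longleftrightarrow> (x - z) * (u - v) + (y - z) * (1 - w + v) = 0)"
proof -
  define Q where "Q = (x - z) * (u - v) + (y - z) * (1 - w + v)"
  define a where "a p = (1 - p * z - w) * (1 - (1 - p) * y - w) - (p * y + v) * ((1 - p) * z + u)" for p
  define b where "b p = (p * x + u) * (1 - (1 - p) * y - w) + (p * y + v) * ((1 - p) * x + v)" for p
  define c where "c p = ((1 - p) * x + v) * (1 - p * z - w) + ((1 - p) * z + u) * (p * x + u)" for p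
  define G where "G p = (1 - p) * (x * b p + y * a p + z * c p) - p * (x * c p + y * b p + z * a p)" for p
  have positive: "0 < a p" "0 < b p" "0 < c p" if p: "0 \<le> p" "p \<le> 1" for p
  proof -
    define q where "q = 1 - p"
    have q: "0 \<le> q" by (simp add: q_def p)
    \<comment> \<open>Total mass 1 turns the differences into sums of nonnegative terms; strictness
      throughout comes from \<open>v\<close>.\<close>
    have P: "1 - p * z - w = x + y + q * z + u + v" "1 - q * y - w = x + p * y + z + u + v"
      using sum1 by (simp_all add: q_def algebra_simps)
    have n: "0 \<le> p * x" "0 \<le> p * y" "0 \<le> q * z" "0 \<le> q * x" using p q nn by simp_all
    have "(q * z + u) * (p * y + v) < (x + y + q * z + u + v) * (x + p * y + z + u + v)"
      by (rule mult_less_le_imp_less) (use nn n in linarith)+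
    then show "0 < a p"
      unfolding a_def q_def[symmetric] P by (simp add: mult.commute)
    have "0 \<le> (p * x + u) * (x + p * y + z + u + v)" "0 \<le> (q * z + u) * (p * x + u)"
      by (rule mult_nonneg_nonneg; use nn n in linarith)+
    moreover have "0 < (p * y + v) * (q * x + v)" "0 < (q * x + v) * (x + y + q * z + u + v)"
      by (rule mult_pos_pos; use nn n in linarith)+
    ultimately show "0 < b p" "0 < c p"
      unfolding b_def c_def q_def[symmetric] P by linarith+
  qed
  have eqs: "b p = p * (x * a p + y * c p + z * b p) + u * a p + v * c p + w * b p"
    "c p = (1 - p) * (x * a p + y * c p + z * b p) + u * b p + v * a p + w * c p" for p
  proof -
    have "b p * (1 - p * z - w) = (p * x + u) * a p + (p * y + v) * c p"
      unfolding a_def b_def c_def by algebra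
    then show "b p = p * (x * a p + y * c p + z * b p) + u * a p + v * c p + w * b p"
      by (simp add: algebra_simps)
    have "c p * (1 - (1 - p) * y - w) = ((1 - p) * x + v) * a p + ((1 - p) * z + u) * b p"
      unfolding a_def b_def c_def by algebra
    then show "c p = (1 - p) * (x * a p + y * c p + z * b p) + u * b p + v * a p + w * c p"
      by (simp add: algebra_simps)
  qed
  have half: "G (1 / 2) = 0 \<longleftrightarrow> Q = 0"
  proof -
    define d where "d = b (1 / 2) - c (1 / 2)"
    define e where "e = a (1 / 2) - b (1 / 2)"
    have cb: "b (1 / 2) = a (1 / 2) - e" "c (1 / 2) = a (1 / 2) - e - d" by (simp_all add: d_def e_def)
    \<comment> \<open>At \<open>p = 1 / 2\<close> the terms with \<open>x\<close>, \<open>y\<close>,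
      \<open>z\<close> of the two balance equations coincide and disappear in their
      difference.\<close>
    have d: "(1 - w + v) * d = (u - v) * e"
      using eqs(1)[of "1 / 2"] eqs(2)[of "1 / 2"] unfolding d_def e_def by (simp add: algebra_simps)
    have w: "0 < 1 - w + v" using nn sum1 by linarith
    \<comment> \<open>Otherwise all three weights agree, and the balance at b forces
      \<open>x + y + z = 0\<close>.\<close>
    have "e \<noteq> 0"
    proof
      assume e: "e = 0"
      with d w have "d = 0" by simp
      with e cb have "b (1 / 2) = a (1 / 2)" "c (1 / 2) = a (1 / 2)" by simp_all
      with eqs(1)[of "1 / 2"] have "a (1 / 2) * 1 = a (1 / 2) * ((x + y + z) / 2 + u + v + w)"
        by (simp add: algebra_simps add_divide_distrib)
      with positive(1)[of "1 / 2"] have "1 = (x + y + z) / 2 + u + v + w" by simp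
      with sum1 pos show False by argo
    qed
    have "2 * G (1 / 2) = (x - z) * d + (y - z) * e"
      unfolding G_def cb by (simp add: algebra_simps)
    then have "(1 - w + v) * (2 * G (1 / 2)) = (1 - w + v) * ((x - z) * d + (y - z) * e)"
      by (simp only:)
    also have "\<dots> = (x - z) * ((1 - w + v) * d) + (y - z) * ((1 - w + v) * e)"
      by (simp add: algebra_simps)
    also have "\<dots> = e * Q" unfolding d Q_def by (simp add: algebra_simps)
    finally show ?thesis using w \<open>e \<noteq> 0\<close> by auto
  qed
  \<comment> \<open>At each endpoint only one of the two products in \<open>G\<close> survives, and
    it is positive because the weights are and \<open>x + y + z\<close> is.\<close>
  have G0: "G 0 > 0" and G1: "G 1 < 0"
  proof -
    have *: "0 < x * r + y * s + z * t" if "0 < r" "0 < s" "0 < t" for r s t :: real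
    proof -
      have m: "0 < min r (min s t)" using that by simp
      have "0 < (x + y + z) * min r (min s t)" using pos m by simp
      also have "\<dots> \<le> x * r + y * s + z * t"
        unfolding distrib_right using nn by (intro add_mono mult_left_mono) auto
      finally show ?thesis .
    qed
    show "G 0 > 0" "G 1 < 0"
      unfolding G_def using *[of "b 0" "a 0" "c 0"] *[of "c 1" "b 1" "a 1"] positive[of 0] positive[of 1] by simp_all
  qed
  have "\<exists>p. 0 < p \<and> p < 1 \<and> G p = 0 \<and> (p = 1 / 2 \<longleftrightarrow> Q = 0)"
  proof (cases "Q = 0")
    case True
    with half show ?thesis by (intro exI[of _ "1 / 2"]) simp
  next
    case False
    have "continuous_on {0..1} G"
      unfolding G_def a_def b_def c_def by (intro continuous_intros)
    then obtain p where p: "0 \<le> p" "p \<le> 1" "G p = 0"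
      using IVT2'[of G 1 0 0] G0 G1 by auto
    moreover have "p \<noteq> 0" "p \<noteq> 1" "p \<noteq> 1 / 2"
      using p(3) G0 G1 half False by (metis less_irrefl)+
    ultimately show ?thesis using False by (intro exI[of _ p]) auto
  qed
  then obtain p where p: "0 < p" "p < 1" "G p = 0" "p = 1 / 2 \<longleftrightarrow> Q = 0" by blast
  define T where "T = a p + b p + c p"
  have pp: "0 < a p" "0 < b p" "0 < c p" using positive p by auto
  then have T: "0 < T" by (simp add: T_def)
  have r1: "(1 - p) * (x * (b p / T) + y * (a p / T) + z * (c p / T)) = p * (x * (c p / T) + y * (b p / T) + z * (a p / T))"
  proof -
    have scale: "x * (r / T) + y * (s / T) + z * (t / T) = (x * r + y * s + z * t) / T" for r s t
      by (simp add: add_divide_distrib)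
    have "(1 - p) * (x * b p + y * a p + z * c p) = p * (x * c p + y * b p + z * a p)"
      using p(3) unfolding G_def by simp
    then show ?thesis unfolding scale by (simp only: times_divide_eq_right)
  qed
  have r2: "b p / T = p * (x * (a p / T) + y * (c p / T) + z * (b p / T)) + u * (a p / T) + v * (c p / T) + w * (b p / T)"
    by (rule trans[OF arg_cong[where f="\<lambda>r. r / T", OF eqs(1)[of p]]])
      (simp add: add_divide_distrib distrib_left)
  have r3: "c p / T = (1 - p) * (x * (a p / T) + y * (c p / T) + z * (b p / T)) + u * (b p / T) + v * (a p / T) + w * (c p / T)"
    by (rule trans[OF arg_cong[where f="\<lambda>r. r / T", OF eqs(2)[of p]]])
      (simp add: add_divide_distrib distrib_left)
  have r4: "a p / T + b p / T + c p / T = 1"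
  proof -
    have "a p / T + b p / T + c p / T = T / T"
      unfolding add_divide_distrib[symmetric] by (simp only: T_def)
    also have "\<dots> = 1" using T by simp
    finally show ?thesis .
  qed
  have "0 < a p / T" "0 < b p / T" "0 < c p / T" using pp T by simp_all
  then show ?thesis
    using p(1,2) p(4)[unfolded Q_def] r1 r2 r3 r4 by blast
qed

lemma stationary_markovI:
  assumes "finite (set_pmf \<mu>)" "0 < p" "p < 1" "pushes \<mu> (markov \<theta> p) (markov \<theta> p)"
    and "s \<in> set_pmf \<mu>" "D \<in> sets borel" "measure (markov \<theta> p) (bact s -` D) \<noteq> measure (markov \<theta> p) D"
  shows "stationary \<mu> (markov \<theta> p)"
proof (rule stationary.intro)
  show "\<exists>s\<in>set_pmf \<mu>. \<exists>D\<in>sets borel. measure (markov \<theta> p) (bact s -` D) \<noteq> measure (markov \<theta> p) D"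
    using assms by blast
qed (use assms prob_space_markov markov_atomless in auto)

text \<open>Up to a nonzero factor, the value at \<open>p = 1/2\<close> of the equation for \<open>p\<close> in \<open>markov_solution\<close>.\<close>

definition filling_defect :: "modgrp pmf \<Rightarrow> real" where
  "filling_defect \<mu> = (pmf \<mu> ga - pmf \<mu> (ga * gb')) * (pmf \<mu> gb - pmf \<mu> gb')
     + (pmf \<mu> (ga * gb) - pmf \<mu> (ga * gb')) * (1 - pmf \<mu> 1 + pmf \<mu> gb')"

text \<open>The set \<open>D\<close> witnesses non-invariance under the single element
  \<open>gb'\<close>, so it can be reused for any other step distribution that charges
  \<open>gb'\<close> and has the same stationary measure.\<close>

lemma factor_product_stationary:
  assumes supp: "set_pmf \<mu> \<subseteq> set factor_product" and v: "gb' \<in> set_pmf \<mu>"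
    and pos: "set_pmf \<mu> \<inter> {ga, ga * gb, ga * gb'} \<noteq> {}"
  shows "\<exists>\<theta> p D. 0 < p \<and> p < 1 \<and> set_pmf \<theta> = UNIV \<and> stationary \<mu> (markov \<theta> p) \<and>
    D \<in> sets borel \<and> measure (markov \<theta> p) (bact gb' -` D) \<noteq> measure (markov \<theta> p) D \<and>
    (p = 1 / 2 \<longleftrightarrow> filling_defect \<mu> = 0)"
proof -
  let ?x = "pmf \<mu> ga" and ?y = "pmf \<mu> (ga * gb)" and ?z = "pmf \<mu> (ga * gb')"
    and ?u = "pmf \<mu> gb" and ?v = "pmf \<mu> gb'" and ?w = "pmf \<mu> 1"
  have sum1: "?x + ?y + ?z + ?u + ?v + ?w = 1"
  proof -
    have "(\<Sum>s\<in>set factor_product. pmf \<mu> s) = 1"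
      using supp by (intro sum_pmf_eq_1) auto
    then show ?thesis
      by (simp add: sum.distinct_set_conv_list[OF distinct_factor_product]) (simp add: factor_product_def)
  qed
  have "0 < ?x \<or> 0 < ?y \<or> 0 < ?z" using pos by (auto intro: pmf_positive)
  then have xyz: "0 < ?x + ?y + ?z"
    using pmf_nonneg[of \<mu>] by (smt (verit))
  have "0 < ?v" using v by (rule pmf_positive)
  then obtain p \<alpha> \<beta> \<gamma> where p: "0 < p" "p < 1" and w: "0 < \<alpha>" "0 < \<beta>" "0 < \<gamma>" "\<alpha> + \<beta> + \<gamma> = 1"
    and ratio: "(1 - p) * (?x * \<beta> + ?y * \<alpha> + ?z * \<gamma>) = p * (?x * \<gamma> + ?y * \<beta> + ?z * \<alpha>)"
    and B: "\<beta> = p * (?x * \<alpha> + ?y * \<gamma> + ?z * \<beta>) + ?u * \<alpha> + ?v * \<gamma> + ?w * \<beta>"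
    and B': "\<gamma> = (1 - p) * (?x * \<alpha> + ?y * \<gamma> + ?z * \<beta>) + ?u * \<beta> + ?v * \<alpha> + ?w * \<gamma>"
    and half: "p = 1 / 2 \<longleftrightarrow> filling_defect \<mu> = 0"
    using markov_solution[OF pmf_nonneg[of \<mu> ga] pmf_nonneg[of \<mu> "ga * gb"] pmf_nonneg[of \<mu> "ga * gb'"]
        pmf_nonneg[of \<mu> gb] _ pmf_nonneg[of \<mu> 1] xyz sum1]
    unfolding filling_defect_def by blast
  define \<theta> where "\<theta> = embed_pmf (\<lambda>l. if l = La then \<alpha> else if l = Lb then \<beta> else \<gamma>)"
  have "pmf \<theta> l = (if l = La then \<alpha> else if l = Lb then \<beta> else \<gamma>)" for l
    unfolding \<theta>_def using w by (intro letter_pmf) auto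
  then have \<theta>: "pmf \<theta> La = \<alpha>" "pmf \<theta> Lb = \<beta>" "pmf \<theta> Lb' = \<gamma>" and full: "set_pmf \<theta> = UNIV"
    using w by (auto simp: set_pmf_eq)
  have push: "pushes \<mu> (markov \<theta> p) (markov \<theta> p)"
    using p by (intro markov_pushes[OF supp _ _ w(4) \<theta> ratio B B']) auto
  have "\<exists>D. D \<in> sets borel \<and> measure (markov \<theta> p) (bact gb' -` D) \<noteq> measure (markov \<theta> p) D"
  proof (rule ccontr)
    assume inv: "\<not> ?thesis"
    \<comment> \<open>Invariance under the inverse of b would make the first-letter weights
      invariant under a cyclic permutation, hence equal.\<close>
    have pmf_eq: "measure (markov \<theta> p) (bact gb' -` {\<gamma>. letter_at \<gamma> 0 = l}) = pmf \<theta> l" for l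
      using inv first_letter_borel[of l] markov_first_letter[of \<theta> p l] by metis
    have translate: "measure (markov \<theta> p) (bact gb' -` N)
        = \<alpha> * coin_measure p Lb' N + \<beta> * coin_measure p La N + \<gamma> * coin_measure p Lb N"
      if "N \<in> sets borel" for N
      using measurable_sets[OF measurable_bcons that, of Lb']
      by (simp add: bact_vimage measure_markov coin_measure_b \<theta>)
    have "measure (markov \<theta> p) (bact gb' -` {\<gamma>. letter_at \<gamma> 0 = l})
        = \<alpha> * of_bool (l = Lb') + \<beta> * of_bool (l = La) + \<gamma> * of_bool (l = Lb)" for l
      by (subst translate[OF first_letter_borel]) (cases l; simp add: coin_measure_first_letter)
    with pmf_eq have "pmf \<theta> l = \<alpha> * of_bool (l = Lb') + \<beta> * of_bool (l = La) + \<gamma> * of_bool (l = Lb)" for l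
      by metis
    from this[of La] this[of Lb] have eq: "\<beta> = \<alpha>" "\<gamma> = \<alpha>" using \<theta> by auto
    \<comment> \<open>With equal weights the sum of the two balance equations loses the mass of the
      steps beginning with a, a contradiction.\<close>
    have "\<beta> + \<gamma> = (?x * \<alpha> + ?y * \<gamma> + ?z * \<beta>) + ?u * (\<alpha> + \<beta>) + ?v * (\<gamma> + \<alpha>) + ?w * (\<beta> + \<gamma>)"
      using B B' by (simp add: algebra_simps)
    then have "2 * \<alpha> = \<alpha> * (2 * (?x + ?y + ?z + ?u + ?v + ?w) - (?x + ?y + ?z))"
      unfolding eq by (simp add: algebra_simps)
    then show False
      using xyz w(1) unfolding sum1 by simp
  qed
  then obtain D where D: "D \<in> sets borel" "measure (markov \<theta> p) (bact gb' -` D) \<noteq> measure (markov \<theta> p) D"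
    by blast
  have "stationary \<mu> (markov \<theta> p)"
    using supp finite_subset by (intro stationary_markovI[OF _ p push v D]) auto
  with p full D half show ?thesis by blast
qed

theorem filling_factor_product_iff:
  assumes "set_pmf \<mu> \<subseteq> set factor_product" "gb' \<in> set_pmf \<mu>"
    and "set_pmf \<mu> \<inter> {ga, ga * gb, ga * gb'} \<noteq> {}"
  shows "filling \<mu> \<longleftrightarrow> filling_defect \<mu> = 0"
proof -
  obtain \<theta> p where p: "0 < p" "p < 1" and full: "set_pmf \<theta> = UNIV"
    and st: "stationary \<mu> (markov \<theta> p)" and half: "p = 1 / 2 \<longleftrightarrow> filling_defect \<mu> = 0"
    using factor_product_stationary[OF assms] by blast
  have harm: "harmonic_measure \<mu> = markov \<theta> p" by (rule stationary.harmonic_measure_eq[OF st])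
  have "0 < pmf \<theta> l" for l using full by (simp add: pmf_positive)
  then show ?thesis
    using filling_markov_half[of \<mu> \<theta>] not_filling_markov[OF harm p] harm half by blast
qed

section \<open>Conjugation by \<open>b\<close>\<close>

definition conj_b :: "modgrp pmf \<Rightarrow> modgrp pmf" where
  "conj_b \<mu> = map_pmf (\<lambda>s. gb * s * gb') \<mu>"

text \<open>Effect of left multiplication by b on the first letter of a boundary point.\<close>

definition rotate_letter :: "letter \<Rightarrow> letter" where
  "rotate_letter l = (case l of La \<Rightarrow> Lb | Lb \<Rightarrow> Lb' | Lb' \<Rightarrow> La)"

lemma markov_rotate:
  assumes N: "N \<in> sets borel"
  shows "emeasure (markov (map_pmf rotate_letter \<theta>) p) N = emeasure (markov \<theta> p) (bact gb -` N)"
proof -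
  have *: "emeasure (markov \<theta> p) N = (\<integral>\<^sup>+l. ennreal (coin_measure p l N) \<partial>\<theta>)" if "N \<in> sets borel" for \<theta> N
    unfolding emeasure_markov[OF that]
    by (subst nn_integral_measure_pmf_support[of UNIV])
      (simp_all add: sum_ennreal[symmetric] ennreal_mult mult.commute)
  have "coin_measure p l (bact gb -` N) = coin_measure p (rotate_letter l) N" for l
    by (cases l) (simp_all add: rotate_letter_def bact_vimage coin_measure_b)
  then show ?thesis
    using N by (simp add: *)
qed

text \<open>Conjugating the steps by b translates the stationary measure by b, which only rotates
  the first-letter weights; the bias \<open>p\<close> is unchanged.\<close>

lemma stationary_conj_b:
  assumes "stationary \<mu> (markov \<theta> p)" and p: "0 < p" "p < 1"
  shows "stationary (conj_b \<mu>) (markov (map_pmf rotate_letter \<theta>) p)"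
proof -
  interpret stationary \<mu> "markov \<theta> p" by fact
  let ?\<nu> = "markov (map_pmf rotate_letter \<theta>) p"
  have m: "bact (g * h) -` N = bact h -` (bact g -` N)" for g h N
    by (auto simp: bact_mult)
  have push: "pushes (conj_b \<mu>) ?\<nu> ?\<nu>"
    unfolding pushes_def
  proof
    fix N :: "boundary set" assume N: "N \<in> sets borel"
    have "bact gb -` (bact (gb * s * gb') -` N) = bact s -` (bact gb -` N)" for s
      by (simp add: m[symmetric] mult.assoc)
    then have "(\<integral>\<^sup>+s. emeasure ?\<nu> (bact s -` N) \<partial>conj_b \<mu>) = (\<integral>\<^sup>+s. emeasure (markov \<theta> p) (bact s -` (bact gb -` N)) \<partial>\<mu>)"
      using N by (simp add: conj_b_def markov_rotate)
    also have "\<dots> = emeasure ?\<nu> N"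
      unfolding markov_rotate[OF N]
      by (rule pushes[unfolded pushes_def, rule_format, OF vimage_bact_borel[OF N], symmetric])
    finally show "emeasure ?\<nu> N = (\<integral>\<^sup>+s. emeasure ?\<nu> (bact s -` N) \<partial>conj_b \<mu>)" ..
  qed
  obtain s D where s: "s \<in> set_pmf \<mu>" and D: "D \<in> sets borel"
    and ne: "measure (markov \<theta> p) (bact s -` D) \<noteq> measure (markov \<theta> p) D"
    using not_invariant by blast
  let ?D = "bact gb' -` D"
  have "bact gb -` (bact (gb * s * gb') -` ?D) = bact s -` D" "bact gb -` ?D = D"
    by (simp_all add: m[symmetric] mult.assoc bact_vimage(1))
  then have "measure ?\<nu> (bact (gb * s * gb') -` ?D) \<noteq> measure ?\<nu> ?D"
    using ne D by (simp add: measure_def markov_rotate)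
  then show ?thesis
    using s D fin p push by (intro stationary_markovI[where s="gb * s * gb'" and D="?D"]) (auto simp: conj_b_def)
qed

section \<open>The examples\<close>

definition kappa :: "modgrp pmf" where
  "kappa = pmf_of_multiset {#ga, ga, gb, gb'#}"

definition kappa_b :: "modgrp pmf" where
  "kappa_b = map_pmf (\<lambda>s. s * gb) kappa"

text \<open>The weights solve the filling equation asymmetrically: 3/8 * (-1/2) + 1/8 * (1 + 1/2) =
  0.\<close>

definition lambda :: "modgrp pmf" where
  "lambda = pmf_of_multiset {#ga, ga, ga, ga * gb, gb', gb', gb', gb'#}"

lemma gens_neq [simp]:
  "ga \<noteq> 1" "gb \<noteq> 1" "gb' \<noteq> 1" "1 \<noteq> ga" "1 \<noteq> gb" "1 \<noteq> gb'"
  "ga \<noteq> gb" "ga \<noteq> gb'" "gb \<noteq> gb'" "gb \<noteq> ga" "gb' \<noteq> ga" "gb' \<noteq> gb"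
  "ga * gb \<noteq> 1" "ga * gb \<noteq> ga" "ga * gb \<noteq> gb" "ga * gb \<noteq> gb'" "ga * gb \<noteq> ga * gb'"
  "ga * gb' \<noteq> 1" "ga * gb' \<noteq> ga" "ga * gb' \<noteq> gb" "ga * gb' \<noteq> gb'" "ga * gb' \<noteq> ga * gb"
  "1 \<noteq> ga * gb" "ga \<noteq> ga * gb" "gb \<noteq> ga * gb" "gb' \<noteq> ga * gb"
  "1 \<noteq> ga * gb'" "ga \<noteq> ga * gb'" "gb \<noteq> ga * gb'" "gb' \<noteq> ga * gb'"
  by (simp_all add: word_of_eq_iff word_of_ops)

lemma set_kappa: "set_pmf kappa = {ga, gb, gb'}"
  by (auto simp: kappa_def)

lemma set_lambda: "set_pmf lambda = {ga, ga * gb, gb'}"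
  by (auto simp: lambda_def)

lemma set_kappa_b: "set_pmf kappa_b = {ga * gb, gb', 1}"
  by (auto simp: kappa_b_def set_kappa)

lemma pmf_kappa: "pmf kappa ga = 1 / 2" "pmf kappa gb = 1 / 4" "pmf kappa gb' = 1 / 4" "pmf kappa 1 = 0"
  "pmf kappa (ga * gb) = 0" "pmf kappa (ga * gb') = 0"
  by (simp_all add: kappa_def)

lemma pmf_lambda: "pmf lambda ga = 3 / 8" "pmf lambda gb = 0" "pmf lambda gb' = 1 / 2" "pmf lambda 1 = 0"
  "pmf lambda (ga * gb) = 1 / 8" "pmf lambda (ga * gb') = 0"
  by (simp_all add: lambda_def)

lemma pmf_kappa_b: "pmf kappa_b (s * gb) = pmf kappa s"
proof -
  have "inj (\<lambda>s. s * gb)"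
    by (rule injI) (metis gens_mult(4) mult.assoc mult.right_neutral)
  then show ?thesis unfolding kappa_b_def by (rule pmf_map_inj')
qed

lemma factor_product_mem: "ga \<in> set factor_product" "gb \<in> set factor_product" "gb' \<in> set factor_product"
  "1 \<in> set factor_product" "ga * gb \<in> set factor_product" "ga * gb' \<in> set factor_product"
  by (simp_all add: factor_product_def)

lemma filling_kappa: "filling kappa"
  by (subst filling_factor_product_iff)
    (auto simp: set_kappa factor_product_mem filling_defect_def pmf_kappa)

lemma filling_lambda: "filling lambda"
  by (subst filling_factor_product_iff)
    (auto simp: set_lambda factor_product_mem filling_defect_def pmf_lambda)

lemma nondegenerate_kappa: "nondegenerate kappa"
  by (intro nondegenerateI semigroup_generated.base) (simp_all add: set_kappa)

lemma nondegenerate_conj_b: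
  assumes "nondegenerate \<mu>" shows "nondegenerate (conj_b \<mu>)"
proof -
  have "gb * s * gb' \<in> semigroup_generated (set_pmf (conj_b \<mu>))" if "s \<in> semigroup_generated (set_pmf \<mu>)" for s
    using that
  proof induction
    case (base s)
    then show ?case by (intro semigroup_generated.base) (auto simp: conj_b_def)
  next
    case (mult s t)
    then show ?case
      using semigroup_generated.mult[OF mult.IH] by (simp add: mult.assoc)
  qed
  then have *: "gb * s * gb' \<in> semigroup_generated (set_pmf (conj_b \<mu>))" for s
    using assms by (simp add: nondegenerate_def)
  show ?thesis
    using *[of "gb' * ga * gb"] *[of gb] by (intro nondegenerateI) (simp_all add: mult.assoc)
qed

lemma filling_conj_b_kappa: "filling (conj_b kappa)" "filling (conj_b (conj_b kappa))"
proof -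
  obtain \<theta> p where p: "0 < p" "p < 1" and full: "set_pmf \<theta> = UNIV"
    and st: "stationary kappa (markov \<theta> p)" and half: "p = 1 / 2 \<longleftrightarrow> filling_defect kappa = 0"
    using factor_product_stationary[of kappa] by (auto simp: set_kappa factor_product_mem)
  have p2: "p = 1 / 2" using half by (simp add: filling_defect_def pmf_kappa)
  have "l \<in> range rotate_letter" for l
    by (cases l) (auto simp: rotate_letter_def image_iff intro: exI[of _ La] exI[of _ Lb] exI[of _ Lb'])
  then have surj: "range rotate_letter = UNIV" by blast
  have st1: "stationary (conj_b kappa) (markov (map_pmf rotate_letter \<theta>) p)"
    by (rule stationary_conj_b[OF st p])
  have st2: "stationary (conj_b (conj_b kappa)) (markov (map_pmf rotate_letter (map_pmf rotate_letter \<theta>)) p)"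
    by (rule stationary_conj_b[OF st1 p])
  show "filling (conj_b kappa)"
    by (rule filling_markov_half[OF stationary.harmonic_measure_eq[OF st1, unfolded p2]])
      (simp add: pmf_positive_iff full surj)
  show "filling (conj_b (conj_b kappa))"
    by (rule filling_markov_half[OF stationary.harmonic_measure_eq[OF st2, unfolded p2]])
      (simp add: pmf_positive_iff full surj)
qed

text \<open>The conjugating factors telescope: between consecutive increments, and after the last
  one, exactly one b remains because b^3 = 1.\<close>

lemma convolution_conjugates:
  "convolution_pmf (convolution_pmf kappa (conj_b kappa)) (conj_b (conj_b kappa))
    = convolution_pmf (convolution_pmf kappa_b kappa_b) kappa_b"
  by (simp add: convolution_pmf_bind conj_b_def kappa_b_def bind_map_pmf map_bind_pmf bind_assoc_pmf
      pmf.map_comp o_def mult.assoc)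

text \<open>The identity belongs to the support of \<open>kappa_b\<close>, so supports of
  convolution powers can only grow.\<close>

lemma set_kappa_b_cubed:
  "{ga * gb, gb'} \<subseteq> set_pmf (convolution_pmf (convolution_pmf kappa_b kappa_b) kappa_b)"
proof -
  have "s \<in> set_pmf (convolution_pmf (convolution_pmf kappa_b kappa_b) kappa_b)" if "s \<in> set_pmf kappa_b" for s
  proof -
    have one: "1 \<in> set_pmf kappa_b" by (simp add: set_kappa_b)
    have "s * 1 \<in> set_pmf (convolution_pmf kappa_b kappa_b)"
      unfolding set_convolution_pmf using that one by blast
    then have "s * 1 * 1 \<in> set_pmf (convolution_pmf (convolution_pmf kappa_b kappa_b) kappa_b)"
      unfolding set_convolution_pmf[of "convolution_pmf kappa_b kappa_b"] using one by blast
    then show ?thesis by simp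
  qed
  then show ?thesis by (simp add: set_kappa_b)
qed

lemma not_filling_triple_convolution:
  "\<not> filling (convolution_pmf (convolution_pmf kappa (conj_b kappa)) (conj_b (conj_b kappa)))"
proof -
  let ?\<mu> = "convolution_pmf (convolution_pmf kappa_b kappa_b) kappa_b"
  obtain \<theta> p D where p: "0 < p" "p < 1" and st: "stationary kappa_b (markov \<theta> p)"
    and D: "D \<in> sets borel" "measure (markov \<theta> p) (bact gb' -` D) \<noteq> measure (markov \<theta> p) D"
    and half: "p = 1 / 2 \<longleftrightarrow> filling_defect kappa_b = 0"
    using factor_product_stationary[of kappa_b] by (auto simp: set_kappa_b factor_product_mem)
  have "pmf kappa_b ga = 0" "pmf kappa_b gb = 0" "pmf kappa_b gb' = 1 / 4" "pmf kappa_b 1 = 1 / 4"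
    "pmf kappa_b (ga * gb) = 1 / 2" "pmf kappa_b (ga * gb') = 0"
    using pmf_kappa_b[of "ga * gb'"] pmf_kappa_b[of 1] pmf_kappa_b[of gb] pmf_kappa_b[of gb'] pmf_kappa_b[of ga]
      pmf_kappa_b[of "ga * gb"] by (simp_all add: pmf_kappa mult.assoc)
  then have p2: "p \<noteq> 1 / 2"
    unfolding half filling_defect_def by simp
  \<comment> \<open>A measure stationary for \<open>kappa_b\<close> is stationary for its
    convolution powers.\<close>
  have push: "pushes ?\<mu> (markov \<theta> p) (markov \<theta> p)"
    using stationary.pushes[OF st] by (intro pushes_convolution)
  have "finite (set_pmf ?\<mu>)"
    by (simp add: convolution_pmf_def set_kappa_b)
  then have "stationary ?\<mu> (markov \<theta> p)"
    using set_kappa_b_cubed by (intro stationary_markovI[OF _ p push _ D]) auto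
  then show ?thesis
    unfolding convolution_conjugates by (rule not_filling_markov[OF stationary.harmonic_measure_eq p p2])
qed

lemma nondegenerate_convolutions:
  "nondegenerate (convolution_pmf kappa (conj_b kappa))"
  "nondegenerate (convolution_pmf (convolution_pmf kappa (conj_b kappa)) (conj_b (conj_b kappa)))"
proof -
  have gen: "nondegenerate \<mu>" if "{ga * gb, gb'} \<subseteq> set_pmf \<mu>" for \<mu>
  proof (rule nondegenerateI)
    have b': "gb' \<in> semigroup_generated (set_pmf \<mu>)" and ab: "ga * gb \<in> semigroup_generated (set_pmf \<mu>)"
      using that by (auto intro: semigroup_generated.base)
    show "gb \<in> semigroup_generated (set_pmf \<mu>)"
      using semigroup_generated.mult[OF b' b'] by simp
    show "ga \<in> semigroup_generated (set_pmf \<mu>)"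
      using semigroup_generated.mult[OF ab b'] by (simp add: mult.assoc)
  qed
  have "set_pmf (conj_b kappa) = {gb * ga * gb', gb, gb'}"
    by (auto simp: conj_b_def set_kappa mult.assoc)
  then have "{ga * gb, gb * gb} \<subseteq> set_pmf (convolution_pmf kappa (conj_b kappa))"
    unfolding set_convolution_pmf set_kappa by blast
  then have "{ga * gb, gb'} \<subseteq> set_pmf (convolution_pmf kappa (conj_b kappa))"
    by simp
  then show "nondegenerate (convolution_pmf kappa (conj_b kappa))" by (rule gen)
  show "nondegenerate (convolution_pmf (convolution_pmf kappa (conj_b kappa)) (conj_b (conj_b kappa)))"
    unfolding convolution_conjugates by (rule gen[OF set_kappa_b_cubed])
qed

lemma convolution_example:
  "\<exists>\<mu>\<^sub>1 \<mu>\<^sub>2 :: modgrp pmf. finite (set_pmf \<mu>\<^sub>1) \<and> finite (set_pmf \<mu>\<^sub>2) \<and>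
    nondegenerate \<mu>\<^sub>1 \<and> nondegenerate \<mu>\<^sub>2 \<and> nondegenerate (convolution_pmf \<mu>\<^sub>1 \<mu>\<^sub>2) \<and>
    filling \<mu>\<^sub>1 \<and> filling \<mu>\<^sub>2 \<and> \<not> filling (convolution_pmf \<mu>\<^sub>1 \<mu>\<^sub>2)"
proof -
  have fin: "finite (set_pmf kappa)" "finite (set_pmf (conj_b kappa))" "finite (set_pmf (conj_b (conj_b kappa)))"
    "finite (set_pmf (convolution_pmf kappa (conj_b kappa)))"
    by (simp_all add: set_kappa conj_b_def convolution_pmf_def)
  note nd = nondegenerate_kappa nondegenerate_conj_b[OF nondegenerate_kappa]
    nondegenerate_conj_b[OF nondegenerate_conj_b[OF nondegenerate_kappa]] nondegenerate_convolutions
  show ?thesis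
  \<comment> \<open>If the first convolution is filling, it serves as a filling factor of the triple
    product, which is not filling; otherwise it is the example itself.\<close>
  proof (cases "filling (convolution_pmf kappa (conj_b kappa))")
    case True
    then show ?thesis
      using fin nd filling_conj_b_kappa(2) not_filling_triple_convolution by blast
  next
    case False
    then show ?thesis
      using fin nd filling_kappa filling_conj_b_kappa(1) by blast
  qed
qed

lemma convex_combination_example:
  "finite (set_pmf lambda) \<and> finite (set_pmf kappa) \<and> nondegenerate lambda \<and> nondegenerate kappa \<and>
   filling lambda \<and> filling kappa \<and>
   (\<forall>t::real. 0 < t \<and> t < 1 \<longrightarrow>
     nondegenerate (convex_comb_pmf t lambda kappa) \<and> \<not> filling (convex_comb_pmf t lambda kappa))"
proof (intro conjI allI impI)
  show "nondegenerate lambda"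
  proof (rule nondegenerateI)
    have *: "ga \<in> semigroup_generated (set_pmf lambda)" "ga * gb \<in> semigroup_generated (set_pmf lambda)"
      by (auto simp: set_lambda intro: semigroup_generated.base)
    show "gb \<in> semigroup_generated (set_pmf lambda)" using semigroup_generated.mult[OF *] by simp
    show "ga \<in> semigroup_generated (set_pmf lambda)" by (rule *)
  qed
  fix t :: real assume t: "0 < t \<and> t < 1"
  let ?\<mu> = "convex_comb_pmf t lambda kappa"
  have pmf: "pmf ?\<mu> g = t * pmf lambda g + (1 - t) * pmf kappa g" for g
    using t by (simp add: pmf_convex_comb_pmf)
  have "g \<in> set_pmf ?\<mu> \<longleftrightarrow> g \<in> set_pmf lambda \<or> g \<in> set_pmf kappa" for g
  proof -
    have "0 \<le> t * pmf lambda g" "0 \<le> (1 - t) * pmf kappa g" using t by simp_all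
    then show ?thesis
      using t unfolding set_pmf_iff pmf by (auto simp: add_nonneg_eq_0_iff)
  qed
  then have set: "set_pmf ?\<mu> = {ga, gb, gb', ga * gb}"
    by (auto simp: set_lambda set_kappa)
  show "nondegenerate ?\<mu>"
    by (intro nondegenerateI semigroup_generated.base) (simp_all add: set)
  \<comment> \<open>The defect is quadratic along the segment and vanishes at both ends, so it is a
    constant times \<open>t * (1 - t)\<close>; the constant is nonzero because the segment leaves
    the quadric.\<close>
  have "filling_defect ?\<mu> = - 3 / 32 * (t * (1 - t))"
    unfolding filling_defect_def pmf pmf_lambda pmf_kappa by (simp add: field_simps)
  then have "filling_defect ?\<mu> \<noteq> 0" using t by simp
  then show "\<not> filling ?\<mu>"
    by (subst filling_factor_product_iff) (auto simp: set factor_product_mem)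
qed (simp_all add: set_lambda set_kappa nondegenerate_kappa filling_kappa filling_lambda)

theorem mainTheorem1:
  shows "\<not> (\<forall>\<mu>\<^sub>1 \<mu>\<^sub>2 :: modgrp pmf.
            nondegenerate \<mu>\<^sub>1 \<and> nondegenerate \<mu>\<^sub>2 \<and> nondegenerate (convolution_pmf \<mu>\<^sub>1 \<mu>\<^sub>2) \<and>
            filling \<mu>\<^sub>1 \<and> filling \<mu>\<^sub>2 \<longrightarrow> filling (convolution_pmf \<mu>\<^sub>1 \<mu>\<^sub>2))
       \<and> \<not> (\<forall>(\<mu>\<^sub>1 :: modgrp pmf) (\<mu>\<^sub>2 :: modgrp pmf) (t :: real).
            nondegenerate \<mu>\<^sub>1 \<and> nondegenerate \<mu>\<^sub>2 \<and> 0 < t \<and> t < 1 \<and>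
            nondegenerate (convex_comb_pmf t \<mu>\<^sub>1 \<mu>\<^sub>2) \<and>
            filling \<mu>\<^sub>1 \<and> filling \<mu>\<^sub>2 \<longrightarrow> filling (convex_comb_pmf t \<mu>\<^sub>1 \<mu>\<^sub>2))
       \<and> (\<exists>\<mu>\<^sub>1 \<mu>\<^sub>2 :: modgrp pmf.
            finite (set_pmf \<mu>\<^sub>1) \<and> finite (set_pmf \<mu>\<^sub>2) \<and>
            nondegenerate \<mu>\<^sub>1 \<and> nondegenerate \<mu>\<^sub>2 \<and> nondegenerate (convolution_pmf \<mu>\<^sub>1 \<mu>\<^sub>2) \<and>
            filling \<mu>\<^sub>1 \<and> filling \<mu>\<^sub>2 \<and> \<not> filling (convolution_pmf \<mu>\<^sub>1 \<mu>\<^sub>2))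
       \<and> (\<exists>\<mu>\<^sub>1 \<mu>\<^sub>2 :: modgrp pmf.
            finite (set_pmf \<mu>\<^sub>1) \<and> finite (set_pmf \<mu>\<^sub>2) \<and>
            nondegenerate \<mu>\<^sub>1 \<and> nondegenerate \<mu>\<^sub>2 \<and> filling \<mu>\<^sub>1 \<and> filling \<mu>\<^sub>2 \<and>
            (\<forall>t::real. 0 < t \<and> t < 1 \<longrightarrow>
               nondegenerate (convex_comb_pmf t \<mu>\<^sub>1 \<mu>\<^sub>2) \<and> \<not> filling (convex_comb_pmf t \<mu>\<^sub>1 \<mu>\<^sub>2)))"
proof (intro conjI)
  show "\<exists>\<mu>\<^sub>1 \<mu>\<^sub>2 :: modgrp pmf.
            finite (set_pmf \<mu>\<^sub>1) \<and> finite (set_pmf \<mu>\<^sub>2) \<and>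
            nondegenerate \<mu>\<^sub>1 \<and> nondegenerate \<mu>\<^sub>2 \<and> nondegenerate (convolution_pmf \<mu>\<^sub>1 \<mu>\<^sub>2) \<and>
            filling \<mu>\<^sub>1 \<and> filling \<mu>\<^sub>2 \<and> \<not> filling (convolution_pmf \<mu>\<^sub>1 \<mu>\<^sub>2)"
    by (rule convolution_example)
  then show "\<not> (\<forall>\<mu>\<^sub>1 \<mu>\<^sub>2 :: modgrp pmf.
            nondegenerate \<mu>\<^sub>1 \<and> nondegenerate \<mu>\<^sub>2 \<and> nondegenerate (convolution_pmf \<mu>\<^sub>1 \<mu>\<^sub>2) \<and>
            filling \<mu>\<^sub>1 \<and> filling \<mu>\<^sub>2 \<longrightarrow> filling (convolution_pmf \<mu>\<^sub>1 \<mu>\<^sub>2))"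
    by blast
  show "\<exists>\<mu>\<^sub>1 \<mu>\<^sub>2 :: modgrp pmf.
            finite (set_pmf \<mu>\<^sub>1) \<and> finite (set_pmf \<mu>\<^sub>2) \<and>
            nondegenerate \<mu>\<^sub>1 \<and> nondegenerate \<mu>\<^sub>2 \<and> filling \<mu>\<^sub>1 \<and> filling \<mu>\<^sub>2 \<and>
            (\<forall>t::real. 0 < t \<and> t < 1 \<longrightarrow>
               nondegenerate (convex_comb_pmf t \<mu>\<^sub>1 \<mu>\<^sub>2) \<and> \<not> filling (convex_comb_pmf t \<mu>\<^sub>1 \<mu>\<^sub>2))"
    by (intro exI) (rule convex_combination_example)
  have "(0::real) < 1 / 2" "(1 / 2 :: real) < 1" by simp_all
  then show "\<not> (\<forall>(\<mu>\<^sub>1 :: modgrp pmf) (\<mu>\<^sub>2 :: modgrp pmf) (t :: real).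
            nondegenerate \<mu>\<^sub>1 \<and> nondegenerate \<mu>\<^sub>2 \<and> 0 < t \<and> t < 1 \<and>
            nondegenerate (convex_comb_pmf t \<mu>\<^sub>1 \<mu>\<^sub>2) \<and>
            filling \<mu>\<^sub>1 \<and> filling \<mu>\<^sub>2 \<longrightarrow> filling (convex_comb_pmf t \<mu>\<^sub>1 \<mu>\<^sub>2))"
    using convex_combination_example by blast
qed

end
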